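(* Let $L$ be a finite torsion-free solvable Lie conformal algebra over a field $\Bbbk$ of characteristic zero, and let $H=\Bbbk[D]$. Then $L$ has a finite faithful representation on a free $H$-module.
   Context: $\Bbbk$ is a field of characteristic $0$ and $H=\Bbbk[D]$. A conformal algebra is a left unital $H$-module $L$ with $\Bbbk$-bilinear products $[a_{(n)}b]$, $n\in\mathbb Z_{\ge 0}$, such that for all $a,b\in L$: $[a_{(n)}b]=0$ for almost all $n$; $[(Da)_{(n)}b]=-n[a_{(n-1)}b]$; $[a_{(n)}(Db)]=D[a_{(n)}b]+n[a_{(n-1)}b]$ (products with negative index are zero). It is a Lie conformal algebra if for all $a,b,c\in L$, $n,m\ge 0$: $[a_{(n)}b]=-\sum_{s\ge0}\frac{(-1)^{n+s}}{s!}D^s[b_{(n+s)}a]$ and $[a_{(n)}[b_{(m)}c]]-[b_{(m)}[a_{(n)}c]]=\sum_{s\ge0}\binom ns[[a_{(n-s)}b]_{(m+s)}c]$. It is finite if it is finitely generated as an $H$-module, and torsion-free if it has no torsion as an $H$-module. $L'$ denotes the subspace (an ideal) of $L$ spanned by all $[x_{(n)}y]$, $x,y\in L$, $n\ge0$. Put $L^{(1)}=L$, $L^{(n+1)}=(L^{(n)})'$ for $n\ge 1$; $L$ is solvable if $L^{(n)}=0$ for some $n>1$. A representation of $L$ on an $H$-module $M$ (equivalently, the structure of a conformal $L$-module on $M$) is given by $\Bbbk$-bilinear maps $L\times M\to M$, $(a,v)\mapsto a_{(n)}v$, $n\ge 0$, such that for all $a,b\in L$, $v\in M$, $n,m\ge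 0$: $a_{(n)}v=0$ for almost all $n$; $(Da)_{(n)}v=-n\,a_{(n-1)}v$; $a_{(n)}(Dv)=D(a_{(n)}v)+n\,a_{(n-1)}v$; $a_{(n)}(b_{(m)}v)-b_{(m)}(a_{(n)}v)=\sum_{s\ge0}\binom ns [a_{(n-s)}b]_{(m+s)}v$. It is finite if $M$ is a finitely generated $H$-module, and faithful if $a_{(n)}v=0$ for all $n\ge0$ and all $v\in M$ implies $a=0$. *)

theory Defs
  imports "HOL-Computational_Algebra.Polynomial"
begin

text \<open>
  The ring \<open>H = k[D]\<close> is the type \<^typ>\<open>'k poly\<close> over a field of characteristic 0, so an
  \<open>H\<close>-module is an instance of the library locale \<^locale>\<open>module\<close>. Then \<open>D\<close> acts by
  \<open>scale [:0, 1:]\<close> and a scalar \<open>c\<close> of \<open>k\<close> acts by \<open>scale [:c:]\<close>.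
\<close>

context module
begin

definition finitely_generated :: "'b set \<Rightarrow> bool" where
  "finitely_generated M \<longleftrightarrow> (\<exists>F. finite F \<and> span F = M)"

definition free :: "'b set \<Rightarrow> bool" where
  "free M \<longleftrightarrow> (\<exists>B. independent B \<and> span B = M)"

definition torsion_free :: bool where
  "torsion_free \<longleftrightarrow> (\<forall>r x. scale r x = 0 \<longrightarrow> r = 0 \<or> x = 0)"

end

text \<open>
  \<open>br n a b\<close> is the product \<open>[a\<^sub>(\<^sub>n\<^sub>) b]\<close>. In the two sesquilinearity axioms the truncated
  \<open>n - 1\<close> is harmless: for \<open>n = 0\<close> the coefficient \<open>n\<close> vanishes.
\<close>

locale conformal_algebra = module scale
  for scale :: "'k::field_char_0 poly \<Rightarrow> 'l::ab_group_add \<Rightarrow> 'l" +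
  fixes br :: "nat \<Rightarrow> 'l \<Rightarrow> 'l \<Rightarrow> 'l"
  assumes br_add_left: "br n (a + b) c = br n a c + br n b c"
    and br_add_right: "br n a (b + c) = br n a b + br n a c"
    and br_scale_left: "br n (scale [:r:] a) b = scale [:r:] (br n a b)"
    and br_scale_right: "br n a (scale [:r:] b) = scale [:r:] (br n a b)"
    and br_locality: "finite {n. br n a b \<noteq> 0}"
    and br_D_left: "br n (scale [:0, 1:] a) b = - scale (of_nat n) (br (n - 1) a b)"
    and br_D_right: "br n a (scale [:0, 1:] b) =
          scale [:0, 1:] (br n a b) + scale (of_nat n) (br (n - 1) a b)"
begin

definition derived :: "'l set \<Rightarrow> 'l set" where
  "derived S = module.span (\<lambda>r. scale [:r:]) {br n x y |n x y. x \<in> S \<and> y \<in> S}"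

text \<open>
  The series is indexed from 1: \<open>L\<^sup>(\<^sup>1\<^sup>) = L\<close>. The value at index 0 is not used.
\<close>

definition derived_series :: "nat \<Rightarrow> 'l set" where
  "derived_series n = (derived ^^ (n - 1)) UNIV"

definition solvable :: bool where
  "solvable \<longleftrightarrow> (\<exists>n>1. derived_series n = {0})"

lemma derived_series_1: "derived_series 1 = UNIV"
  by (simp add: derived_series_def)

lemma derived_series_Suc: "n \<ge> 1 \<Longrightarrow> derived_series (Suc n) = derived (derived_series n)"
  by (cases n) (simp_all add: derived_series_def)

end

text \<open>
  In the skew-symmetry axiom the sum runs over the indices \<open>s\<close> whose product is nonzero, a finite
  set by locality; \<open>monom c s\<close> is \<open>c D\<^sup>s\<close>. In the Jacobi identity the terms with \<open>s > n\<close> vanish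
  because \<open>n choose s = 0\<close>.
\<close>

locale lie_conformal_algebra = conformal_algebra scale br
  for scale :: "'k::field_char_0 poly \<Rightarrow> 'l::ab_group_add \<Rightarrow> 'l"
    and br :: "nat \<Rightarrow> 'l \<Rightarrow> 'l \<Rightarrow> 'l" +
  assumes br_skew: "br n a b =
      - (\<Sum>s | br (n + s) b a \<noteq> 0. scale (monom ((-1) ^ (n + s) / fact s) s) (br (n + s) b a))"
    and br_jacobi: "br n a (br m b c) - br m b (br n a c) =
      (\<Sum>s\<le>n. scale (of_nat (n choose s)) (br (m + s) (br (n - s) a b) c))"

text \<open>
  A representation on an \<open>H\<close>-submodule \<open>M\<close> of an ambient \<open>H\<close>-module (with scalar multiplication
  \<open>scaleM\<close>). The carrier \<open>M\<close> is a set rather than a type so that one can assert the existence of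
  a representation. The values of \<open>act n a v\<close> for \<open>v\<close> outside \<open>M\<close> are irrelevant.
\<close>

locale conformal_representation = L: lie_conformal_algebra scale br + M: module scaleM
  for scale :: "'k::field_char_0 poly \<Rightarrow> 'l::ab_group_add \<Rightarrow> 'l"
    and br :: "nat \<Rightarrow> 'l \<Rightarrow> 'l \<Rightarrow> 'l"
    and scaleM :: "'k poly \<Rightarrow> 'm::ab_group_add \<Rightarrow> 'm" +
  fixes M :: "'m set"
    and act :: "nat \<Rightarrow> 'l \<Rightarrow> 'm \<Rightarrow> 'm"
  assumes submodule: "M.subspace M"
    and act_closed: "v \<in> M \<Longrightarrow> act n a v \<in> M"
    and act_add_left: "v \<in> M \<Longrightarrow> act n (a + b) v = act n a v + act n b v"
    and act_add_right: "v \<in> M \<Longrightarrow> w \<in> M \<Longrightarrow> act n a (v + w) = act n a v + act n a w"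
    and act_scale_left: "v \<in> M \<Longrightarrow> act n (scale [:r:] a) v = scaleM [:r:] (act n a v)"
    and act_scale_right: "v \<in> M \<Longrightarrow> act n a (scaleM [:r:] v) = scaleM [:r:] (act n a v)"
    and act_locality: "v \<in> M \<Longrightarrow> finite {n. act n a v \<noteq> 0}"
    and act_D_left: "v \<in> M \<Longrightarrow>
          act n (scale [:0, 1:] a) v = - scaleM (of_nat n) (act (n - 1) a v)"
    and act_D_right: "v \<in> M \<Longrightarrow> act n a (scaleM [:0, 1:] v) =
          scaleM [:0, 1:] (act n a v) + scaleM (of_nat n) (act (n - 1) a v)"
    and act_jacobi: "v \<in> M \<Longrightarrow> act n a (act m b v) - act m b (act n a v) =
          (\<Sum>s\<le>n. scaleM (of_nat (n choose s)) (act (m + s) (br (n - s) a b) v))"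

definition faithful :: "'m::zero set \<Rightarrow> (nat \<Rightarrow> 'l::zero \<Rightarrow> 'm \<Rightarrow> 'm) \<Rightarrow> bool" where
  "faithful M act \<longleftrightarrow> (\<forall>a. (\<forall>n. \<forall>v\<in>M. act n a v = 0) \<longrightarrow> a = 0)"

text \<open>
  The ambient module for existence statements: \<^typ>\<open>'k poly poly\<close> with \<^const>\<open>smult\<close> is the free
  \<open>H\<close>-module of countable rank (basis: the powers of the outer variable). Every free
  \<open>H\<close>-module of finite rank is isomorphic to one of its submodules, so restricting to submodules
  of it loses no generality. The multiplication of \<^typ>\<open>'k poly poly\<close> plays no role.
\<close>

lemma module_smult: "module (smult :: 'a::comm_ring_1 \<Rightarrow> 'a poly \<Rightarrow> 'a poly)"
  by unfold_locales (simp_all add: smult_add_right smult_add_left)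

end

theory Submission
  imports Defs "HOL-Library.Function_Algebras" "HOL-Computational_Algebra.Formal_Power_Series"
begin

text \<open>
  The maps \<open>b \<mapsto> a\<^sub>(\<^sub>n\<^sub>) b\<close> are the action of \<open>a t\<^sup>n\<close> in the annihilation algebra \<open>A\<close>, the Lie
  algebra \<open>L[t] / (D + d/dt) L[t]\<close>. If a finite-dimensional representation \<open>W\<close> of \<open>A\<close> is killed
  by \<open>a t\<^sup>n\<close> for large \<open>n\<close>, the induced module \<open>k[D] \<otimes> W\<close> is a finite free \<open>L\<close>-module; it is
  faithful when no \<open>a \<noteq> 0\<close> has all \<open>a t\<^sup>n\<close> acting by zero. To find such a \<open>W\<close>:

  By induction on the derived series, \<open>L\<close> is generated over \<open>k[D]\<close> by a finite-dimensional subspace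
  \<open>V\<close> with \<open>[L\<^sub>(\<^sub>n\<^sub>) V] \<subseteq> V\<close>. Then \<open>t\<^sup>N V[t]\<close> spans an ideal of finite codimension in \<open>A\<close>, and since
  \<open>L\<close> is torsion-free, for large \<open>N\<close> no \<open>a \<noteq> 0\<close> has all \<open>a t\<^sup>n\<close> in it. The quotient is a
  finite-dimensional solvable Lie algebra, to which Ado's theorem applies.

  Ado's theorem over an arbitrary field of characteristic 0 is obtained without enveloping algebras.
  The derived algebra acts nilpotently, so one can adjoin one element \<open>x\<close> at a time to an ideal
  \<open>J\<close>: on the power series \<open>W[[t]]\<close> let \<open>a \<in> J\<close> act as \<open>exp (t ad x) a\<close> and \<open>x\<close> as \<open>d/dt\<close>. The
  nilpotency confines everything to a finite-dimensional submodule.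
\<close>

section \<open>Linear algebra modulo a subspace\<close>

text \<open>A subspace \<open>V\<close> as above is special to the solvable case: in the Virasoro
  algebra with generator \<open>l\<close> one has \<open>[l_(0) v] = D v\<close>, so a nonzero
  stable subspace would be closed under \<open>D\<close>. The proof studies, modulo an ideal, the
  sum of all finite-dimensional stable subspaces, and shows that vectors killed by all products of
  high index already lie in it.

  Over a field that is not algebraically closed, common eigenvectors may be missing. Nilpotency of
  the derived algebra is therefore proved on composition factors of the adjoint module, with
  annihilating polynomials and traces.

  Adjoining \<open>x\<close> preserves faithfulness because the constant series return the old
  representation while \<open>d/dt\<close> sends \<open>t w\<close> to \<open>w\<close>. Finite
  dimension is the delicate point: if \<open>[x, a] = a\<close>, then \<open>a\<close> acts as
  \<open>e^t \<rho>(a)\<close>, and its powers applied to a constant span a finite-dimensional space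
  only where \<open>\<rho>(a)\<close> is nilpotent. Hence a flag witnessing nilpotency belongs to
  the induction hypothesis.

  The bound \<open>N\<close> comes from torsion-freeness: \<open>L\<close> embeds in a free
  \<open>k[D]\<close>-module, and \<open>N\<close> exceeds the degrees of the coordinates of the
  generators.\<close>

locale char0_space = vector_space scale
  for scale :: "'a::field_char_0 \<Rightarrow> 'b::ab_group_add \<Rightarrow> 'b" (infixr "*s" 75)
begin

definition finite_over :: "'b set \<Rightarrow> 'b set \<Rightarrow> bool" where
  "finite_over U V \<longleftrightarrow> (\<exists>B. finite B \<and> V \<subseteq> span (U \<union> B))"

lemma finite_over_mono: "finite_over U V \<Longrightarrow> U \<subseteq> U' \<Longrightarrow> V' \<subseteq> V \<Longrightarrow> finite_over U' V'"
  unfolding finite_over_def by (meson Un_mono dual_order.trans order_refl span_mono)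

text \<open>A basis of \<open>V / U\<close> lifted to \<open>V\<close>, with its dual functionals.
  The functionals are linear on the whole space, so they can be applied without membership
  conditions.\<close>

definition relative_basis :: "'b set \<Rightarrow> 'b set \<Rightarrow> 'b set \<Rightarrow> ('b \<Rightarrow> 'b \<Rightarrow> 'a) \<Rightarrow> bool" where
  "relative_basis U V B \<xi> \<longleftrightarrow> finite B \<and> B \<subseteq> V \<and>
    (\<forall>b x y. \<xi> b (x + y) = \<xi> b x + \<xi> b y) \<and> (\<forall>b c x. \<xi> b (c *s x) = c * \<xi> b x) \<and>
    (\<forall>b\<in>B. \<forall>u\<in>U. \<xi> b u = 0) \<and> (\<forall>b\<in>B. \<forall>b'\<in>B. \<xi> b b' = (if b = b' then 1 else 0)) \<and>
    (\<forall>v\<in>V. v - (\<Sum>b\<in>B. \<xi> b v *s b) \<in> U)"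

lemma relative_basisD:
  assumes "relative_basis U V B \<xi>"
  shows "finite B" "B \<subseteq> V" "\<xi> b (x + y) = \<xi> b x + \<xi> b y" "\<xi> b (c *s x) = c * \<xi> b x"
    "b \<in> B \<Longrightarrow> u \<in> U \<Longrightarrow> \<xi> b u = 0"
    "b \<in> B \<Longrightarrow> b' \<in> B \<Longrightarrow> \<xi> b b' = (if b = b' then 1 else 0)"
    "v \<in> V \<Longrightarrow> v - (\<Sum>b\<in>B. \<xi> b v *s b) \<in> U"
  using assms unfolding relative_basis_def by blast+

lemma relative_basis_exists:
  assumes U: "subspace U" and V: "subspace V" and UV: "U \<subseteq> V" and fin: "finite_over U V"
  obtains B \<xi> where "relative_basis U V B \<xi>"
proof -
  interpret vector_space_pair scale scale by unfold_locales
  obtain B0 where B0: "B0 \<subseteq> U" "independent B0" "U \<subseteq> span B0"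
    by (rule maximal_independent_subset)
  obtain B1 where B1: "B0 \<subseteq> B1" "B1 \<subseteq> V" "independent B1" "V \<subseteq> span B1"
    by (rule maximal_independent_subset_extend[of B0 V]) (use B0 UV in auto)
  obtain B2 where B2: "B1 \<subseteq> B2" "independent B2" "UNIV \<subseteq> span B2"
    by (rule maximal_independent_subset_extend[of B1 UNIV]) (use B1 in auto)
  have sp: "v \<in> span B2" for v using B2 by blast
  define B where "B = B1 - B0"
  define \<xi> where "\<xi> b v = representation B2 v b" for b v
  obtain C where C: "finite C" "V \<subseteq> span (U \<union> C)" using fin finite_over_def by blast
  obtain g where g: "Vector_Spaces.linear scale scale g" "\<forall>x\<in>B1. g x = (if x \<in> B0 then 0 else x)"
    using linear_independent_extend[OF B1(3), of "\<lambda>x. if x \<in> B0 then 0 else x"] by (elim exE conjE)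
  interpret g: Vector_Spaces.linear scale scale g by fact
  have g0: "g u = 0" if "u \<in> U" for u
    by (rule g.eq_0_on_span[of B0]) (use that B0 B1(1) g(2) in auto)
  have "B \<subseteq> span (g ` C)"
  proof
    fix b assume b: "b \<in> B"
    then have "g b = b" using g(2) by (auto simp: B_def)
    moreover have "g b \<in> span (g ` (U \<union> C))"
      using C(2) b B1(2) unfolding g.span_image B_def by blast
    moreover have "span (g ` (U \<union> C)) \<subseteq> span (g ` C)"
      by (rule span_minimal) (auto simp: g0 span_zero intro: span_base)
    ultimately show "b \<in> span (g ` C)" by auto
  qed
  moreover have iB: "independent B" using B1(3) B_def independent_mono by blast
  ultimately have fB: "finite B" using independent_span_bound[of "g ` C" B] C(1) by blast
  have xi_U: "\<xi> b u = 0" if "b \<in> B" "u \<in> U" for b u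
  proof -
    have "representation B2 u = representation B0 u"
      by (rule representation_extend) (use B0 B1 B2 that in auto)
    then show ?thesis
      using representation_ne_zero[of B0 u b] that by (auto simp: \<xi>_def B_def)
  qed
  have xi_B: "\<xi> b b' = (if b = b' then 1 else 0)" if "b' \<in> B" for b b'
    using representation_basis[OF B2(2), of b'] that B2(1) by (auto simp: \<xi>_def B_def)
  have lin1: "\<xi> b (x + y) = \<xi> b x + \<xi> b y" for b x y
    by (simp add: \<xi>_def representation_add[OF B2(2) sp sp])
  have lin2: "\<xi> b (c *s x) = c * \<xi> b x" for b c x
    by (simp add: \<xi>_def representation_scale[OF B2(2) sp])
  have dec: "v - (\<Sum>b\<in>B. \<xi> b v *s b) \<in> U" if "v \<in> V" for v
  proof -
    have "B0 \<union> B = B1" using B1(1) by (auto simp: B_def)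
    then have "v \<in> span (B0 \<union> B)" using that B1(4) by auto
    then obtain x y where xy: "v = x + y" "x \<in> span B0" "y \<in> span B"
      by (auto simp: span_Un)
    have xU: "x \<in> U" using xy(2) B0(1) U span_minimal by blast
    obtain c where c: "y = (\<Sum>b\<in>B. c b *s b)" using xy(3) fB by (auto simp: span_finite)
    have xi_sum: "\<xi> b (sum f A) = (\<Sum>a\<in>A. \<xi> b (f a))" if "finite A" for b f and A :: "'b set"
      using that by (induction A rule: finite_induct) (auto simp: lin1, simp add: \<xi>_def representation_zero)
    have "\<xi> b v = c b" if "b \<in> B" for b
    proof -
      have "\<xi> b y = (\<Sum>b'\<in>B. if b = b' then c b' else 0)"
        unfolding c xi_sum[OF fB] by (rule sum.cong) (auto simp: lin2 xi_B)
      then show ?thesis using that fB by (simp add: xy lin1 xi_U xU)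
    qed
    then have "(\<Sum>b\<in>B. \<xi> b v *s b) = y" unfolding c by simp
    then show ?thesis using xy xU by simp
  qed
  show thesis
    by (rule that[of B \<xi>], unfold relative_basis_def)
      (use fB B1 xi_U xi_B lin1 lin2 dec B_def in auto)
qed

section \<open>Codimension and extremal subspaces\<close>

definition codim :: "'b set \<Rightarrow> nat" where
  "codim U = (LEAST n. \<exists>B. finite B \<and> card B = n \<and> span (U \<union> B) = UNIV)"

lemma codim_witness:
  assumes "finite_over K UNIV" "K \<subseteq> U"
  obtains B where "finite B" "card B = codim U" "span (U \<union> B) = UNIV"
proof -
  have "finite_over U UNIV" using assms finite_over_mono by blast
  then obtain B where "finite B" "span (U \<union> B) = UNIV" unfolding finite_over_def by blast
  then have "\<exists>n B. finite B \<and> card B = n \<and> span (U \<union> B) = UNIV" by blast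
  from LeastI_ex[OF this] show thesis using that unfolding codim_def by blast
qed

lemma codim_less:
  assumes fin: "finite_over K UNIV" and KU: "K \<subseteq> U" and U: "subspace U" and V: "subspace V"
    and UV: "U \<subset> V"
  shows "codim V < codim U"
proof -
  obtain B where B: "finite B" "card B = codim U" "span (U \<union> B) = UNIV"
    using codim_witness[OF fin KU] .
  obtain v where v: "v \<in> V" "v \<notin> U" using UV by blast
  have "v \<in> span (U \<union> B)" using B by auto
  then obtain u y where uy: "v = u + y" "u \<in> U" "y \<in> span B"
    unfolding span_Un span_eq_iff[THEN iffD2, OF U] by auto
  obtain c where c: "y = (\<Sum>b\<in>B. c b *s b)" using uy(3) B(1) by (auto simp: span_finite)
  have "y \<noteq> 0" using uy v by auto
  then obtain b where b: "b \<in> B" "c b \<noteq> 0" using c by (metis (mono_tags, lifting) scale_zero_left sum.neutral)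
  let ?S = "span (V \<union> (B - {b}))"
  have "c b *s b = y - (\<Sum>b\<in>B - {b}. c b *s b)" using c b B(1) by (simp add: sum.remove)
  moreover have "y \<in> ?S"
  proof -
    have "v \<in> ?S" "u \<in> ?S" using uy(2) v(1) UV by (auto intro!: span_base)
    then have "v - u \<in> ?S" by (rule span_diff)
    then show ?thesis by (simp add: uy(1))
  qed
  moreover have "(\<Sum>b\<in>B - {b}. c b *s b) \<in> ?S" by (intro span_sum span_scale span_base) auto
  ultimately have "c b *s b \<in> ?S" by (simp add: span_diff)
  then have "inverse (c b) *s (c b *s b) \<in> ?S" by (rule span_scale)
  then have "b \<in> ?S" using b by simp
  then have "U \<union> B \<subseteq> ?S" using UV by (auto intro: span_base)
  then have "?S = UNIV" using B(3) span_mono span_span by (metis UNIV_I subsetI subset_antisym)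
  then have "codim V \<le> card (B - {b})" unfolding codim_def
    by (intro Least_le) (use B(1) in auto)
  then show ?thesis using B b by (metis card_Diff1_less le_less_trans)
qed

text \<open>Serves as a chain condition for an arbitrary predicate: subspaces containing
  \<open>K\<close> have finite codimension, and \<open>codim\<close> drops strictly along proper
  inclusions, so a member of least codimension is maximal. Minimal members exist dually, because
  \<open>codim K\<close> bounds all codimensions.\<close>

lemma maximal_subspace:
  assumes fin: "finite_over K UNIV" and P: "\<And>U. P U \<Longrightarrow> subspace U \<and> K \<subseteq> U" and "P U0"
  shows "\<exists>U. P U \<and> (\<forall>V. P V \<longrightarrow> U \<subseteq> V \<longrightarrow> V = U)"
proof -
  from ex_has_least_nat[of P U0 codim] \<open>P U0\<close>
  obtain U where U: "P U" "\<And>V. P V \<Longrightarrow> codim U \<le> codim V" by blast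
  show ?thesis
    by (rule exI[of _ U]) (metis U P codim_less[OF fin] leD psubsetI)
qed

lemma minimal_subspace:
  assumes fin: "finite_over K UNIV" and P: "\<And>U. P U \<Longrightarrow> subspace U \<and> K \<subseteq> U" and "P U0"
  shows "\<exists>U. P U \<and> (\<forall>V. P V \<longrightarrow> V \<subseteq> U \<longrightarrow> V = U)"
proof -
  have bd: "codim V \<le> codim K" if "P V" for V
  proof -
    obtain B where B: "finite B" "card B = codim K" "span (K \<union> B) = UNIV"
      using codim_witness[OF fin order_refl] .
    have "span (V \<union> B) = UNIV" using B(3) P[OF that] span_mono[of "K \<union> B" "V \<union> B"] by blast
    then show ?thesis unfolding codim_def[of V] B(2)[symmetric]
      by (intro Least_le) (use B(1) in auto)
  qed
  from ex_has_greatest_nat[of P U0 codim] \<open>P U0\<close> bd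
  obtain U where U: "P U" "\<And>V. P V \<Longrightarrow> codim V \<le> codim U" by (metis less_Suc_eq_le)
  show ?thesis
    by (rule exI[of _ U]) (metis U P codim_less[OF fin] leD psubsetI)
qed

section \<open>Polynomials in an endomorphism\<close>

definition peval :: "'a poly \<Rightarrow> ('b \<Rightarrow> 'b) \<Rightarrow> 'b \<Rightarrow> 'b" where
  "peval p T v = (\<Sum>i\<le>degree p. coeff p i *s (T ^^ i) v)"

lemma peval_upto: "degree p \<le> n \<Longrightarrow> peval p T v = (\<Sum>i\<le>n. coeff p i *s (T ^^ i) v)"
  unfolding peval_def by (rule sum.mono_neutral_left) (auto simp: coeff_eq_0)

lemma peval_0 [simp]: "peval 0 T v = 0"
  by (simp add: peval_def)

lemma peval_add: "peval (p + q) T v = peval p T v + peval q T v"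
proof -
  define n where "n = max (degree p) (degree q)"
  have "degree p \<le> n" "degree q \<le> n" "degree (p + q) \<le> n"
    by (auto simp: n_def degree_add_le)
  then show ?thesis by (simp add: peval_upto scale_left_distrib sum.distrib)
qed

lemma peval_smult: "peval (smult c p) T v = c *s peval p T v"
  using degree_smult_le[of c p] by (simp add: peval_upto[of _ "degree p"] scale_sum_right)

lemma peval_monom: "peval (monom 1 n) T v = (T ^^ n) v"
proof -
  have "peval (monom 1 n) T v = (\<Sum>i\<in>{n}. coeff (monom 1 n) i *s (T ^^ i) v)"
    unfolding peval_upto[OF degree_monom_le] by (rule sum.mono_neutral_right) auto
  then show ?thesis by simp
qed

end

locale endomorphism = char0_space scale for scale :: "'a::field_char_0 \<Rightarrow> 'b::ab_group_add \<Rightarrow> 'b" (infixr "*s" 75) +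
  fixes T :: "'b \<Rightarrow> 'b" and U V :: "'b set"
  assumes T_add: "T (x + y) = T x + T y" and T_scale: "T (c *s x) = c *s T x"
    and U: "subspace U" and V: "subspace V" and UV: "U \<subseteq> V"
    and TU: "u \<in> U \<Longrightarrow> T u \<in> U" and TV: "u \<in> V \<Longrightarrow> T u \<in> V"
    and fin: "finite_over U UNIV"
begin

lemma T_0: "T 0 = 0" using T_scale[of 0 0] by simp

lemma T_sum: "T (sum f A) = (\<Sum>a\<in>A. T (f a))"
  by (induction A rule: infinite_finite_induct) (auto simp: T_add T_0)

lemma Ti_add: "(T ^^ i) (x + y) = (T ^^ i) x + (T ^^ i) y"
  by (induction i) (auto simp: T_add)

lemma Ti_scale: "(T ^^ i) (c *s x) = c *s (T ^^ i) x"
  by (induction i) (auto simp: T_scale)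

lemma TiV: "u \<in> V \<Longrightarrow> (T ^^ i) u \<in> V"
  by (induction i) (auto simp: TV)

lemma TiU: "u \<in> U \<Longrightarrow> (T ^^ i) u \<in> U"
  by (induction i) (auto simp: TU)

lemma peval_linear: "peval p T (x + y) = peval p T x + peval p T y" "peval p T (c *s x) = c *s peval p T x"
  by (simp_all add: peval_def Ti_add Ti_scale scale_right_distrib sum.distrib scale_sum_right mult.commute)

lemma pevalU: "u \<in> U \<Longrightarrow> peval p T u \<in> U"
  unfolding peval_def by (intro subspace_sum subspace_scale U TiU)

lemma pevalV: "u \<in> V \<Longrightarrow> peval p T u \<in> V"
  unfolding peval_def by (intro subspace_sum subspace_scale V TiV)

lemma peval_pCons: "peval (pCons a p) T v = a *s v + T (peval p T v)"
proof -
  have "peval (pCons a p) T v = (\<Sum>i\<le>Suc (degree p). coeff (pCons a p) i *s (T ^^ i) v)"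
    by (rule peval_upto) (simp add: degree_pCons_le)
  also have "\<dots> = a *s v + T (peval p T v)"
    by (subst sum.atMost_Suc_shift) (simp add: peval_def T_sum T_scale)
  finally show ?thesis .
qed

lemma peval_mult: "peval (p * q) T v = peval p T (peval q T v)"
  by (induction p) (simp_all add: peval_pCons mult_pCons_left peval_add peval_smult)

text \<open>The spans of \<open>v, T v, ..., T^(n-1) v\<close> together with \<open>U\<close>
  increase and must stop growing. Then \<open>T^n v\<close> is congruent to a combination of lower
  iterates; keeping that combination in degrees below \<open>n\<close> makes the difference monic,
  hence nonzero.\<close>

lemma vector_annihilated:
  assumes v: "v \<in> V"
  shows "\<exists>p. p \<noteq> 0 \<and> peval p T v \<in> U"
proof -
  define S where "S n = span (U \<union> (\<lambda>i. (T ^^ i) v) ` {..<n})" for n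
  have "subspace Y \<and> U \<subseteq> Y" if "Y \<in> range S" for Y
    using that by (auto simp: S_def intro: span_base)
  then obtain Y where Y: "Y \<in> range S" "\<And>Z. Z \<in> range S \<Longrightarrow> Y \<subseteq> Z \<Longrightarrow> Z = Y"
    using maximal_subspace[OF fin, of "\<lambda>Y. Y \<in> range S" "S 0"] by auto
  then obtain n where n: "Y = S n" by blast
  have "S n \<subseteq> S (Suc n)" unfolding S_def by (rule span_mono) auto
  then have "S (Suc n) = S n" using Y n by blast
  moreover have "(T ^^ n) v \<in> S (Suc n)" unfolding S_def by (rule span_base) simp
  ultimately have "(T ^^ n) v \<in> S n" by simp
  moreover have "\<exists>p. (\<forall>i\<ge>n. coeff p i = 0) \<and> w - peval p T v \<in> U" if "w \<in> S n" for w
    using that unfolding S_def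
  proof (induction rule: span_induct_alt)
    case base
    show ?case by (rule exI[of _ 0]) (simp add: subspace_0[OF U])
  next
    case (step c x y)
    then obtain p where p: "\<forall>i\<ge>n. coeff p i = 0" "y - peval p T v \<in> U" by blast
    from step(1) show ?case
    proof
      assume "x \<in> U"
      then have "c *s x + (y - peval p T v) \<in> U" by (intro subspace_add[OF U] subspace_scale[OF U] p)
      then show ?thesis using p(1) by (auto simp: algebra_simps)
    next
      assume "x \<in> (\<lambda>i. (T ^^ i) v) ` {..<n}"
      then obtain i where i: "x = (T ^^ i) v" "i < n" by blast
      have "c *s x + y - peval (smult c (monom 1 i) + p) T v \<in> U"
        unfolding peval_add peval_smult peval_monom i(1) using p(2) by (simp add: algebra_simps)
      moreover have "\<forall>k\<ge>n. coeff (smult c (monom 1 i) + p) k = 0" using p(1) i(2) by simp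
      ultimately show ?thesis by blast
    qed
  qed
  ultimately obtain p where p: "\<forall>i\<ge>n. coeff p i = 0" "(T ^^ n) v - peval p T v \<in> U" by blast
  have "coeff (monom 1 n + smult (- 1) p) n \<noteq> 0" using p(1) by simp
  then have "monom 1 n + smult (- 1) p \<noteq> 0" by (metis coeff_0)
  moreover have "peval (monom 1 n + smult (- 1) p) T v \<in> U"
    using p(2) unfolding peval_add peval_smult peval_monom by simp
  ultimately show ?thesis by blast
qed

lemma annihilated:
  obtains p where "p \<noteq> 0" "\<And>v. v \<in> V \<Longrightarrow> peval p T v \<in> U"
proof -
  obtain B \<xi> where "relative_basis U V B \<xi>"
    by (rule relative_basis_exists[OF U V UV finite_over_mono[OF fin order_refl subset_UNIV]])
  note B = relative_basisD[OF this]
  have "\<forall>b\<in>B. \<exists>p. p \<noteq> 0 \<and> peval p T b \<in> U" using B(2) vector_annihilated by blast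
  then obtain q where q: "\<And>b. b \<in> B \<Longrightarrow> q b \<noteq> 0 \<and> peval (q b) T b \<in> U" by metis
  define p where "p = (\<Prod>b\<in>B. q b)"
  have "p \<noteq> 0" using q B(1) by (simp add: p_def)
  moreover have pb: "peval p T b \<in> U" if "b \<in> B" for b
  proof -
    have "p = (\<Prod>b\<in>B-{b}. q b) * q b" using that B(1) by (simp add: p_def prod.remove mult.commute)
    then show ?thesis using that q by (simp add: peval_mult pevalU)
  qed
  have "peval p T v \<in> U" if v: "v \<in> V" for v
  proof -
    have "peval p T v = peval p T (v - (\<Sum>b\<in>B. \<xi> b v *s b)) + peval p T (\<Sum>b\<in>B. \<xi> b v *s b)"
      by (simp flip: peval_linear(1))
    also have "peval p T (\<Sum>b\<in>B. \<xi> b v *s b) = (\<Sum>b\<in>B. \<xi> b v *s peval p T b)"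
      using B(1) by (induction B rule: finite_induct)
        (use peval_linear(2)[of p 0 0] in \<open>auto simp: peval_linear\<close>)
    finally show ?thesis
      by (simp add: subspace_add[OF U] subspace_sum[OF U] subspace_scale[OF U] pevalU[OF B(7)[OF v]] pb)
  qed
  ultimately show thesis using that by blast
qed

end

section \<open>Nilpotency of the derived algebra\<close>

text \<open>
  \<open>UNIV / K\<close> is a finite-dimensional Lie algebra. Keeping \<open>K\<close> instead of passing to the quotient
  avoids quotient types; it costs skew-symmetry, which holds modulo \<open>K\<close> only.
\<close>

locale leibniz_mod = char0_space scale
  for scale :: "'a::field_char_0 \<Rightarrow> 'g::ab_group_add \<Rightarrow> 'g" (infixr "*s" 75) +
  fixes b :: "'g \<Rightarrow> 'g \<Rightarrow> 'g" and K :: "'g set"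
  assumes b_add_left: "b (x + y) z = b x z + b y z"
    and b_add_right: "b x (y + z) = b x y + b x z"
    and b_scale_left: "b (c *s x) y = c *s b x y"
    and b_scale_right: "b x (c *s y) = c *s b x y"
    and leibniz: "b x (b y z) = b (b x y) z + b y (b x z)"
    and skew: "b x y + b y x \<in> K"
    and K: "subspace K"
    and K_right: "k \<in> K \<Longrightarrow> b x k \<in> K"
    and finite_K: "finite_over K UNIV"
begin

lemma b_0_left [simp]: "b 0 x = 0" using b_scale_left[of 0 0 x] by simp
lemma b_0_right [simp]: "b x 0 = 0" using b_scale_right[of x 0 0] by simp
lemma b_minus_left: "b (- x) y = - b x y" using b_scale_left[of "- 1" x y] by simp
lemma b_minus_right: "b x (- y) = - b x y" using b_scale_right[of x "- 1" y] by simp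
lemma b_diff_right: "b x (y - z) = b x y - b x z"
  using b_add_right[of x y "- z"] by (simp add: b_minus_right)
lemma b_sum_right: "b y (sum f A) = (\<Sum>a\<in>A. b y (f a))"
  by (induction A rule: infinite_finite_induct) (auto simp: b_add_right)

lemma K_left: "k \<in> K \<Longrightarrow> b k x \<in> K"
  using subspace_diff[OF K skew[of k x] K_right[of k x]] by simp

definition left_sub :: "'g set \<Rightarrow> bool" where
  "left_sub U \<longleftrightarrow> subspace U \<and> K \<subseteq> U \<and> (\<forall>x. \<forall>u\<in>U. b x u \<in> U)"

lemma left_subD: "left_sub U \<Longrightarrow> subspace U" "left_sub U \<Longrightarrow> K \<subseteq> U" "left_sub U \<Longrightarrow> u \<in> U \<Longrightarrow> b x u \<in> U"
  by (auto simp: left_sub_def)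

definition dser :: "nat \<Rightarrow> 'g set" where
  "dser n = ((\<lambda>S. span {b x y |x y. x \<in> S \<and> y \<in> S}) ^^ n) UNIV"

lemma dser_0 [simp]: "dser 0 = UNIV" by (simp add: dser_def)
lemma dser_Suc: "dser (Suc n) = span {b x y |x y. x \<in> dser n \<and> y \<in> dser n}" by (simp add: dser_def)

lemma subspace_dser: "subspace (dser n)" by (cases n) (auto simp: dser_Suc)

lemma dser_bracket: "x \<in> dser n \<Longrightarrow> y \<in> dser n \<Longrightarrow> b x y \<in> dser (Suc n)"
  by (auto simp: dser_Suc intro: span_base)

lemma dser_right: "z \<in> dser n \<Longrightarrow> b x z \<in> dser n"
proof (induction n arbitrary: z)
  case (Suc n)
  from Suc.prems show ?case
    unfolding dser_Suc
  proof (induction rule: span_induct_alt)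
    case (step c z y)
    then obtain u v where uv: "z = b u v" "u \<in> dser n" "v \<in> dser n" by blast
    have "b x z \<in> dser (Suc n)" unfolding uv(1) leibniz[of x]
      by (intro subspace_add[OF subspace_dser] dser_bracket uv Suc.IH)
    then show ?case using step(2) by (simp add: b_add_right b_scale_right span_add span_scale dser_Suc)
  qed (simp add: span_zero)
qed simp

lemma dser_1: "b x y \<in> dser (Suc 0)"
  using dser_bracket[of x 0 y] by simp

text \<open>The preimage of the derived algebra of \<open>UNIV / K\<close>. The name anticipates
  \<open>nil_ad_nilpotent\<close>.\<close>

definition nil :: "'g set" where "nil = span (K \<union> dser (Suc 0))"

lemma subspace_nil: "subspace nil" by (simp add: nil_def)
lemma K_nil: "K \<subseteq> nil" by (auto simp: nil_def intro: span_base)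
lemma b_nil: "b x y \<in> nil" using dser_1 by (auto simp: nil_def intro: span_base)

end

text \<open>\<open>V / U\<close> is an irreducible constituent of the adjoint module, and
  \<open>I\<close> is a set stable under the adjoint action whose elements act on
  \<open>V / U\<close> by commuting operators. The goal is that \<open>I\<close> acts by zero once
  it consists of sums of brackets.\<close>

locale composition_factor = leibniz_mod scale b K
  for scale :: "'a::field_char_0 \<Rightarrow> 'g::ab_group_add \<Rightarrow> 'g" (infixr "*s" 75) and b K +
  fixes U V I :: "'g set"
  assumes lU: "left_sub U" and lV: "left_sub V" and psub: "U \<subset> V"
    and minimal: "left_sub W \<Longrightarrow> U \<subset> W \<Longrightarrow> W \<subseteq> V \<Longrightarrow> W = V"
    and I: "x \<in> I \<Longrightarrow> b y x \<in> I"
    and I_comm: "x \<in> I \<Longrightarrow> y \<in> I \<Longrightarrow> v \<in> V \<Longrightarrow> b x (b y v) - b y (b x v) \<in> U"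
begin

definition cong (infix "\<approx>" 50) where "x \<approx> y \<longleftrightarrow> x - y \<in> U"

lemmas sU = left_subD(1)[OF lU] and sV = left_subD(1)[OF lV] and KU = left_subD(2)[OF lU]
lemmas bU = left_subD(3)[OF lU] and bV = left_subD(3)[OF lV]

lemma UV': "U \<subseteq> V" using psub by auto

lemma cong_refl [simp]: "x \<approx> x" by (simp add: cong_def subspace_0 sU)
lemma cong_trans [trans]: "x \<approx> y \<Longrightarrow> y \<approx> z \<Longrightarrow> x \<approx> z"
  unfolding cong_def using subspace_add[OF sU, of "x - y" "y - z"] by simp
lemma cong_eq_trans [trans]: "x \<approx> y \<Longrightarrow> y = z \<Longrightarrow> x \<approx> z" by simp
lemma eq_cong_trans [trans]: "x = y \<Longrightarrow> y \<approx> z \<Longrightarrow> x \<approx> z" by simp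
lemma cong_sym: "x \<approx> y \<Longrightarrow> y \<approx> x"
  unfolding cong_def using subspace_neg[OF sU, of "x - y"] by simp
lemma cong_add: "x \<approx> y \<Longrightarrow> x' \<approx> y' \<Longrightarrow> x + x' \<approx> y + y'"
  unfolding cong_def using subspace_add[OF sU, of "x - y" "x' - y'"] by (simp add: algebra_simps)
lemma cong_scale: "x \<approx> y \<Longrightarrow> c *s x \<approx> c *s y"
  unfolding cong_def using subspace_scale[OF sU, of "x - y" c] by (simp add: scale_right_diff_distrib)
lemma cong_b: "x \<approx> y \<Longrightarrow> b z x \<approx> b z y"
  unfolding cong_def using bU[of "x - y" z] by (simp add: b_diff_right)
lemma cong_U: "x \<approx> y \<Longrightarrow> x \<in> U \<longleftrightarrow> y \<in> U"
  unfolding cong_def by (metis sU subspace_diff subspace_add diff_add_cancel diff_diff_eq2 add_diff_cancel_left')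
lemma cong_sum: "(\<And>a. a \<in> A \<Longrightarrow> f a \<approx> g a) \<Longrightarrow> sum f A \<approx> sum g A"
  by (induction A rule: infinite_finite_induct) (auto intro: cong_add)

lemma comm: "x \<in> I \<Longrightarrow> y \<in> I \<Longrightarrow> v \<in> V \<Longrightarrow> b x (b y v) \<approx> b y (b x v)"
  using I_comm by (simp add: cong_def)

lemma endo: "endomorphism scale (b a) U V"
  by unfold_locales
    (auto simp: b_add_right b_scale_right sU sV bU bV subsetD[OF UV'] intro: finite_over_mono[OF finite_K KU order_refl])

lemma pow_V: "v \<in> V \<Longrightarrow> (b a ^^ i) v \<in> V" for a by (induction i) (auto simp: bV)
lemma pow_U: "v \<in> U \<Longrightarrow> (b a ^^ i) v \<in> U" for a by (induction i) (auto simp: bU)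

lemma comm_pow:
  assumes "\<And>v. v \<in> V \<Longrightarrow> b x (b a v) \<approx> b a (b x v)" and "v \<in> V"
  shows "b x ((b a ^^ i) v) \<approx> (b a ^^ i) (b x v)"
proof (induction i)
  case (Suc i)
  have "b x (b a ((b a ^^ i) v)) \<approx> b a (b x ((b a ^^ i) v))" by (intro assms pow_V)
  also have "\<dots> \<approx> b a ((b a ^^ i) (b x v))" by (intro cong_b Suc)
  finally show ?case by simp
qed simp

lemma comm_peval:
  assumes "\<And>v. v \<in> V \<Longrightarrow> b x (b a v) \<approx> b a (b x v)" and "v \<in> V"
  shows "b x (peval p (b a) v) \<approx> peval p (b a) (b x v)"
  unfolding peval_def b_sum_right b_scale_right
  by (intro cong_sum cong_scale comm_pow assms)

text \<open>Since \<open>b y a\<close> lies in \<open>I\<close>, it commutes with \<open>a\<close>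
  modulo \<open>U\<close>; commutation with \<open>y\<close> therefore differentiates powers of
  \<open>a\<close>. The next lemma extends this to polynomials.\<close>

lemma bracket_pow:
  assumes "a \<in> I" "v \<in> V"
  shows "b y ((b a ^^ Suc i) v) \<approx> (b a ^^ Suc i) (b y v) + of_nat (Suc i) *s (b a ^^ i) (b (b y a) v)"
proof (induction i)
  case 0
  show ?case using leibniz[of y a v] by (simp add: add.commute)
next
  case (Suc i)
  let ?w = "(b a ^^ Suc i) v" and ?c = "b y a"
  have "b y (b a ?w) = b ?c ?w + b a (b y ?w)" by (rule leibniz)
  also have "\<dots> \<approx> (b a ^^ Suc i) (b ?c v) +
      b a ((b a ^^ Suc i) (b y v) + of_nat (Suc i) *s (b a ^^ i) (b (b y a) v))"
    by (intro cong_add comm_pow comm I cong_b Suc.IH assms)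
  also have "\<dots> = (b a ^^ Suc (Suc i)) (b y v) + of_nat (Suc (Suc i)) *s (b a ^^ Suc i) (b ?c v)"
    by (simp only: funpow.simps comp_def of_nat_Suc[of "Suc i"] b_add_right b_scale_right
        scale_left_distrib scale_one add_ac)
  finally show ?case by simp
qed

lemma bracket_peval:
  assumes "a \<in> I" "v \<in> V"
  shows "b y (peval p (b a) v) \<approx> peval p (b a) (b y v) + peval (pderiv p) (b a) (b (b y a) v)"
proof (induction p)
  case (pCons \<alpha> p)
  interpret endomorphism scale "b a" U V by (rule endo)
  let ?c = "b y a" and ?w = "peval p (b a) v"
  have "b y (peval (pCons \<alpha> p) (b a) v) = \<alpha> *s b y v + (b ?c ?w + b a (b y ?w))"
    by (simp add: peval_pCons b_add_right b_scale_right leibniz[of y a])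
  also have "\<dots> \<approx> \<alpha> *s b y v + (peval p (b a) (b ?c v) + b a (peval p (b a) (b y v) + peval (pderiv p) (b a) (b ?c v)))"
    by (intro cong_add cong_refl comm_peval comm I cong_b pCons.IH assms)
  also have "\<dots> = peval (pCons \<alpha> p) (b a) (b y v) + peval (pderiv (pCons \<alpha> p)) (b a) (b ?c v)"
    by (simp add: peval_pCons pderiv_pCons peval_add b_add_right)
  finally show ?case .
qed simp

text \<open>
  Applying \<open>b y\<close> to \<open>p(a) c\<^sup>e\<^sup>+\<^sup>1 v\<close> trades one degree of \<open>p\<close> for two more factors \<open>c\<close>; iterating down
  to a constant polynomial shows that \<open>c\<close> is nilpotent.
\<close>

lemma nilpotent_step:
  assumes a: "a \<in> I" and c: "c = b y a"
    and H: "\<And>v. v \<in> V \<Longrightarrow> peval p (b a) ((b c ^^ e) v) \<in> U" and v: "v \<in> V"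
  shows "peval (pderiv p) (b a) ((b c ^^ (e + 2)) v) \<in> U"
proof -
  interpret endomorphism scale "b a" U V by (rule endo)
  have cI: "c \<in> I" by (simp add: c a I)
  let ?d = "b y c" and ?w = "(b c ^^ Suc e) v"
  have H': "peval p (b a) ((b c ^^ Suc e) v) \<in> U" if "v \<in> V" for v
    using H[of "b c v"] that bV by (simp add: funpow_swap1)
  have U1: "b y (peval p (b a) ?w) \<in> U" using bU H' v by blast
  have "b y (peval p (b a) ?w) \<approx> peval p (b a) (b y ?w) + peval (pderiv p) (b a) (b c ?w)"
    unfolding c by (intro bracket_peval a pow_V v)
  then have U2: "peval p (b a) (b y ?w) + peval (pderiv p) (b a) (b c ?w) \<in> U"
    using cong_U U1 by blast
  have e1: "b y ?w \<approx> (b c ^^ Suc e) (b y v) + of_nat (Suc e) *s (b c ^^ e) (b ?d v)"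
    by (rule bracket_pow[OF cI v])
  have "peval p (b a) (b y ?w - ((b c ^^ Suc e) (b y v) + of_nat (Suc e) *s (b c ^^ e) (b ?d v))) \<in> U"
    by (intro pevalU e1[unfolded cong_def])
  moreover have "peval p (b a) ((b c ^^ Suc e) (b y v) + of_nat (Suc e) *s (b c ^^ e) (b ?d v)) \<in> U"
    unfolding peval_linear by (intro subspace_add[OF sU] subspace_scale[OF sU] H H' bV v)
  ultimately have "peval p (b a) (b y ?w) \<in> U"
    using subspace_add[OF sU] by (fastforce simp flip: peval_linear(1))
  from subspace_diff[OF sU U2 this] show ?thesis by simp
qed

lemma bracket_nilpotent:
  assumes a: "a \<in> I"
  shows "\<exists>e. \<forall>v\<in>V. (b (b y a) ^^ e) v \<in> U"
proof -
  let ?c = "b y a"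
  interpret endomorphism scale "b a" U V by (rule endo)
  obtain p where p: "p \<noteq> 0" "\<And>v. v \<in> V \<Longrightarrow> peval p (b a) v \<in> U" using annihilated by blast
  have "\<exists>e. \<forall>v\<in>V. (b ?c ^^ e) v \<in> U"
    if "p \<noteq> 0" "\<And>v. v \<in> V \<Longrightarrow> peval p (b a) ((b ?c ^^ e) v) \<in> U" for p e
    using that
  proof (induction "degree p" arbitrary: p e)
    case 0
    then obtain \<alpha> where \<alpha>: "p = [:\<alpha>:]" "\<alpha> \<noteq> 0" by (metis degree_eq_zeroE pCons_0_0)
    have "(b ?c ^^ e) v \<in> U" if "v \<in> V" for v
    proof -
      have "\<alpha> *s (b ?c ^^ e) v \<in> U" using 0(3)[OF that] \<alpha> by (simp add: peval_pCons T_0)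
      then have "inverse \<alpha> *s \<alpha> *s (b ?c ^^ e) v \<in> U" by (rule subspace_scale[OF sU])
      then show ?thesis using \<alpha> by simp
    qed
    then show ?case by blast
  next
    case (Suc d)
    have "degree (pderiv p) = d" using Suc(2) by (simp add: degree_pderiv flip: Suc(2))
    moreover have "pderiv p \<noteq> 0" using Suc(2) by (auto simp: pderiv_eq_0_iff)
    ultimately show ?case
      using Suc(1)[of "pderiv p" "e + 2"] nilpotent_step[OF a refl Suc(4)] by blast
  qed
  from this[of p 0] p show ?thesis by simp
qed

text \<open>The brackets in \<open>C\<close> are commuting nilpotent operators on
  \<open>V / U\<close>. In a minimal \<open>C\<close>-stable \<open>X\<close> above
  \<open>U\<close>, the kernel of each \<open>c\<close> is \<open>C\<close>-stable and larger than
  \<open>U\<close>, hence all of \<open>X\<close>; so \<open>C\<close> has a nonzero common kernel.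
  As \<open>C\<close> is stable under the adjoint action, this kernel is an ideal, and
  irreducibility makes it \<open>V\<close>.\<close>

lemma bracket_trivial:
  assumes "a \<in> I" "v \<in> V"
  shows "b (b y a) v \<in> U"
proof -
  define C where "C = {b y a |y a. a \<in> I}"
  have C_I: "c \<in> I" if "c \<in> C" for c using that I by (auto simp: C_def)
  have C_b: "b x c \<in> C" if "c \<in> C" for x c using C_I[OF that] unfolding C_def by blast
  define P where "P X \<longleftrightarrow> subspace X \<and> U \<subset> X \<and> X \<subseteq> V \<and> (\<forall>c\<in>C. \<forall>v\<in>X. b c v \<in> X)" for X
  have "P V" using psub sV bV by (auto simp: P_def)
  moreover have "subspace Y \<and> K \<subseteq> Y" if "P Y" for Y using that KU by (auto simp: P_def)
  ultimately obtain X where X: "P X" "\<And>Y. P Y \<Longrightarrow> Y \<subseteq> X \<Longrightarrow> Y = X"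
    using minimal_subspace[OF finite_K, of P] by meson
  have sX: "subspace X" and UX: "U \<subseteq> X" and XV: "X \<subseteq> V" using X(1) by (auto simp: P_def)
  have CX: "b c v \<in> U" if c: "c \<in> C" and v: "v \<in> X" for c v
  proof -
    define Y where "Y = {x \<in> X. b c x \<in> U}"
    have "subspace Y" unfolding Y_def
      by (rule subspaceI)
        (auto simp: b_add_right b_scale_right sU sX subspace_0 subspace_add subspace_scale)
    moreover have "b c' x \<in> Y" if "c' \<in> C" "x \<in> Y" for c' x
    proof -
      have "b c (b c' x) \<approx> b c' (b c x)" using comm C_I c that XV by (auto simp: Y_def)
      moreover have "b c' (b c x) \<in> U" using that bU by (simp add: Y_def)
      ultimately show ?thesis using that X(1) cong_U by (auto simp: Y_def P_def)
    qed
    moreover have "U \<subseteq> Y" using UX bU by (auto simp: Y_def)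
    moreover have "Y \<noteq> U"
    proof
      assume YU: "Y = U"
      obtain e where e: "\<And>v. v \<in> V \<Longrightarrow> (b c ^^ e) v \<in> U" using bracket_nilpotent c unfolding C_def by blast
      have "x \<in> U" if "x \<in> X" "(b c ^^ i) x \<in> U" for x i
        using that
      proof (induction i arbitrary: x)
        case (Suc i)
        have "b c x \<in> X" using X(1) c Suc.prems by (auto simp: P_def)
        then have "b c x \<in> U" using Suc by (simp add: funpow_swap1)
        then show ?case using Suc.prems YU by (auto simp: Y_def)
      qed simp
      then show False using e XV X(1) by (auto simp: P_def)
    qed
    ultimately have "P Y" using XV by (auto simp: P_def Y_def)
    then have "Y = X" using X(2)[of Y] by (auto simp: Y_def)
    then show ?thesis using v by (auto simp: Y_def)
  qed
  define W where "W = {v\<in>V. \<forall>c\<in>C. b c v \<in> U}"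
  have "left_sub W" unfolding left_sub_def
  proof (intro conjI allI ballI)
    show "subspace W"
      by (rule subspaceI) (auto simp: W_def b_add_right b_scale_right sU sV subspace_0 subspace_add subspace_scale)
    show "K \<subseteq> W" using KU UV' bU by (auto simp: W_def)
    fix x u assume u: "u \<in> W"
    have "b c (b x u) \<in> U" if c: "c \<in> C" for c
    proof -
      \<comment> \<open>Skew-symmetry holds modulo \<open>K\<close> only: replacing
        \<open>b c x\<close> by \<open>- b x c\<close> costs an element of \<open>K\<close>, which
        acts into \<open>K\<close>.\<close>
      have "b c (b x u) = b (b c x + b x c) u - b (b x c) u + b x (b c u)"
        by (simp add: leibniz[of c x] b_add_left)
      moreover have "b (b c x + b x c) u \<in> U" using K_left skew KU by blast
      moreover have "b (b x c) u \<in> U" "b x (b c u) \<in> U" using u c C_b bU by (auto simp: W_def)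
      ultimately show ?thesis by (simp add: subspace_add subspace_diff sU)
    qed
    then show "b x u \<in> W" using u bV by (auto simp: W_def)
  qed
  moreover have "X \<subseteq> W" using CX XV by (auto simp: W_def)
  moreover have "U \<subset> X" using X(1) by (simp add: P_def)
  ultimately have "W = V" using minimal[of W] by (auto simp: W_def)
  then show ?thesis using assms unfolding W_def C_def by blast
qed

lemma central: 
  assumes "a \<in> I" "v \<in> V"
  shows "b y (b a v) \<approx> b a (b y v)"
  using bracket_trivial[OF assms, of y] by (simp add: cong_def leibniz[of y a v])

text \<open>An element of \<open>I\<close> acting non-trivially would act invertibly, but all its powers have trace 0.\<close>

lemma abelian_ideal_acts_trivially:
  assumes sp: "I \<subseteq> span {b x y |x y. True}" and z: "z \<in> I" and v: "v \<in> V"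
  shows "b z v \<in> U"
proof (rule ccontr)
  assume nv: "b z v \<notin> U"
  interpret endomorphism scale "b z" U V by (rule endo)
  define W where "W = {v\<in>V. b z v \<in> U}"
  have "left_sub W" unfolding left_sub_def
  proof (intro conjI allI ballI)
    show "subspace W"
      by (rule subspaceI) (auto simp: W_def b_add_right b_scale_right sU sV subspace_0 subspace_add subspace_scale)
    show "K \<subseteq> W" using KU UV' bU by (auto simp: W_def)
    fix x u assume u: "u \<in> W"
    have "b x (b z u) \<approx> b z (b x u)" using central[OF z] u by (simp add: W_def)
    moreover have "b x (b z u) \<in> U" using u bU by (simp add: W_def)
    ultimately show "b x u \<in> W" using u bV cong_U by (auto simp: W_def)
  qed
  then have "\<not> U \<subset> W" using minimal[of W] nv v by (auto simp: W_def)
  moreover have "U \<subseteq> W" using UV' bU by (auto simp: W_def)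
  ultimately have inj: "u \<in> U" if "u \<in> V" "b z u \<in> U" for u using that by (auto simp: W_def)
  obtain p0 where p0: "p0 \<noteq> 0" "\<And>v. v \<in> V \<Longrightarrow> peval p0 (b z) v \<in> U" using annihilated by blast
  \<comment> \<open>As \<open>b z\<close> is injective on \<open>V / U\<close>, factors of the
    variable can be cancelled from an annihilating polynomial.\<close>
  have "\<exists>p. coeff p 0 \<noteq> 0 \<and> (\<forall>v\<in>V. peval p (b z) v \<in> U)"
    using p0
  proof (induction "degree p0" arbitrary: p0 rule: less_induct)
    case less
    show ?case
    proof (cases "coeff p0 0 = 0")
      case True
      then obtain q where q: "p0 = pCons 0 q" by (metis coeff_pCons_0 pCons_cases)
      have "peval q (b z) v \<in> U" if "v \<in> V" for v
        using less(3)[OF that] inj[OF pevalV[OF that]] by (simp add: q peval_pCons)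
      moreover have "q \<noteq> 0" "degree q < degree p0" using less(2) q by (auto simp: degree_pCons_eq_if)
      ultimately show ?thesis using less(1) by blast
    qed (use less in blast)
  qed
  then obtain p where p: "coeff p 0 \<noteq> 0" "\<And>v. v \<in> V \<Longrightarrow> peval p (b z) v \<in> U" by blast
  obtain B \<xi> where "relative_basis U V B \<xi>"
    by (rule relative_basis_exists[OF sU sV UV' finite_over_mono[OF fin order_refl subset_UNIV]])
  note B = relative_basisD[OF this]
  have xi_0: "\<xi> \<beta> 0 = 0" for \<beta> using B(4)[of \<beta> 0 0] by simp
  have xi_sum: "\<xi> \<beta> (sum f A) = (\<Sum>a\<in>A. \<xi> \<beta> (f a))" for \<beta> f and A :: "'i set"
    by (induction A rule: infinite_finite_induct) (auto simp: B(3) xi_0)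
  have xi_cong: "\<xi> \<beta> x = \<xi> \<beta> y" if "x \<approx> y" "\<beta> \<in> B" for x y \<beta>
    using B(5)[OF that(2), of "x - y"] that(1) B(3)[of \<beta> "x - y" y] by (simp add: cong_def)
  have expand: "v \<approx> (\<Sum>\<beta>\<in>B. \<xi> \<beta> v *s \<beta>)" if "v \<in> V" for v using B(7)[OF that] by (simp add: cong_def)
  define tr where "tr T = (\<Sum>\<beta>\<in>B. \<xi> \<beta> (T \<beta>))" for T
  have tr_swap: "tr (\<lambda>v. b x (b y ((b z ^^ i) v))) = tr (\<lambda>v. b y ((b z ^^ i) (b x v)))" for x y i
  proof -
    let ?S = "\<lambda>v. b y ((b z ^^ i) v)"
    have S_lin: "?S (sum f A) = (\<Sum>a\<in>A. ?S (f a))" for f and A :: "'g set"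
      by (induction A rule: infinite_finite_induct) (use Ti_scale[of i 0 0] in \<open>auto simp: Ti_add b_add_right\<close>)
    have S_cong: "?S u \<approx> ?S v" if "u \<approx> v" for u v
    proof -
      have "(b z ^^ i) (u - v) \<in> U" using that pow_U by (simp add: cong_def)
      moreover have "(b z ^^ i) u = (b z ^^ i) (u - v) + (b z ^^ i) v" by (simp flip: Ti_add)
      ultimately show ?thesis by (intro cong_b) (simp add: cong_def)
    qed
    have SV: "?S v \<in> V" if "v \<in> V" for v using that bV pow_V by blast
    have "tr (\<lambda>v. b x (?S v)) = (\<Sum>\<beta>\<in>B. \<Sum>\<gamma>\<in>B. \<xi> \<gamma> (?S \<beta>) * \<xi> \<beta> (b x \<gamma>))"
      unfolding tr_def
    proof (rule sum.cong[OF refl])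
      fix \<beta> assume \<beta>: "\<beta> \<in> B"
      have "b x (?S \<beta>) \<approx> b x (\<Sum>\<gamma>\<in>B. \<xi> \<gamma> (?S \<beta>) *s \<gamma>)" using \<beta> B(2) by (intro cong_b expand SV) auto
      from xi_cong[OF this \<beta>] show "\<xi> \<beta> (b x (?S \<beta>)) = (\<Sum>\<gamma>\<in>B. \<xi> \<gamma> (?S \<beta>) * \<xi> \<beta> (b x \<gamma>))"
        by (simp add: b_sum_right b_scale_right xi_sum B(4))
    qed
    also have "\<dots> = (\<Sum>\<gamma>\<in>B. \<Sum>\<beta>\<in>B. \<xi> \<beta> (b x \<gamma>) * \<xi> \<gamma> (?S \<beta>))"
      by (subst sum.swap) (simp add: mult.commute)
    also have "\<dots> = tr (\<lambda>v. ?S (b x v))"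
      unfolding tr_def
    proof (rule sum.cong[OF refl])
      fix \<gamma> assume \<gamma>: "\<gamma> \<in> B"
      have "?S (b x \<gamma>) \<approx> ?S (\<Sum>\<beta>\<in>B. \<xi> \<beta> (b x \<gamma>) *s \<beta>)" using \<gamma> B(2) by (intro S_cong expand bV) auto
      from xi_cong[OF this \<gamma>] show "(\<Sum>\<beta>\<in>B. \<xi> \<beta> (b x \<gamma>) * \<xi> \<gamma> (?S \<beta>)) = \<xi> \<gamma> (?S (b x \<gamma>))"
        by (simp add: S_lin Ti_scale b_scale_right xi_sum B(4))
    qed
    finally show ?thesis .
  qed
  \<comment> \<open>The trace of \<open>[x, y] z^i\<close> is tr \<open>(x y z^i)\<close> minus tr
    \<open>(y x z^i)\<close>. Since \<open>z^i\<close> commutes with \<open>x\<close> on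
    \<open>V / U\<close>, the second term is tr \<open>(y z^i x)\<close>, which equals the first by
    cyclicity.\<close>
  have tr_bracket: "tr (\<lambda>v. b (b x y) ((b z ^^ i) v)) = 0" for x y i
  proof -
    have "tr (\<lambda>v. b x (b y ((b z ^^ i) v))) = tr (\<lambda>v. b (b x y) ((b z ^^ i) v)) + tr (\<lambda>v. b y (b x ((b z ^^ i) v)))"
      by (simp add: tr_def leibniz[of x y] B(3) sum.distrib)
    moreover have "tr (\<lambda>v. b y ((b z ^^ i) (b x v))) = tr (\<lambda>v. b y (b x ((b z ^^ i) v)))"
      unfolding tr_def
    proof (rule sum.cong[OF refl])
      fix \<beta> assume \<beta>: "\<beta> \<in> B"
      have "b x ((b z ^^ i) \<beta>) \<approx> (b z ^^ i) (b x \<beta>)"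
        by (rule comm_pow) (use central z \<beta> B(2) in auto)
      then show "\<xi> \<beta> (b y ((b z ^^ i) (b x \<beta>))) = \<xi> \<beta> (b y (b x ((b z ^^ i) \<beta>)))"
        using xi_cong \<beta> cong_b cong_sym by metis
    qed
    ultimately show ?thesis using tr_swap[of x y i] by simp
  qed
  have tr_pow: "tr (b z ^^ Suc i) = 0" for i
  proof -
    have "tr (\<lambda>v. b w ((b z ^^ i) v)) = 0" if "w \<in> span {b x y |x y. True}" for w
      using that
    proof (induction rule: span_induct_alt)
      case base
      show ?case by (simp add: tr_def xi_0)
    next
      case (step c x y)
      have "tr (\<lambda>v. b x ((b z ^^ i) v)) = 0" using step(1) tr_bracket by blast
      then show ?case using step(2)
        by (simp add: tr_def b_add_left b_scale_left B(3,4) sum.distrib flip: sum_distrib_left)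
    qed
    from this[of z] z sp show ?thesis by (auto simp: tr_def)
  qed
  \<comment> \<open>All positive powers of \<open>z\<close> are traceless, so the trace of
    \<open>p(z) = 0\<close> is \<open>p(0)\<close> times the dimension of \<open>V / U\<close>. In
    characteristic 0 this dimension must vanish.\<close>
  have "tr (peval p (b z)) = 0"
    unfolding tr_def using B(2,5) p(2) by (intro sum.neutral) blast
  moreover have "tr (peval p (b z)) = (\<Sum>i\<le>degree p. coeff p i * tr (b z ^^ i))"
    unfolding tr_def peval_def xi_sum B(4) sum_distrib_left by (rule sum.swap)
  also have "\<dots> = (\<Sum>i\<in>{0}. coeff p i * tr (b z ^^ i))"
    by (rule sum.mono_neutral_right) (use tr_pow in \<open>auto simp: gr0_conv_Suc\<close>)
  also have "\<dots> = coeff p 0 * of_nat (card B)"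
    by (simp add: tr_def B(6))
  finally have "card B = 0" using p(1) by simp
  then have "B = {}" using B(1) by simp
  then have "V \<subseteq> U" using B(7) by auto
  then show False using psub by blast
qed

end

section \<open>The derived algebra of a solvable Lie algebra acts nilpotently\<close>

locale solvable_leibniz_mod = leibniz_mod scale b K
  for scale :: "'a::field_char_0 \<Rightarrow> 'g::ab_group_add \<Rightarrow> 'g" (infixr "*s" 75) and b K +
  assumes solvable: "\<exists>n. dser n \<subseteq> K"
begin

text \<open>Take \<open>V\<close> minimal above \<open>U\<close>. If \<open>dser 1\<close> acted
  nontrivially on \<open>V / U\<close>, some \<open>dser (j + 1)\<close> would be the last derived
  ideal to do so; it would act by commuting operators, and being spanned by brackets it acts by zero
  after all. The search starts at index 1 because the trace argument needs brackets.\<close>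

lemma left_sub_step:
  assumes lU: "left_sub U" and "U \<noteq> UNIV"
  obtains V where "left_sub V" "U \<subset> V" "\<And>x v. x \<in> nil \<Longrightarrow> v \<in> V \<Longrightarrow> b x v \<in> U"
proof -
  have "left_sub UNIV" by (simp add: left_sub_def)
  then have "left_sub UNIV \<and> U \<subset> UNIV" using assms by blast
  then have "\<exists>V. (left_sub V \<and> U \<subset> V) \<and> (\<forall>W. left_sub W \<and> U \<subset> W \<longrightarrow> W \<subseteq> V \<longrightarrow> W = V)"
    by (intro minimal_subspace[OF finite_K, where P = "\<lambda>V. left_sub V \<and> U \<subset> V" and ?U0.0 = UNIV])
      (auto simp: left_sub_def)
  then obtain V where V': "(left_sub V \<and> U \<subset> V) \<and> (\<forall>W. left_sub W \<and> U \<subset> W \<longrightarrow> W \<subseteq> V \<longrightarrow> W = V)" ..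
  have V: "left_sub V" "U \<subset> V" using V' by auto
  have Vmin: "W = V" if "left_sub W" "U \<subset> W" "W \<subseteq> V" for W using V' that by blast
  define Q where "Q k \<longleftrightarrow> (\<forall>x\<in>dser k. \<forall>v\<in>V. b x v \<in> U)" for k
  have KV: "b x v \<in> U" if "x \<in> K" for x v using K_left[OF that] left_subD(2)[OF lU] by auto
  obtain n where "dser n \<subseteq> K" using solvable by blast
  then have Qn: "Q n" using KV by (auto simp: Q_def)
  have Q1: "Q (Suc 0)"
  proof (rule ccontr)
    assume n1: "\<not> Q (Suc 0)"
    have n0: "\<not> Q 0" using n1 by (auto simp: Q_def)
    have "\<exists>j. \<not> Q (Suc j) \<and> Q (Suc (Suc j))"
    proof (rule ccontr)
      assume "\<nexists>j. \<not> Q (Suc j) \<and> Q (Suc (Suc j))"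
      then have "\<not> Q (Suc j)" for j using n1 by (induction j) auto
      then show False using Qn n0 by (cases n) auto
    qed
    then obtain j where j: "\<not> Q (Suc j)" "Q (Suc (Suc j))" by blast
    interpret composition_factor scale b K U V "dser (Suc j)"
    proof
      show "b x (b y v) - b y (b x v) \<in> U" if "x \<in> dser (Suc j)" "y \<in> dser (Suc j)" "v \<in> V" for x y v
        using dser_bracket[OF that(1,2)] j(2) that(3) by (simp add: leibniz[of x y] Q_def)
    qed (use V Vmin lU dser_right in auto)
    have "dser (Suc j) \<subseteq> span {b x y |x y. True}"
      unfolding dser_Suc by (rule span_mono) auto
    then have "Q (Suc j)" using abelian_ideal_acts_trivially by (simp add: Q_def)
    then show False using j by blast
  qed
  have "b x v \<in> U" if "x \<in> nil" "v \<in> V" for x v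
    using that(1) unfolding nil_def
  proof (induction rule: span_induct_alt)
    case base
    then show ?case using left_subD(1)[OF lU] by (simp add: subspace_0)
  next
    case (step c x y)
    have "b x v \<in> U" using step(1) KV Q1 that(2) by (auto simp: Q_def)
    then show ?case using step(2) left_subD(1)[OF lU]
      by (simp add: b_add_left b_scale_left subspace_add subspace_scale)
  qed
  then show thesis using that V by blast
qed

lemma nil_ad_nilpotent:
  assumes x: "x \<in> nil"
  obtains e where "\<And>y. (b x ^^ e) y \<in> K"
proof -
  define P where "P U \<longleftrightarrow> left_sub U \<and> (\<exists>e. \<forall>y\<in>U. (b x ^^ e) y \<in> K)" for U
  have "left_sub K" using K K_right by (simp add: left_sub_def)
  then have "P K" unfolding P_def by (intro conjI exI[of _ 0]) auto
  moreover have "subspace Y \<and> K \<subseteq> Y" if "P Y" for Y using that by (auto simp: P_def left_sub_def)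
  ultimately obtain U where U: "P U" "\<And>V. P V \<Longrightarrow> U \<subseteq> V \<Longrightarrow> V = U"
    using maximal_subspace[OF finite_K, of P] by meson
  then obtain e where e: "\<And>y. y \<in> U \<Longrightarrow> (b x ^^ e) y \<in> K" by (auto simp: P_def)
  have "U = UNIV"
  proof (rule ccontr)
    assume "U \<noteq> UNIV"
    then obtain V where V: "left_sub V" "U \<subset> V" "\<And>x v. x \<in> nil \<Longrightarrow> v \<in> V \<Longrightarrow> b x v \<in> U"
      using left_sub_step U(1) unfolding P_def by metis
    have "(b x ^^ Suc e) y \<in> K" if "y \<in> V" for y
      using e[OF V(3)[OF x that]] by (simp add: funpow_swap1)
    then have "P V" using V(1) by (auto simp: P_def simp del: funpow.simps)
    then show False using U(2) V(2) by blast
  qed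
  then show thesis using that e by blast
qed

text \<open>Choose an ideal \<open>U\<close> maximal with
  \<open>U \<inter> nil \<subseteq> J\<close>. The next step \<open>V\<close> above \<open>U\<close>
  meets \<open>nil\<close> outside \<open>J\<close>, while \<open>nil\<close> moves \<open>V\<close>
  into \<open>U\<close>. The element found is central in \<open>nil\<close> modulo \<open>J\<close>,
  so adjoining it to \<open>J\<close> again gives an ideal of \<open>nil\<close>.\<close>

lemma nil_central_step:
  assumes "subspace J" "K \<subseteq> J" "J \<subset> nil"
  obtains x where "x \<in> nil" "x \<notin> J" "\<And>y. y \<in> nil \<Longrightarrow> b y x \<in> J"
proof -
  define P where "P U \<longleftrightarrow> left_sub U \<and> U \<inter> nil \<subseteq> J" for U
  have "left_sub K" using K K_right by (simp add: left_sub_def)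
  then have "P K" unfolding P_def using assms by blast
  moreover have "subspace Y \<and> K \<subseteq> Y" if "P Y" for Y using that by (auto simp: P_def left_sub_def)
  ultimately obtain U where U: "P U" "\<And>V. P V \<Longrightarrow> U \<subseteq> V \<Longrightarrow> V = U"
    using maximal_subspace[OF finite_K, of P] by meson
  have "U \<noteq> UNIV" using U(1) assms by (auto simp: P_def)
  then obtain V where V: "left_sub V" "U \<subset> V" "\<And>x v. x \<in> nil \<Longrightarrow> v \<in> V \<Longrightarrow> b x v \<in> U"
    using left_sub_step U(1) unfolding P_def by metis
  have "\<not> P V" using U V by blast
  then obtain x where x: "x \<in> V" "x \<in> nil" "x \<notin> J" using V by (auto simp: P_def)
  have "b y x \<in> J" if "y \<in> nil" for y
    using V(3)[OF that x(1)] b_nil U(1) by (auto simp: P_def)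
  then show thesis using that x by blast
qed

end

section \<open>Extending a representation by one element\<close>

lemma sum_fun_apply: "(sum f A) x = (\<Sum>a\<in>A. f a x)"
  by (induction A rule: infinite_finite_induct) auto

lemma sum_triangle:
  fixes f :: "nat \<Rightarrow> nat \<Rightarrow> 'a::comm_monoid_add"
  shows "(\<Sum>i\<le>n. \<Sum>j\<le>n - i. f i j) = (\<Sum>k\<le>n. \<Sum>i\<le>k. f i (k - i))"
proof -
  have "(\<Sum>i\<le>n. \<Sum>j\<le>n - i. f i j) = (\<Sum>(i, j)\<in>{(i, j). i + j \<le> n}. f i j)"
    by (subst sum.Sigma) (auto intro!: sum.cong)
  then show ?thesis by (simp add: sum.triangle_reindex_eq)
qed

text \<open>The induction hypothesis for Ado's theorem. The module is the finite-dimensional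
  \<open>W 0\<close> inside a possibly larger type, on all of which the operators are linear.
  Elements of \<open>J\<close> in \<open>nil\<close> lower the flag by one step; this keeps the next
  module finite-dimensional. \<open>W 0\<close> is nonzero so that some \<open>t w\<close> detects
  \<open>d/dt\<close>.\<close>

locale nil_rep = leibniz_mod scale b K + w: char0_space sw
  for scale :: "'a::field_char_0 \<Rightarrow> 'g::ab_group_add \<Rightarrow> 'g" (infixr "*s" 75) and b K
    and sw :: "'a \<Rightarrow> 'w::ab_group_add \<Rightarrow> 'w" (infixr "*w" 75) +
  fixes J :: "'g set" and \<rho> :: "'g \<Rightarrow> 'w \<Rightarrow> 'w" and W :: "nat \<Rightarrow> 'w set"
  assumes rho_add: "x \<in> J \<Longrightarrow> y \<in> J \<Longrightarrow> \<rho> (x + y) w = \<rho> x w + \<rho> y w"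
    and rho_scale: "x \<in> J \<Longrightarrow> \<rho> (c *s x) w = c *w \<rho> x w"
    and rho_add_right: "x \<in> J \<Longrightarrow> \<rho> x (w + w') = \<rho> x w + \<rho> x w'"
    and rho_scale_right: "x \<in> J \<Longrightarrow> \<rho> x (c *w w) = c *w \<rho> x w"
    and rho_b: "x \<in> J \<Longrightarrow> y \<in> J \<Longrightarrow> \<rho> (b x y) w = \<rho> x (\<rho> y w) - \<rho> y (\<rho> x w)"
    and rho_K: "k \<in> K \<Longrightarrow> \<rho> k w = 0"
    and W: "w.subspace (W i)" and W_Suc: "W (Suc i) \<subseteq> W i" and W_end: "\<exists>m. W m = {0}"
    and W_nontrivial: "W 0 \<noteq> {0}" and W_finite: "\<exists>B. finite B \<and> W 0 \<subseteq> w.span B"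
    and rho_W: "x \<in> J \<Longrightarrow> w \<in> W i \<Longrightarrow> \<rho> x w \<in> W i"
    and rho_nil: "x \<in> J \<Longrightarrow> x \<in> nil \<Longrightarrow> w \<in> W i \<Longrightarrow> \<rho> x w \<in> W (Suc i)"
    and rho_faithful: "x \<in> J \<Longrightarrow> (\<And>w. w \<in> W 0 \<Longrightarrow> \<rho> x w = 0) \<Longrightarrow> x \<in> K"

locale rep_extension = nil_rep scale b K sw J \<rho> W
  for scale :: "'a::field_char_0 \<Rightarrow> 'g::ab_group_add \<Rightarrow> 'g" (infixr "*s" 75) and b K
    and sw :: "'a \<Rightarrow> 'w::ab_group_add \<Rightarrow> 'w" (infixr "*w" 75) and J \<rho> W +
  fixes x :: 'g
  assumes J: "subspace J" and KJ: "K \<subseteq> J" and xJ: "x \<notin> J"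
    and stab: "a \<in> J \<Longrightarrow> b x a \<in> J" and J_b: "a \<in> J \<Longrightarrow> a' \<in> J \<Longrightarrow> b a a' \<in> J"
begin

lemmas rho_simps = rho_add rho_scale rho_add_right rho_scale_right rho_b rho_K

lemma rho_0: "\<rho> 0 w = 0" using rho_K subspace_0[OF K] by blast
lemma rho_0_right: "a \<in> J \<Longrightarrow> \<rho> a 0 = 0" using rho_scale_right[of a 0 0] by simp
lemma rho_sum: "(\<And>i. i \<in> A \<Longrightarrow> f i \<in> J) \<Longrightarrow> \<rho> (sum f A) w = (\<Sum>i\<in>A. \<rho> (f i) w)"
  by (induction A rule: infinite_finite_induct) (auto simp: rho_0 rho_add subspace_sum[OF J])
lemma rho_sum_right: "a \<in> J \<Longrightarrow> \<rho> a (sum f A) = (\<Sum>i\<in>A. \<rho> a (f i))"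
  by (induction A rule: infinite_finite_induct) (auto simp: rho_0_right rho_add_right)
lemma rho_cong: assumes "a \<in> J" "a - a' \<in> K" shows "\<rho> a w = \<rho> a' w"
proof -
  have "a' - a \<in> K" using subspace_neg[OF K assms(2)] by simp
  then have "\<rho> (a + (a' - a)) w = \<rho> a w + 0" using rho_add rho_K assms(1) KJ by (metis subsetD)
  then show ?thesis by simp
qed

text \<open>The coefficient of \<open>t^i\<close> in \<open>exp (t ad x) a\<close>.\<close>

definition e :: "nat \<Rightarrow> 'g \<Rightarrow> 'g" where "e i a = inverse (fact i) *s (b x ^^ i) a"

lemma e_0: "e 0 a = a" by (simp add: e_def)
lemma pow_add: "(b x ^^ i) (a + a') = (b x ^^ i) a + (b x ^^ i) a'"
  by (induction i) (auto simp: b_add_right)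
lemma pow_scale: "(b x ^^ i) (c *s a) = c *s (b x ^^ i) a"
  by (induction i) (auto simp: b_scale_right)
lemma e_add: "e i (a + a') = e i a + e i a'" by (simp add: e_def pow_add scale_right_distrib)
lemma e_scale: "e i (c *s a) = c *s e i a" by (simp add: e_def pow_scale mult.commute)
lemma pow_J: "a \<in> J \<Longrightarrow> (b x ^^ i) a \<in> J" by (induction i) (auto simp: stab)
lemma pow_K: "a \<in> K \<Longrightarrow> (b x ^^ i) a \<in> K" by (induction i) (auto simp: K_right)
lemma e_J: "a \<in> J \<Longrightarrow> e i a \<in> J" by (simp add: e_def pow_J subspace_scale J)
lemma e_K: "a \<in> K \<Longrightarrow> e i a \<in> K" by (simp add: e_def pow_K subspace_scale K)
lemma e_Suc: "of_nat (Suc i) *s e (Suc i) a = b x (e i a)"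
proof -
  have "of_nat (Suc i) \<noteq> (0 :: 'a)" by (simp del: of_nat_Suc)
  then have "(of_nat (Suc i) :: 'a) * inverse (fact (Suc i)) = inverse (fact i)"
    by (simp add: field_simps del: of_nat_Suc)
  then show ?thesis by (simp add: e_def b_scale_right del: of_nat_Suc fact_Suc)
qed
lemma e_ad: "e i (b x a) = of_nat (Suc i) *s e (Suc i) a"
  unfolding e_Suc by (simp add: e_def b_scale_right funpow_swap1)

text \<open>\<open>exp (t ad x)\<close> preserves brackets because \<open>b x\<close> is a
  derivation. Multiplying by \<open>Suc n\<close> amounts to differentiating in \<open>t\<close>;
  the factor is then split as \<open>i + (Suc n - i)\<close> between the two arguments.\<close>

lemma e_bracket: "e n (b a a') = (\<Sum>i\<le>n. b (e i a) (e (n - i) a'))"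
proof (induction n)
  case (Suc n)
  let ?t = "\<lambda>i. b (e i a) (e (Suc n - i) a')"
  have "of_nat (Suc n) *s e (Suc n) (b a a') = (\<Sum>i\<le>n. b x (b (e i a) (e (n - i) a')))"
    by (simp add: e_Suc Suc b_sum_right del: of_nat_Suc)
  also have "\<dots> = (\<Sum>i\<le>n. of_nat (Suc i) *s ?t (Suc i)) + (\<Sum>i\<le>n. of_nat (Suc n - i) *s ?t i)"
    by (simp add: leibniz[of x] sum.distrib Suc_diff_le b_scale_left b_scale_right flip: e_Suc del: of_nat_Suc)
  also have "(\<Sum>i\<le>n. of_nat (Suc i) *s ?t (Suc i)) = (\<Sum>i\<le>Suc n. of_nat i *s ?t i)"
    by (subst sum.atMost_Suc_shift) (simp del: of_nat_Suc)
  also have "(\<Sum>i\<le>n. of_nat (Suc n - i) *s ?t i) = (\<Sum>i\<le>Suc n. of_nat (Suc n - i) *s ?t i)"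
    by simp
  also have "(\<Sum>i\<le>Suc n. of_nat i *s ?t i) + \<dots> = (\<Sum>i\<le>Suc n. of_nat (Suc n) *s ?t i)"
    unfolding sum.distrib[symmetric] 
    by (rule sum.cong) (auto simp flip: scale_left_distrib of_nat_add simp del: of_nat_Suc)
  also have "\<dots> = of_nat (Suc n) *s (\<Sum>i\<le>Suc n. ?t i)" by (simp only: scale_sum_right)
  finally show ?case by (simp del: of_nat_Suc sum.atMost_Suc)
qed (simp add: e_0)

text \<open>An element \<open>a\<close> of \<open>J\<close> acts on \<open>W[[t]]\<close> by \<open>\<rho> (exp (t ad x) a)\<close>, and \<open>x\<close> acts by \<open>d/dt\<close>.\<close>

definition A :: "'g \<Rightarrow> (nat \<Rightarrow> 'w) \<Rightarrow> nat \<Rightarrow> 'w" where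
  "A a F = (\<lambda>d. \<Sum>i\<le>d. \<rho> (e i a) (F (d - i)))"

definition X :: "(nat \<Rightarrow> 'w) \<Rightarrow> nat \<Rightarrow> 'w" where
  "X F = (\<lambda>d. of_nat (Suc d) *w F (Suc d))"

definition ss :: "'a \<Rightarrow> (nat \<Rightarrow> 'w) \<Rightarrow> nat \<Rightarrow> 'w" where "ss c F = (\<lambda>d. c *w F d)"

sublocale s: char0_space ss
  by unfold_locales (auto simp: ss_def fun_eq_iff w.scale_right_distrib w.scale_left_distrib)

lemma X_linear: "X (F + G) = X F + X G" "X (ss c F) = ss c (X F)"
  by (auto simp: X_def ss_def fun_eq_iff w.scale_right_distrib mult.commute)

lemma A_linear: "a \<in> J \<Longrightarrow> A a (F + G) = A a F + A a G" "a \<in> J \<Longrightarrow> A a (ss c F) = ss c (A a F)"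
  by (auto simp: A_def ss_def fun_eq_iff rho_simps e_J sum.distrib w.scale_sum_right)

lemma A_linear_left:
  "a \<in> J \<Longrightarrow> a' \<in> J \<Longrightarrow> A (a + a') F = A a F + A a' F" "a \<in> J \<Longrightarrow> A (c *s a) F = ss c (A a F)"
  by (auto simp: A_def ss_def fun_eq_iff rho_simps e_J e_add e_scale sum.distrib w.scale_sum_right)

lemma A_K: "k \<in> K \<Longrightarrow> A k F = 0"
  by (auto simp: A_def fun_eq_iff rho_K e_K)

lemma A_bracket:
  assumes "a \<in> J" "a' \<in> J"
  shows "A (b a a') F = A a (A a' F) - A a' (A a F)"
proof
  fix d
  have prod: "A a (A a' F) d = (\<Sum>k\<le>d. \<Sum>i\<le>k. \<rho> (e i a) (\<rho> (e (k - i) a') (F (d - k))))"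
    if "a \<in> J" "a' \<in> J" for a a'
  proof -
    have "A a (A a' F) d = (\<Sum>i\<le>d. \<Sum>j\<le>d - i. \<rho> (e i a) (\<rho> (e j a') (F (d - i - j))))"
      by (simp add: A_def rho_sum_right e_J that)
    also have "\<dots> = (\<Sum>k\<le>d. \<Sum>i\<le>k. \<rho> (e i a) (\<rho> (e (k - i) a') (F (d - i - (k - i)))))"
      by (rule sum_triangle)
    finally show ?thesis by simp
  qed
  have "A (b a a') F d = (\<Sum>k\<le>d. \<Sum>i\<le>k. \<rho> (b (e i a) (e (k - i) a')) (F (d - k)))"
  proof (unfold A_def, rule sum.cong[OF refl])
    fix k
    have "\<rho> (e k (b a a')) v = (\<Sum>i\<le>k. \<rho> (b (e i a) (e (k - i) a')) v)" for v
    proof -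
      have "b (e i a) (e (k - i) a') \<in> J" for i by (intro J_b e_J assms)
      then show ?thesis by (simp add: e_bracket rho_sum)
    qed
    then show "\<rho> (e k (b a a')) (F (d - k)) = (\<Sum>i\<le>k. \<rho> (b (e i a) (e (k - i) a')) (F (d - k)))" .
  qed
  also have "\<dots> = (\<Sum>k\<le>d. \<Sum>i\<le>k. \<rho> (e i a) (\<rho> (e (k - i) a') (F (d - k)))) -
      (\<Sum>k\<le>d. \<Sum>i\<le>k. \<rho> (e (k - i) a') (\<rho> (e i a) (F (d - k))))"
    by (simp add: rho_b e_J assms sum_subtractf)
  also have "(\<Sum>k\<le>d. \<Sum>i\<le>k. \<rho> (e (k - i) a') (\<rho> (e i a) (F (d - k)))) =
     (\<Sum>k\<le>d. \<Sum>i\<le>k. \<rho> (e i a') (\<rho> (e (k - i) a) (F (d - k))))"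
  proof (rule sum.cong[OF refl])
    fix k
    show "(\<Sum>i\<le>k. \<rho> (e (k - i) a') (\<rho> (e i a) (F (d - k)))) = (\<Sum>i\<le>k. \<rho> (e i a') (\<rho> (e (k - i) a) (F (d - k))))"
      by (rule sum.reindex_bij_witness[of _ "\<lambda>i. k - i" "\<lambda>i. k - i"]) auto
  qed
  finally show "A (b a a') F d = (A a (A a' F) - A a' (A a F)) d" by (simp add: prod assms)
qed

text \<open>The product rule: the derivative of \<open>exp (t ad x) a\<close> is
  \<open>exp (t ad x) [x, a]\<close>. Thus \<open>d/dt\<close> satisfies the commutation relations
  required of \<open>x\<close>.\<close>

lemma X_A:
  assumes "a \<in> J"
  shows "X (A a F) - A a (X F) = A (b x a) F"
proof
  fix d
  have "X (A a F) d = (\<Sum>i\<le>Suc d. of_nat (Suc d) *w \<rho> (e i a) (F (Suc d - i)))"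
    by (simp only: X_def A_def w.scale_sum_right)
  also have "\<dots> = (\<Sum>i\<le>Suc d. of_nat i *w \<rho> (e i a) (F (Suc d - i))) +
      (\<Sum>i\<le>Suc d. of_nat (Suc d - i) *w \<rho> (e i a) (F (Suc d - i)))"
    unfolding sum.distrib[symmetric]
    by (rule sum.cong) (auto simp flip: w.scale_left_distrib of_nat_add simp del: of_nat_Suc)
  also have "(\<Sum>i\<le>Suc d. of_nat i *w \<rho> (e i a) (F (Suc d - i))) = (\<Sum>i\<le>d. \<rho> (e i (b x a)) (F (d - i)))"
    by (subst sum.atMost_Suc_shift) (simp add: e_ad rho_simps e_J assms del: of_nat_Suc)
  also have "(\<Sum>i\<le>Suc d. of_nat (Suc d - i) *w \<rho> (e i a) (F (Suc d - i))) =
      (\<Sum>i\<le>d. \<rho> (e i a) (of_nat (Suc (d - i)) *w F (Suc (d - i))))"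
    by (rule trans[OF sum.atMost_Suc]) (simp add: rho_simps e_J assms Suc_diff_le flip: of_nat_diff del: of_nat_Suc of_nat_diff)
  finally show "(X (A a F) - A a (X F)) d = A (b x a) F d"
    by (simp add: A_def X_def)
qed

text \<open>What both extension steps share: a flag in \<open>W[[t]]\<close> with the required
  stability, containing the series \<open>w\<close> and \<open>t w\<close>, carries a representation
  of \<open>J\<close> enlarged by \<open>x\<close>. The series \<open>t w\<close> detect the
  multiple of \<open>x\<close>, the constants detect the part in \<open>J\<close>.\<close>

lemma extend_to_flag:
  assumes sub: "\<And>p. s.subspace (V p)" and dec: "\<And>p. V (Suc p) \<subseteq> V p" and V0: "V m = {0}"
    and fin: "finite B" "V 0 \<subseteq> s.span B"
    and XV: "\<And>p F. F \<in> V p \<Longrightarrow> X F \<in> V p"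
    and AV: "\<And>a p F. a \<in> J \<Longrightarrow> F \<in> V p \<Longrightarrow> A a F \<in> V p"
    and nA: "\<And>a p F. a \<in> J \<inter> nil \<Longrightarrow> F \<in> V p \<Longrightarrow> A a F \<in> V (Suc p)"
    and nX: "(x \<in> nil \<and> J \<subseteq> nil \<and> (\<forall>p. \<forall>F\<in>V p. X F \<in> V (Suc p))) \<or> nil \<subseteq> J"
    and single: "\<And>w. w \<in> W 0 \<Longrightarrow> (\<lambda>d. if d = 0 then w else 0) \<in> V 0"
      "\<And>w. w \<in> W 0 \<Longrightarrow> (\<lambda>d. if d = 1 then w else 0) \<in> V 0"
  shows "\<exists>\<rho>'. nil_rep scale b K ss (span (insert x J)) \<rho>' V"
proof -
  obtain B \<xi> where "relative_basis J UNIV B \<xi>"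
    by (rule relative_basis_exists[OF J subspace_UNIV _ finite_over_mono[OF finite_K KJ order_refl]]) auto
  note B = relative_basisD[OF this]
  obtain \<beta> where \<beta>: "\<beta> \<in> B" "\<xi> \<beta> x \<noteq> 0"
    using B(7)[of x] xJ by (metis (mono_tags, lifting) UNIV_I diff_zero scale_zero_left sum.neutral)
  \<comment> \<open>\<open>c\<close> reads off the multiple of \<open>x\<close>, and
    \<open>q\<close> is the remaining part, which lies in \<open>J\<close> for elements of the
    enlarged space. Both come from one functional on the whole space that vanishes on
    \<open>J\<close>.\<close>
  define c where "c y = \<xi> \<beta> y / \<xi> \<beta> x" for y
  have c_add: "c (y + z) = c y + c z" and c_scale: "c (r *s y) = r * c y" and c_J: "y \<in> J \<Longrightarrow> c y = 0"
    and c_x: "c x = 1" for y z r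
    using \<beta> by (auto simp: c_def B add_divide_distrib)
  define q where "q y = y - c y *s x" for y
  have q_add: "q (y + z) = q y + q z" and q_scale: "q (r *s y) = r *s q y" and q_J: "y \<in> J \<Longrightarrow> q y = y" for y z r
    by (auto simp: q_def c_add c_scale c_J scale_left_distrib scale_right_diff_distrib)
  let ?J = "span (insert x J)"
  have qJ: "q y \<in> J" if y: "y \<in> ?J" for y
  proof -
    obtain k where k: "y - k *s x \<in> J"
      using y by (auto simp: span_breakdown_eq span_eq_iff[THEN iffD2, OF J])
    have "c y = k" using c_J[OF k] c_add[of "y - k *s x" "k *s x"] by (simp add: c_scale c_x)
    then show ?thesis using k by (simp add: q_def)
  qed
  have dec_y: "y = c y *s x + q y" for y by (simp add: q_def)
  define \<rho>' where "\<rho>' y F = ss (c y) (X F) + A (q y) F" for y F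
  have xx: "b x x \<in> K"
    using subspace_scale[OF K skew[of x x], of "inverse 2"] scale_left_distrib[of "inverse 2" "inverse 2" "b x x"]
    by (simp add: scale_right_distrib)
  \<comment> \<open>The first summand collects the defects of skew-symmetry; it lies in
    \<open>K\<close> and acts by zero. The second involves brackets with \<open>x\<close> only on
    the left, where stability of \<open>J\<close> applies.\<close>
  have eq: "b y z = (c y *s c z *s b x x + c z *s (b (q y) x + b x (q y))) +
        (c y *s b x (q z) + ((- c z) *s b x (q y) + b (q y) (q z)))" for y z
  proof -
    have "b y z = b (c y *s x + q y) (c z *s x + q z)" by (simp flip: dec_y)
    then show ?thesis
      by (simp add: b_add_left b_add_right b_scale_left b_scale_right scale_right_distrib algebra_simps)
  qed
  have k: "c y *s c z *s b x x + c z *s (b (q y) x + b x (q y)) \<in> K" for y z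
    by (intro subspace_add[OF K] subspace_scale[OF K] xx skew)
  have b_J: "b y z \<in> J" if "y \<in> ?J" "z \<in> ?J" for y z
    unfolding eq[of y z] by (intro subspace_add[OF J] subspace_scale[OF J] subsetD[OF KJ k] subsetD[OF KJ xx] 
      subsetD[OF KJ skew] stab J_b qJ that)
  have rho'_J: "\<rho>' y F = A y F" if "y \<in> J" for y F using that by (simp add: \<rho>'_def c_J q_J)
  have bracket: "\<rho>' (b y z) F = \<rho>' y (\<rho>' z F) - \<rho>' z (\<rho>' y F)" if yz: "y \<in> ?J" "z \<in> ?J" for y z F
  proof -
    note qy = qJ[OF yz(1)] and qz = qJ[OF yz(2)]
    have j: "b (q y) (q z) \<in> J" by (intro J_b qy qz)
    let ?P = "c y *s c z *s b x x + c z *s (b (q y) x + b x (q y))"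
    let ?Q = "c y *s b x (q z) + ((- c z) *s b x (q y) + b (q y) (q z))"
    have QJ: "?Q \<in> J" by (intro subspace_add[OF J] subspace_scale[OF J] stab qy qz j)
    have "\<rho>' (b y z) F = A (b y z) F" using b_J yz rho'_J by blast
    also have "\<dots> = A ?P F + A ?Q F"
      unfolding eq[of y z] by (intro A_linear_left subsetD[OF KJ k] QJ)
    also have "A ?P F = 0" by (rule A_K[OF k])
    also have "A ?Q F = A (c y *s b x (q z)) F + (A ((- c z) *s b x (q y)) F + A (b (q y) (q z)) F)"
      by (simp only: A_linear_left subspace_add[OF J] subspace_scale[OF J] stab qy qz j)
    also have "\<dots> = ss (c y) (A (b x (q z)) F) + (ss (- c z) (A (b x (q y)) F) + A (b (q y) (q z)) F)"
      by (simp only: A_linear_left stab qy qz)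
    also have "\<dots> = \<rho>' y (\<rho>' z F) - \<rho>' z (\<rho>' y F)"
      using qy qz by (simp add: \<rho>'_def A_linear X_linear A_bracket s.scale_right_distrib
        s.scale_right_diff_distrib mult.commute flip: X_A)
    finally show ?thesis by (simp only: add_0_left)
  qed
  have "nil_rep scale b K ss ?J \<rho>' V"
  proof
    show "\<rho>' (y + z) F = \<rho>' y F + \<rho>' z F" if "y \<in> ?J" "z \<in> ?J" for y z F
      using that by (simp add: \<rho>'_def c_add q_add A_linear_left qJ s.scale_left_distrib)
    show "\<rho>' (r *s y) F = ss r (\<rho>' y F)" if "y \<in> ?J" for r y F
      using that by (simp add: \<rho>'_def c_scale q_scale A_linear_left qJ s.scale_right_distrib)
    show "\<rho>' y (F + G) = \<rho>' y F + \<rho>' y G" if "y \<in> ?J" for y F G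
      using that by (simp add: \<rho>'_def A_linear X_linear qJ s.scale_right_distrib)
    show "\<rho>' y (ss r F) = ss r (\<rho>' y F)" if "y \<in> ?J" for y r F
      using that by (simp add: \<rho>'_def A_linear X_linear qJ s.scale_right_distrib mult.commute)
    show "\<rho>' k F = 0" if "k \<in> K" for k F using that KJ by (simp add: rho'_J A_K subsetD)
    show "\<exists>m. V m = {0}" using V0 by blast
    show "\<exists>B. finite B \<and> V 0 \<subseteq> s.span B" using fin by blast
    obtain w where w: "w \<in> W 0" "w \<noteq> 0" using W_nontrivial w.subspace_0[OF W[of 0]] by blast
    show "V 0 \<noteq> {0}"
    proof
      assume "V 0 = {0}"
      from single(1)[OF w(1), unfolded this] have "(\<lambda>d::nat. if d = 0 then w else 0) = 0" by (rule singletonD)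
      from fun_cong[OF this, of 0] show False using w(2) by simp
    qed
    show "\<rho>' y F \<in> V p" if "y \<in> ?J" "F \<in> V p" for y p F
      unfolding \<rho>'_def using that by (intro s.subspace_add[OF sub] s.subspace_scale[OF sub] XV AV qJ)
    show "\<rho>' y F \<in> V (Suc p)" if "y \<in> ?J" "y \<in> nil" "F \<in> V p" for y p F
      using nX
    proof
      assume "nil \<subseteq> J"
      then show ?thesis using that nA by (auto simp: rho'_J)
    next
      assume H: "x \<in> nil \<and> J \<subseteq> nil \<and> (\<forall>p. \<forall>F\<in>V p. X F \<in> V (Suc p))"
      then show ?thesis unfolding \<rho>'_def using that
        by (intro s.subspace_add[OF sub] s.subspace_scale[OF sub] nA) (auto simp: qJ)
    qed
    show "y \<in> K" if y: "y \<in> ?J" and 0: "\<And>F. F \<in> V 0 \<Longrightarrow> \<rho>' y F = 0" for y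
    proof -
      \<comment> \<open>The constant term of \<open>y\<close> applied to \<open>t w\<close> is
        \<open>c y\<close> times \<open>w\<close>: the part from \<open>J\<close> meets the zero
        constant term of \<open>t w\<close>.\<close>
      have "\<rho>' y (\<lambda>d. if d = 1 then w else 0) 0 = 0" using 0 single(2)[OF w(1)] by simp
      then have "c y = 0" using w(2) by (simp add: \<rho>'_def ss_def X_def A_def rho_0_right e_J qJ y)
      then have yJ: "y \<in> J" using qJ[OF y] by (simp add: q_def)
      have "\<rho> y v = 0" if "v \<in> W 0" for v
      proof -
        have "\<rho>' y (\<lambda>d. if d = 0 then v else 0) 0 = 0" using 0 single(1)[OF that] by simp
        then show ?thesis by (simp add: rho'_J yJ A_def e_0)
      qed
      then show ?thesis using rho_faithful yJ by blast
    qed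
  qed (use sub dec bracket in auto)
  then show ?thesis by blast
qed

definition single :: "nat \<Rightarrow> 'w \<Rightarrow> nat \<Rightarrow> 'w" where "single n w = (\<lambda>d. if d = n then w else 0)"

lemma single_span:
  assumes "w \<in> w.span B" "n < M"
  shows "single n w \<in> s.span {single n w |n w. n < M \<and> w \<in> B}"
  using assms(1)
proof (induction rule: w.span_induct_alt)
  case base
  have "single n 0 = 0" by (auto simp: single_def)
  show ?case unfolding \<open>single n 0 = 0\<close> by (rule s.span_zero)
next
  case (step c w y)
  have *: "single n (c *w w + y) = ss c (single n w) + single n y" by (auto simp: single_def ss_def)
  have "single n w \<in> s.span {single n w |n w. n < M \<and> w \<in> B}"
    using step(1) assms(2) by (intro s.span_base) blast
  then show ?case unfolding * by (intro s.span_add s.span_scale step(2))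
qed

lemma W_antimono: "i \<le> j \<Longrightarrow> W j \<subseteq> W i"
  by (rule lift_Suc_antimono_le[of W]) (use W_Suc in auto)

text \<open>
  If \<open>ad x\<close> is nilpotent, \<open>exp (t ad x) a\<close> has degree less than \<open>r\<close> in \<open>t\<close>. Giving \<open>t\<close> weight \<open>- 1\<close> and
  each step of the flag \<open>W\<close> weight \<open>q > r\<close>, both \<open>a\<close> and \<open>d/dt\<close> raise the weight.
\<close>

lemma nil_extend:
  assumes x: "x \<in> nil" and Jn: "J \<subseteq> nil" and r: "\<And>y. (b x ^^ r) y \<in> K"
  shows "\<exists>\<rho>' V. nil_rep scale b K ss (span (insert x J)) \<rho>' V"
proof -
  \<comment> \<open>\<open>q \<ge> r\<close> lets one step down the flag pay for every factor
    \<open>t^i\<close> with \<open>i < r\<close> and still gain weight; \<open>q \<ge> 2\<close>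
    puts \<open>t w\<close> into \<open>V 0\<close>, as \<open>1 div q = 0\<close>. In
    \<open>V p\<close>, an element of \<open>W i\<close> in degree \<open>d\<close> has weight
    \<open>q * i - d\<close> at least \<open>p\<close>, up to the constant
    \<open>q - 1\<close>.\<close>
  define q where "q = r + 2"
  define V where "V p = {F. \<forall>d. F d \<in> W ((p + d) div q)}" for p
  obtain m where m: "W m = {0}" using W_end by blast
  obtain B where B: "finite B" "W 0 \<subseteq> w.span B" using W_finite by blast
  have W0: "0 \<in> W i" for i by (rule w.subspace_0[OF W])
  have W_m: "w = 0" if "w \<in> W i" "m \<le> i" for i w using W_antimono[OF that(2)] that(1) m by auto
  have e_0: "\<rho> (e i a) w = 0" if "r \<le> i" for i a w
  proof -
    have "(b x ^^ i) a = (b x ^^ r) ((b x ^^ (i - r)) a)"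
      using that by (metis comp_apply funpow_add le_add_diff_inverse)
    then have "e i a \<in> K" using r by (simp add: e_def subspace_scale K)
    then show ?thesis by (rule rho_K)
  qed
  have AV: "A a F \<in> V (Suc p)" if a: "a \<in> J" and F: "F \<in> V p" for a p F
  proof -
    have "\<rho> (e i a) (F (d - i)) \<in> W ((Suc p + d) div q)" if "i \<le> d" for i d
    proof (cases "r \<le> i")
      case False
      have "F (d - i) \<in> W ((p + (d - i)) div q)" using F by (simp add: V_def)
      then have "\<rho> (e i a) (F (d - i)) \<in> W (Suc ((p + (d - i)) div q))"
        using a Jn e_J by (intro rho_nil) auto
      moreover have "(Suc p + d) div q \<le> (p + (d - i) + q) div q"
        by (rule div_le_mono) (use False that in \<open>simp add: q_def\<close>)
      then have "(Suc p + d) div q \<le> Suc ((p + (d - i)) div q)" by (subst (asm) div_add_self2) (simp_all add: q_def)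
      ultimately show ?thesis using W_antimono by blast
    qed (simp add: e_0 W0)
    then show ?thesis by (auto simp: V_def A_def intro!: w.subspace_sum[OF W])
  qed
  have V_dec: "V (Suc p) \<subseteq> V p" for p
  proof
    fix F assume F: "F \<in> V (Suc p)"
    have "F d \<in> W ((p + d) div q)" for d
    proof -
      have "(p + d) div q \<le> (Suc p + d) div q" by (rule div_le_mono) simp
      moreover have "F d \<in> W ((Suc p + d) div q)" using F by (simp add: V_def)
      ultimately show ?thesis using W_antimono by blast
    qed
    then show "F \<in> V p" by (simp add: V_def)
  qed
  have XV: "X F \<in> V (Suc p)" if "F \<in> V p" for p F
    unfolding V_def X_def
  proof safe
    fix d
    have "F (Suc d) \<in> W ((p + Suc d) div q)" using that unfolding V_def by blast
    then show "of_nat (Suc d) *w F (Suc d) \<in> W ((Suc p + d) div q)"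
      by (intro w.subspace_scale[OF W]) simp
  qed
  have "\<exists>\<rho>'. nil_rep scale b K ss (span (insert x J)) \<rho>' V"
  proof (rule extend_to_flag)
    show "s.subspace (V p)" for p
      by (rule s.subspaceI)
        (auto simp: V_def ss_def W0 intro: w.subspace_add[OF W] w.subspace_scale[OF W])
    show "V (Suc p) \<subseteq> V p" for p by (rule V_dec)
    show "V (m * q) = {0}"
    proof -
      have "F = 0" if "F \<in> V (m * q)" for F
      proof
        fix d
        have "m \<le> (m * q + d) div q" by (subst less_eq_div_iff_mult_less_eq) (simp_all add: q_def)
        moreover have "F d \<in> W ((m * q + d) div q)" using that by (simp add: V_def)
        ultimately show "F d = 0 d" using W_m by simp
      qed
      moreover have "0 \<in> V (m * q)" by (simp add: V_def W0)
      ultimately show ?thesis by blast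
    qed
    show "finite {single n w |n w. n < m * q \<and> w \<in> B}"
      using finite_image_set2[of "\<lambda>n. n < m * q" "\<lambda>w. w \<in> B" single] B(1) by simp
    show "V 0 \<subseteq> s.span {single n w |n w. n < m * q \<and> w \<in> B}"
    proof
      fix F assume F: "F \<in> V 0"
      have F_eq: "F = (\<Sum>n<m * q. single n (F n))"
      proof
        fix d
        have "(\<Sum>n<m * q. single n (F n)) d = (\<Sum>n<m * q. single n (F n) d)"
          by (rule sum_fun_apply)
        also have "\<dots> = (if d < m * q then F d else 0)" by (simp add: single_def)
        also have "\<dots> = F d"
        proof -
          have "F d = 0" if "\<not> d < m * q"
          proof (rule W_m)
            show "F d \<in> W (d div q)" using F by (simp add: V_def)
            show "m \<le> d div q" using that by (simp add: q_def less_eq_div_iff_mult_less_eq)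
          qed
          then show ?thesis by simp
        qed
        finally show "F d = (\<Sum>n<m * q. single n (F n)) d" by simp
      qed
      have "F n \<in> w.span B" for n
        using F W_antimono[of 0 "n div q"] B(2) by (auto simp: V_def)
      then have "(\<Sum>n<m * q. single n (F n)) \<in> s.span {single n w |n w. n < m * q \<and> w \<in> B}"
        by (intro s.span_sum single_span) simp_all
      then show "F \<in> s.span {single n w |n w. n < m * q \<and> w \<in> B}"
        by (subst F_eq)
    qed
    show "A a F \<in> V p" if "a \<in> J" "F \<in> V p" for a p F using AV V_dec that by blast
    show "A a F \<in> V (Suc p)" if "a \<in> J \<inter> nil" "F \<in> V p" for a p F using AV that by blast
    show "X F \<in> V p" if "F \<in> V p" for p F using XV[OF that] V_dec by blast
    show "(x \<in> nil \<and> J \<subseteq> nil \<and> (\<forall>p. \<forall>F\<in>V p. X F \<in> V (Suc p))) \<or> nil \<subseteq> J" using x Jn XV by blast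
    show "(\<lambda>d. if d = 0 then w else 0) \<in> V 0" if "w \<in> W 0" for w
      using that W0 by (simp add: V_def)
    show "(\<lambda>d. if d = 1 then w else 0) \<in> V 0" if "w \<in> W 0" for w
      using that W0 by (simp add: V_def q_def)
  qed
  then show ?thesis by blast
qed

definition tens :: "'w \<Rightarrow> 'a fps \<Rightarrow> nat \<Rightarrow> 'w" where "tens w f = (\<lambda>d. fps_nth f d *w w)"

lemma tens_simps: "tens (w + w') f = tens w f + tens w' f" "tens (c *w w) f = ss c (tens w f)"
  "tens w (f + g) = tens w f + tens w g" "tens w (fps_const c * f) = ss c (tens w f)" "tens 0 f = 0" "tens w 0 = 0"
  by (auto simp: tens_def ss_def fun_eq_iff w.scale_right_distrib w.scale_left_distrib mult.commute)

lemma X_tens: "X (tens w f) = tens w (fps_deriv f)"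
  by (auto simp: X_def tens_def fun_eq_iff)

end

sublocale rep_extension \<subseteq> f: char0_space "\<lambda>c f. fps_const c * (f :: 'a fps)"
  by unfold_locales (auto simp: algebra_simps simp flip: fps_const_add fps_const_mult)

context rep_extension
begin

lemma tens_span:
  assumes "w \<in> w.span B" "f \<in> f.span T"
  shows "tens w f \<in> s.span {tens w f |w f. w \<in> B \<and> f \<in> T}" (is "_ \<in> s.span ?S")
  using assms(2)
proof (induction rule: f.span_induct_alt)
  case (step c f g)
  have "tens w f \<in> s.span ?S"
    using assms(1)
  proof (induction rule: w.span_induct_alt)
    case (step c w y)
    have "tens w f \<in> s.span ?S" using step(1) \<open>f \<in> T\<close> by (intro s.span_base) blast
    then show ?case unfolding tens_simps by (intro s.span_add s.span_scale step(2))
  qed (simp only: tens_simps s.span_zero)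
  then show ?case unfolding tens_simps by (intro s.span_add s.span_scale step(2))
qed (simp only: tens_simps s.span_zero)

text \<open>
  The entries of \<open>exp (t ad x)\<close> span, together with \<open>1\<close> and \<open>t\<close>, a finite-dimensional space \<open>S\<close> of
  power series closed under \<open>d/dt\<close>. A non-constant coefficient of \<open>exp (t ad x) a\<close> lies in the
  ideal \<open>nil\<close>, so a factor from \<open>S\<close> always comes with a step down the flag \<open>W\<close>, and products of
  boundedly many elements of \<open>S\<close> suffice.
\<close>

lemma solvable_extend:
  assumes nJ: "nil \<subseteq> J"
  shows "\<exists>\<rho>' V. nil_rep scale b K ss (span (insert x J)) \<rho>' V"
proof -
  obtain N \<xi> where "relative_basis K nil N \<xi>"
    by (rule relative_basis_exists[OF K subspace_nil K_nil finite_over_mono[OF finite_K order_refl subset_UNIV]])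
  note N = relative_basisD[OF this]
  have xi_0: "\<xi> k 0 = 0" for k using N(4)[of k 0 0] by simp
  have xi_sum: "\<xi> k (sum f A) = (\<Sum>a\<in>A. \<xi> k (f a))" for k f and A :: "'g set"
    by (induction A rule: infinite_finite_induct) (auto simp: N(3) xi_0)
  have xi_K: "\<xi> k y = \<xi> k z" if "k \<in> N" "y - z \<in> K" for k y z
    using N(5)[OF that] N(3)[of k "y - z" z] by simp
  \<comment> \<open>\<open>s k a\<close> is coordinate \<open>k\<close> of
    \<open>exp (t ad x) a - a\<close>; the constant term is removed because \<open>a\<close> may lie
    outside \<open>nil\<close>. \<open>s' k l\<close> is the integral from 0 to \<open>t\<close> of
    coordinate \<open>k\<close> of \<open>exp (u ad x) l\<close>. Since \<open>(ad x)^i a\<close> is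
    \<open>(ad x)^(i-1)\<close> of \<open>[x, a]\<close>, which lies in \<open>nil\<close>, the
    finitely many \<open>s' k l\<close> span all \<open>s k a\<close>.\<close>
  define s where "s k a = Abs_fps (\<lambda>i. if i = 0 then 0 else \<xi> k ((b x ^^ i) a) / fact i)" for k a
  define s' where "s' k l = Abs_fps (\<lambda>i. if i = 0 then 0 else \<xi> k ((b x ^^ (i - 1)) l) / fact i)" for k l
  define S where "S = insert 1 (insert fps_X {s' k l |k l. k \<in> N \<and> l \<in> N})"
  have finS: "finite S" using finite_image_set2[of "\<lambda>k. k \<in> N" "\<lambda>k. k \<in> N" s'] N(1) by (simp add: S_def)
  have s_S: "s k a \<in> f.span S" if k: "k \<in> N" for k a
  proof -
    have "\<xi> k ((b x ^^ Suc i) a) = (\<Sum>l\<in>N. \<xi> l (b x a) * \<xi> k ((b x ^^ i) l))" for i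
    proof -
      have "(b x ^^ i) (b x a - (\<Sum>l\<in>N. \<xi> l (b x a) *s l)) \<in> K" by (intro pow_K N(7) b_nil)
      moreover have "(b x ^^ i) (b x a) = (b x ^^ i) (b x a - (\<Sum>l\<in>N. \<xi> l (b x a) *s l)) + (b x ^^ i) (\<Sum>l\<in>N. \<xi> l (b x a) *s l)"
        by (simp flip: pow_add)
      ultimately have "\<xi> k ((b x ^^ i) (b x a)) = \<xi> k ((b x ^^ i) (\<Sum>l\<in>N. \<xi> l (b x a) *s l))"
        by (intro xi_K[OF k]) simp
      also have "(b x ^^ i) (\<Sum>l\<in>N. \<xi> l (b x a) *s l) = (\<Sum>l\<in>N. \<xi> l (b x a) *s (b x ^^ i) l)"
        using N(1) by (induction N rule: finite_induct) (use pow_scale[of i 0 0] in \<open>auto simp: pow_add pow_scale\<close>)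
      finally show ?thesis by (simp add: funpow_swap1 xi_sum N(4))
    qed
    note * = this
    have "s k a = (\<Sum>l\<in>N. fps_const (\<xi> l (b x a)) * s' k l)"
    proof (rule fps_ext)
      fix i
      show "fps_nth (s k a) i = fps_nth (\<Sum>l\<in>N. fps_const (\<xi> l (b x a)) * s' k l) i"
        by (cases i) (simp_all add: s_def s'_def fps_sum_nth * sum_divide_distrib del: funpow.simps)
    qed
    also have "\<dots> \<in> f.span S"
      by (intro f.span_sum f.span_scale f.span_base) (use k in \<open>auto simp: S_def\<close>)
    finally show ?thesis .
  qed
  have deriv_S: "fps_deriv f \<in> f.span S" if f: "f \<in> S" for f
  proof -
    have 1: "fps_const c * 1 \<in> f.span S" for c by (intro f.span_scale f.span_base) (simp add: S_def)
    consider "f = 1" | "f = fps_X" | k l where "f = s' k l" "k \<in> N" "l \<in> N" using f unfolding S_def by blast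
    then show ?thesis
    proof cases
      case 3
      have "fps_deriv (s' k l) = fps_const (\<xi> k l) * 1 + s k l"
      proof (rule fps_ext)
        fix i
        have "(1 + of_nat i :: 'a) \<noteq> 0" by (metis of_nat_Suc of_nat_neq_0)
        then show "fps_nth (fps_deriv (s' k l)) i = fps_nth (fps_const (\<xi> k l) * 1 + s k l) i"
          by (cases i) (auto simp: s_def s'_def divide_simps)
      qed
      then show ?thesis using 1 s_S 3 by (simp only: f.span_add)
    qed (use 1[of 1] in \<open>auto simp: f.span_zero\<close>)
  qed
  \<comment> \<open>\<open>T j\<close> consists of the products of \<open>j + 1\<close> elements of
    \<open>S\<close>; as \<open>1\<close> lies in \<open>S\<close>, these sets increase.\<close>
  define T where "T j = ((\<lambda>T. {f * g |f g. f \<in> S \<and> g \<in> T}) ^^ j) S" for j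
  have T_0: "T 0 = S" and T_Suc: "T (Suc j) = {f * g |f g. f \<in> S \<and> g \<in> T j}" for j
    by (simp_all add: T_def)
  have finT: "finite (T j)" for j
    by (induction j) (use finS finite_image_set2[of "\<lambda>f. f \<in> S" "\<lambda>g. g \<in> T _" "(*)"] in \<open>auto simp: T_0 T_Suc\<close>)
  have "T j \<subseteq> T (Suc j)" for j
  proof
    fix f assume "f \<in> T j"
    moreover have "1 \<in> S" by (simp add: S_def)
    ultimately show "f \<in> T (Suc j)" unfolding T_Suc by (metis (mono_tags, lifting) mem_Collect_eq mult_1)
  qed
  then have T_mono: "f.span (T j) \<subseteq> f.span (T (Suc j))" for j by (rule f.span_mono)
  have T_mult: "f * g \<in> f.span (T (Suc j))" if "f \<in> f.span S" "g \<in> f.span (T j)" for f g j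
    using that(1)
  proof (induction rule: f.span_induct_alt)
    case (step c f h)
    have "f * g \<in> f.span (T (Suc j))"
      using that(2)
    proof (induction rule: f.span_induct_alt)
      case (step c g h)
      have "f * g \<in> f.span (T (Suc j))" using step(1) \<open>f \<in> S\<close> by (auto simp: T_Suc intro: f.span_base)
      moreover have "f * (fps_const c * g + h) = fps_const c * (f * g) + f * h" by (simp add: algebra_simps)
      ultimately show ?case using step(2) by (simp only: f.span_add f.span_scale)
    qed (simp add: f.span_zero)
    moreover have "(fps_const c * f + h) * g = fps_const c * (f * g) + h * g" by (simp add: algebra_simps)
    ultimately show ?case using step(2) by (simp only: f.span_add f.span_scale)
  qed (simp add: f.span_zero)
  have deriv_span: "fps_deriv f \<in> f.span U'" if "f \<in> f.span U" "\<And>u. u \<in> U \<Longrightarrow> fps_deriv u \<in> f.span U'" for f U U'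
    using that(1) by (induction rule: f.span_induct_alt) (auto simp: f.span_zero f.span_add f.span_scale that(2))
  have deriv_T: "fps_deriv f \<in> f.span (T j)" if "f \<in> T j" for f j
    using that
  proof (induction j arbitrary: f)
    case (Suc j)
    then obtain g h where gh: "f = g * h" "g \<in> S" "h \<in> T j" by (auto simp: T_Suc)
    have "g * fps_deriv h \<in> f.span (T (Suc j))" "fps_deriv g * h \<in> f.span (T (Suc j))"
      using gh Suc.IH deriv_S by (auto intro!: T_mult intro: f.span_base)
    then show ?case by (simp add: gh f.span_add)
  qed (simp add: T_0 deriv_S)
  \<comment> \<open>A vector of depth \<open>j\<close> in the flag may carry \<open>j + 1\<close>
    factors from \<open>S\<close>. Since \<open>W j\<close> vanishes for large \<open>j\<close>, the
    number of factors is bounded.\<close>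
  define G where "G p = {tens w f |w f j. p \<le> j \<and> w \<in> W j \<and> f \<in> f.span (T j)}" for p
  define V where "V p = s.span (G p)" for p
  have V_I: "tens w f \<in> V p" if "w \<in> W j" "f \<in> f.span (T j)" "p \<le> j" for w f j p
    unfolding V_def G_def using that by (intro s.span_base) blast
  have V_map: "L F \<in> V p'" if "\<And>F G. L (F + G) = L F + L G" "\<And>c F. L (ss c F) = ss c (L F)"
    "\<And>w f j. p \<le> j \<Longrightarrow> w \<in> W j \<Longrightarrow> f \<in> f.span (T j) \<Longrightarrow> L (tens w f) \<in> V p'" "F \<in> V p" for L F p p'
    using that(4) unfolding V_def[of p]
  proof (induction rule: s.span_induct_alt)
    case base
    have "L 0 = 0" using that(2)[of 0 0] unfolding s.scale_zero_left .
    then show ?case unfolding V_def by (metis s.span_zero)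
  next
    case (step c F F')
    have "L F \<in> s.span (G p')" using step(1) that(3) unfolding G_def V_def by blast
    then show ?case unfolding that(1,2) V_def
      by (intro s.span_add s.span_scale step(2)[unfolded V_def])
  qed
  obtain m where m: "W m = {0}" using W_end by blast
  obtain B where B: "finite B" "W 0 \<subseteq> w.span B" using W_finite by blast
  have W0: "0 \<in> W i" for i by (rule w.subspace_0[OF W])
  have W_m: "w = 0" if "w \<in> W i" "m \<le> i" for i w using W_antimono[OF that(2)] that(1) m by auto
  \<comment> \<open>The constant coefficient of \<open>exp (t ad x) a\<close> acts without a new
    series. Each other term brings a factor \<open>s k a\<close> together with
    \<open>\<rho> k\<close> for some \<open>k\<close> in \<open>nil\<close>, so the flag index pays
    for the extra factor.\<close>
  have A_tens: "A a (tens w f) = tens (\<rho> a w) f + (\<Sum>k\<in>N. tens (\<rho> k w) (s k a * f))" if a: "a \<in> J" for a w f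
  proof
    fix d
    have NJ: "k \<in> J" if "k \<in> N" for k using that N(2) nJ by blast
    have e_exp: "\<rho> (e i a) w = (if i = 0 then \<rho> a w else 0) + (\<Sum>k\<in>N. fps_nth (s k a) i *w \<rho> k w)" for i
    proof (cases i)
      case (Suc i')
      have "e i a \<in> nil" by (simp add: e_def Suc b_nil subspace_scale subspace_nil)
      then have "e i a - (\<Sum>k\<in>N. \<xi> k (e i a) *s k) \<in> K" by (rule N(7))
      then have "\<rho> (e i a) w = \<rho> (\<Sum>k\<in>N. \<xi> k (e i a) *s k) w" by (rule rho_cong[OF e_J[OF a]])
      also have "\<dots> = (\<Sum>k\<in>N. \<xi> k (e i a) *w \<rho> k w)"
        using NJ by (simp add: rho_sum subspace_scale[OF J] rho_scale)
      finally show ?thesis using Suc by (simp add: s_def e_def N(4) divide_inverse mult.commute del: fact_Suc)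
    qed (simp add: s_def e_0)
    have "A a (tens w f) d = (\<Sum>i\<le>d. fps_nth f (d - i) *w \<rho> (e i a) w)"
      by (simp add: A_def tens_def rho_scale_right e_J a)
    also have "\<dots> = fps_nth f d *w \<rho> a w + (\<Sum>i\<le>d. \<Sum>k\<in>N. (fps_nth (s k a) i * fps_nth f (d - i)) *w \<rho> k w)"
    proof -
      have "(\<Sum>i\<le>d. fps_nth f (d - i) *w (if i = 0 then \<rho> a w else 0)) = fps_nth f d *w \<rho> a w"
        by (subst sum.remove[of _ 0]) auto
      then show ?thesis
        by (simp only: e_exp w.scale_right_distrib sum.distrib w.scale_sum_right w.scale_scale mult.commute)
    qed
    also have "(\<Sum>i\<le>d. \<Sum>k\<in>N. (fps_nth (s k a) i * fps_nth f (d - i)) *w \<rho> k w) =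
        (\<Sum>k\<in>N. tens (\<rho> k w) (s k a * f) d)"
      by (subst sum.swap) (simp add: tens_def fps_mult_nth atLeast0AtMost w.scale_sum_left)
    also have "\<dots> = (\<Sum>k\<in>N. tens (\<rho> k w) (s k a * f)) d"
      by (rule sum_fun_apply[symmetric])
    finally show "A a (tens w f) d = (tens (\<rho> a w) f + (\<Sum>k\<in>N. tens (\<rho> k w) (s k a * f))) d"
      by (simp add: tens_def)
  qed
  have A_rest: "(\<Sum>k\<in>N. tens (\<rho> k w) (s k a * f)) \<in> V (Suc p)"
    if "w \<in> W j" "f \<in> f.span (T j)" "p \<le> j" for w f j p a
    using that N(2) nJ unfolding V_def
    by (intro s.span_sum) (auto intro!: V_I[unfolded V_def, of _ "Suc j"] rho_nil T_mult s_S)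
  have V_Suc: "V (Suc p) \<subseteq> V p" for p
  proof -
    have "G (Suc p) \<subseteq> G p" unfolding G_def by (blast intro: Suc_leD)
    then show ?thesis unfolding V_def by (rule s.span_mono)
  qed
  have sV: "s.subspace (V p)" for p by (simp add: V_def)
  have "\<exists>\<rho>'. nil_rep scale b K ss (span (insert x J)) \<rho>' V"
  proof (rule extend_to_flag)
    show "s.subspace (V p)" for p by (rule sV)
    show "V (Suc p) \<subseteq> V p" for p by (rule V_Suc)
    have "g = 0" if g: "g \<in> G m" for g
    proof -
      obtain w f j where wf: "g = tens w f" "m \<le> j" "w \<in> W j" using g unfolding G_def by blast
      have "w = 0" using W_m wf by blast
      then show ?thesis unfolding wf by (simp only: tens_simps)
    qed
    then have "G m \<subseteq> {0}" by blast
    then have "V m \<subseteq> {0}" unfolding V_def by (rule s.span_minimal) simp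
    then show "V m = {0}" using s.subspace_0[OF sV] by blast
    let ?B = "{tens w f |w f. w \<in> B \<and> f \<in> (\<Union>j<m. T j)}"
    show "finite ?B"
      using finite_image_set2[of "\<lambda>w. w \<in> B" "\<lambda>f. f \<in> (\<Union>j<m. T j)" tens] B(1) finT by simp
    have "tens w f \<in> s.span ?B" if "w \<in> W j" "f \<in> f.span (T j)" for w f j
    proof (cases "j < m")
      case True
      have "w \<in> w.span B" using that(1) W_antimono[of 0 j] B(2) by auto
      moreover have "f \<in> f.span (\<Union>j<m. T j)" using that(2) True f.span_mono[of "T j" "\<Union>j<m. T j"] by blast
      ultimately show ?thesis by (rule tens_span)
    qed (use W_m[OF that(1)] in \<open>simp add: tens_simps s.span_zero\<close>)
    then show "V 0 \<subseteq> s.span ?B" unfolding V_def by (intro s.span_minimal) (auto simp: G_def)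
    show "X F \<in> V p" if "F \<in> V p" for p F
      by (rule V_map[OF X_linear _ that], unfold X_tens, rule V_I, assumption, erule deriv_span, erule deriv_T, assumption)
    show "A a F \<in> V p" if a: "a \<in> J" and "F \<in> V p" for a p F
    proof (rule V_map[OF A_linear[OF a] _ that(2)])
      fix w f j assume *: "p \<le> j" "w \<in> W j" "f \<in> f.span (T j)"
      then show "A a (tens w f) \<in> V p"
        unfolding A_tens[OF a] using A_rest[OF *(2,3,1)] V_Suc a
        by (intro s.subspace_add[OF sV] V_I[of _ j] rho_W) auto
    qed
    show "A a F \<in> V (Suc p)" if a: "a \<in> J \<inter> nil" and "F \<in> V p" for a p F
    proof (rule V_map[OF A_linear _ that(2)])
      fix w f j assume *: "p \<le> j" "w \<in> W j" "f \<in> f.span (T j)"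
      have aJ: "a \<in> J" using a by simp
      show "A a (tens w f) \<in> V (Suc p)"
        unfolding A_tens[OF aJ] using A_rest[OF *(2,3,1)] a * T_mono
        by (intro s.subspace_add[OF sV] V_I[of _ "Suc j"] rho_nil) auto
    qed (use a in auto)
    show "(x \<in> nil \<and> J \<subseteq> nil \<and> (\<forall>p. \<forall>F\<in>V p. X F \<in> V (Suc p))) \<or> nil \<subseteq> J" using nJ by blast
    have S1: "1 \<in> f.span (T 0)" "fps_X \<in> f.span (T 0)" by (auto simp: T_0 S_def intro: f.span_base)
    show "(\<lambda>d. if d = 0 then w else 0) \<in> V 0" if "w \<in> W 0" for w
    proof -
      have "(\<lambda>d. if d = 0 then w else 0) = tens w 1" by (auto simp: tens_def)
      then show ?thesis using V_I[OF that S1(1)] by simp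
    qed
    show "(\<lambda>d. if d = 1 then w else 0) \<in> V 0" if "w \<in> W 0" for w
    proof -
      have "(\<lambda>d. if d = 1 then w else 0) = tens w fps_X" by (auto simp: tens_def)
      then show ?thesis using V_I[OF that S1(2)] by simp
    qed
  qed
  then show ?thesis by blast
qed

end

section \<open>Faithful matrices for solvable Lie algebras\<close>

definition fun_scale :: "'a::field_char_0 \<Rightarrow> (nat \<Rightarrow> 'a) \<Rightarrow> nat \<Rightarrow> 'a" where
  "fun_scale c f = (\<lambda>i. c * f i)"

interpretation fun_scale: char0_space fun_scale
  by unfold_locales (auto simp: fun_scale_def fun_eq_iff algebra_simps)

definition (in leibniz_mod) matrix_rep :: "nat \<Rightarrow> ('g \<Rightarrow> nat \<Rightarrow> nat \<Rightarrow> 'a) \<Rightarrow> bool" where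
  "matrix_rep N R \<longleftrightarrow> (\<forall>x y i j. R (x + y) i j = R x i j + R y i j) \<and> (\<forall>c x i j. R (c *s x) i j = c * R x i j) \<and>
    (\<forall>x y i j. j < N \<longrightarrow> R (b x y) i j = (\<Sum>l<N. R x i l * R y l j - R y i l * R x l j)) \<and>
    (\<forall>x. x \<in> K \<longleftrightarrow> (\<forall>i<N. \<forall>j<N. R x i j = 0))"

context nil_rep
begin

definition coordinates :: "nat \<Rightarrow> (nat \<Rightarrow> 'w) \<Rightarrow> (nat \<Rightarrow> 'w \<Rightarrow> 'a) \<Rightarrow> bool" where
  "coordinates N h \<xi> \<longleftrightarrow> (\<forall>i x y. \<xi> i (x + y) = \<xi> i x + \<xi> i y) \<and> (\<forall>i c x. \<xi> i (c *w x) = c * \<xi> i x) \<and>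
    (\<forall>i<N. h i \<in> W 0) \<and> (\<forall>v\<in>W 0. v = (\<Sum>i<N. \<xi> i v *w h i))"

lemma coordinatesD:
  assumes "coordinates N h \<xi>"
  shows "\<xi> i (x + y) = \<xi> i x + \<xi> i y" "\<xi> i (c *w x) = c * \<xi> i x"
    "i < N \<Longrightarrow> h i \<in> W 0" "v \<in> W 0 \<Longrightarrow> v = (\<Sum>i<N. \<xi> i v *w h i)"
  using assms unfolding coordinates_def by blast+

lemma coordinates_exist:
  obtains N h \<xi> where "coordinates N h \<xi>"
proof -
  have "w.finite_over {0} (W 0)"
    using W_finite w.span_mono unfolding w.finite_over_def by (metis inf_sup_ord(4) order_trans)
  then obtain B \<xi> where "w.relative_basis {0} (W 0) B \<xi>"
    using w.relative_basis_exists[OF w.subspace_single_0 W] w.subspace_0[OF W] by blast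
  note B = w.relative_basisD[OF this]
  obtain h where h: "bij_betw h {..<card B} B"
    using ex_bij_betw_nat_finite[OF B(1)] by (auto simp: atLeast0LessThan)
  show thesis
  proof (rule that[of "card B" h "\<lambda>i. \<xi> (h i)"], unfold coordinates_def, intro conjI allI impI ballI)
    show "h i \<in> W 0" if "i < card B" for i using h B(2) that bij_betwE by blast
    show "v = (\<Sum>i<card B. \<xi> (h i) v *w h i)" if "v \<in> W 0" for v
    proof -
      have "v = (\<Sum>b\<in>B. \<xi> b v *w b)" using B(7)[OF that] by simp
      then show ?thesis using sum.reindex_bij_betw[OF h, of "\<lambda>b. \<xi> b v *w b"] by simp
    qed
  qed (simp_all add: B)
qed

text \<open>Each extension replaces the carrier \<open>'w\<close> by
  \<open>nat \<Rightarrow> 'w\<close>. Coordinates on the finite-dimensional \<open>W 0\<close>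
  bring the representation back to one fixed type, so that the maximality arguments over
  \<open>J\<close> can quantify over representations.\<close>

lemma rep_on_functions: "\<exists>\<rho>' W'. nil_rep scale b K fun_scale J \<rho>' W'"
proof -
  obtain N h \<xi> where "coordinates N h \<xi>" by (rule coordinates_exist)
  note xi = coordinatesD[OF this]
  define \<phi> where "\<phi> v = (\<lambda>i. if i < N then \<xi> i v else 0)" for v
  define \<psi> where "\<psi> f = (\<Sum>i<N. f i *w h i)" for f
  have phi_add: "\<phi> (v + v') = \<phi> v + \<phi> v'" and phi_scale: "\<phi> (c *w v) = fun_scale c (\<phi> v)" for v v' c
    by (auto simp: \<phi>_def fun_scale_def xi)
  have phi_0: "\<phi> 0 = 0" using phi_scale[of 0 0] by (simp only: w.scale_zero_left fun_scale.scale_zero_left)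
  have phi_diff: "\<phi> (v - v') = \<phi> v - \<phi> v'" for v v'
    using phi_add[of "v - v'" v'] by (metis add_diff_cancel diff_add_cancel)
  have psi_add: "\<psi> (f + g) = \<psi> f + \<psi> g" and psi_scale: "\<psi> (fun_scale c f) = c *w \<psi> f" for f g c
    by (auto simp: \<psi>_def fun_scale_def w.scale_left_distrib sum.distrib w.scale_sum_right)
  have psi_W: "\<psi> f \<in> W 0" for f
    unfolding \<psi>_def by (intro w.subspace_sum[OF W] w.subspace_scale[OF W]) (simp add: xi)
  have psi_phi: "\<psi> (\<phi> v) = v" if "v \<in> W 0" for v
    using xi(4)[OF that] by (simp add: \<psi>_def \<phi>_def)
  have W_sub: "W i \<subseteq> W 0" for i by (rule lift_Suc_antimono_le[of W]) (use W_Suc in auto)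
  define \<rho>' where "\<rho>' x f = \<phi> (\<rho> x (\<psi> f))" for x f
  define W' where "W' i = \<phi> ` W i" for i
  have rho': "\<rho>' x (\<phi> v) = \<phi> (\<rho> x v)" if "v \<in> W i" for x v i
    using that W_sub psi_phi unfolding \<rho>'_def by (metis subsetD)
  obtain m where m: "W m = {0}" using W_end by blast
  obtain B where B: "finite B" "W 0 \<subseteq> w.span B" using W_finite by blast
  have "nil_rep scale b K fun_scale J \<rho>' W'"
  proof
    show "\<rho>' (x + y) f = \<rho>' x f + \<rho>' y f" if "x \<in> J" "y \<in> J" for x y f
      unfolding \<rho>'_def rho_add[OF that] phi_add ..
    show "\<rho>' (c *s x) f = fun_scale c (\<rho>' x f)" if "x \<in> J" for c x f
      unfolding \<rho>'_def rho_scale[OF that] phi_scale ..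
    show "\<rho>' x (f + g) = \<rho>' x f + \<rho>' x g" if "x \<in> J" for x f g
      unfolding \<rho>'_def psi_add rho_add_right[OF that] phi_add ..
    show "\<rho>' x (fun_scale c f) = fun_scale c (\<rho>' x f)" if "x \<in> J" for c x f
      unfolding \<rho>'_def psi_scale rho_scale_right[OF that] phi_scale ..
    show "\<rho>' (b x y) f = \<rho>' x (\<rho>' y f) - \<rho>' y (\<rho>' x f)" if "x \<in> J" "y \<in> J" for x y f
    proof -
      have "\<rho> x (\<psi> f) \<in> W 0" "\<rho> y (\<psi> f) \<in> W 0" using rho_W that psi_W by auto
      then show ?thesis unfolding \<rho>'_def by (simp only: psi_phi rho_b[OF that] phi_diff)
    qed
    show "\<rho>' k f = 0" if "k \<in> K" for k f unfolding \<rho>'_def rho_K[OF that] by (rule phi_0)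
    show "fun_scale.subspace (W' i)" for i
    proof (rule fun_scale.subspaceI)
      show "0 \<in> W' i" unfolding W'_def using phi_0 w.subspace_0[OF W] by (metis image_eqI)
      show "f + g \<in> W' i" if "f \<in> W' i" "g \<in> W' i" for f g
        using that w.subspace_add[OF W[of i]] unfolding W'_def by (auto simp flip: phi_add)
      show "fun_scale c f \<in> W' i" if "f \<in> W' i" for c f
        using that w.subspace_scale[OF W[of i]] unfolding W'_def by (auto simp flip: phi_scale)
    qed
    show "W' (Suc i) \<subseteq> W' i" for i unfolding W'_def using W_Suc by (rule image_mono)
    show "\<exists>m. W' m = {0}" using m phi_0 unfolding W'_def by (metis image_empty image_insert)
    show "W' 0 \<noteq> {0}"
    proof
      assume *: "W' 0 = {0}"
      have "v = 0" if "v \<in> W 0" for v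
        using psi_phi[OF that] psi_phi[OF w.subspace_0[OF W]] * that phi_0 unfolding W'_def
        by (metis image_eqI singletonD)
      then show False using W_nontrivial w.subspace_0[OF W] by blast
    qed
    have "\<phi> v \<in> fun_scale.span (\<phi> ` B)" if "v \<in> w.span B" for v
      using that
    proof (induction rule: w.span_induct_alt)
      case base
      show ?case unfolding phi_0 by (rule fun_scale.span_zero)
    next
      case (step c x y)
      then show ?case unfolding phi_add phi_scale
        by (blast intro: fun_scale.span_add fun_scale.span_scale fun_scale.span_base)
    qed
    then show "\<exists>B. finite B \<and> W' 0 \<subseteq> fun_scale.span B"
      using B unfolding W'_def by (intro exI[of _ "\<phi> ` B"]) blast
    show "\<rho>' x f \<in> W' i" if "x \<in> J" "f \<in> W' i" for x f i
      using that rho' rho_W unfolding W'_def by auto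
    show "\<rho>' x f \<in> W' (Suc i)" if "x \<in> J" "x \<in> nil" "f \<in> W' i" for x f i
      using that rho' rho_nil unfolding W'_def by auto
    show "x \<in> K" if x: "x \<in> J" and 0: "\<And>f. f \<in> W' 0 \<Longrightarrow> \<rho>' x f = 0" for x
    proof (rule rho_faithful[OF x])
      fix v assume v: "v \<in> W 0"
      then have "\<phi> (\<rho> x v) = 0" using 0[of "\<phi> v"] rho'[OF v] unfolding W'_def by (metis image_eqI)
      then have "\<rho> x v = \<psi> (\<phi> 0)" using psi_phi[OF rho_W[OF x v]] phi_0 by metis
      then show "\<rho> x v = 0" using psi_phi[OF w.subspace_0[OF W]] by simp
    qed
  qed
  then show ?thesis by blast
qed

lemma matrix_rep_exists:
  assumes "J = UNIV"
  shows "\<exists>N R. matrix_rep N R"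
proof -
  obtain N h \<xi> where "coordinates N h \<xi>" by (rule coordinates_exist)
  note xi = coordinatesD[OF this]
  have J: "x \<in> J" for x using assms by simp
  have xi_0: "\<xi> i 0 = 0" for i using xi(2)[of i 0 0] by simp
  have xi_diff: "\<xi> i (x - y) = \<xi> i x - \<xi> i y" for i x y
    using xi(1)[of i "x - y" y] by simp
  have xi_sum: "\<xi> i (sum f A) = (\<Sum>a\<in>A. \<xi> i (f a))" for i f and A :: "nat set"
    by (induction A rule: infinite_finite_induct) (auto simp: xi xi_0)
  have rho_sum: "\<rho> x (sum f A) = (\<Sum>a\<in>A. \<rho> x (f a))" for x f and A :: "nat set"
    by (induction A rule: infinite_finite_induct) (use rho_scale_right[OF J, of x 0 0] in \<open>auto simp: rho_add_right[OF J]\<close>)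
  define R where "R x i j = \<xi> i (\<rho> x (h j))" for x i j
  have prod: "\<xi> i (\<rho> x (\<rho> y (h j))) = (\<Sum>l<N. R x i l * R y l j)" if "j < N" for x y i j
  proof -
    have "\<rho> y (h j) = (\<Sum>l<N. R y l j *w h l)"
      unfolding R_def by (intro xi(4) rho_W J xi(3) that)
    then have "\<xi> i (\<rho> x (\<rho> y (h j))) = \<xi> i (\<rho> x (\<Sum>l<N. R y l j *w h l))" by (rule arg_cong)
    then show ?thesis by (simp add: rho_sum xi_sum rho_scale_right[OF J] xi(2) R_def mult.commute)
  qed
  show ?thesis
  proof (rule exI[of _ N], rule exI[of _ R], unfold matrix_rep_def, intro conjI allI impI)
    show "R (x + y) i j = R x i j + R y i j" for x y i j by (simp add: R_def rho_add[OF J J] xi)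
    show "R (c *s x) i j = c * R x i j" for c x i j by (simp add: R_def rho_scale[OF J] xi)
    show "R (b x y) i j = (\<Sum>l<N. R x i l * R y l j - R y i l * R x l j)" if "j < N" for x y i j
      unfolding R_def[of "b x y"] rho_b[OF J J] xi_diff prod[OF that] by (rule sum_subtractf[symmetric])
    show "x \<in> K \<longleftrightarrow> (\<forall>i<N. \<forall>j<N. R x i j = 0)" for x
    proof
      assume "x \<in> K"
      then show "\<forall>i<N. \<forall>j<N. R x i j = 0" by (simp add: R_def rho_K xi_0)
    next
      assume 0: "\<forall>i<N. \<forall>j<N. R x i j = 0"
      show "x \<in> K"
      proof (rule rho_faithful[OF J])
        fix v assume v: "v \<in> W 0"
        have "\<rho> x (h j) = 0" if "j < N" for j
          using xi(4)[OF rho_W[OF J xi(3)[OF that]], of x] 0 that by (simp add: R_def)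
        then have "\<rho> x (\<Sum>i<N. \<xi> i v *w h i) = 0"
          by (simp add: rho_sum rho_scale_right[OF J])
        then show "\<rho> x v = 0" by (simp flip: xi(4)[OF v])
      qed
    qed
  qed
qed

end

context solvable_leibniz_mod
begin

lemma trivial_nil_rep: "\<exists>\<rho> W. nil_rep scale b K fun_scale K \<rho> W"
proof -
  define W :: "nat \<Rightarrow> (nat \<Rightarrow> 'a) set" where "W i = (if i = 0 then {f. \<forall>j>0. f j = 0} else {0})" for i
  have "nil_rep scale b K fun_scale K (\<lambda>x f. 0) W"
  proof
    show "fun_scale.subspace (W i)" for i
    proof (cases "i = 0")
      case True
      then show ?thesis by (intro fun_scale.subspaceI) (auto simp: W_def fun_scale_def)
    qed (simp add: W_def)
    show "W (Suc i) \<subseteq> W i" for i by (auto simp: W_def)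
    show "\<exists>m. W m = {0}" by (rule exI[of _ 1]) (simp add: W_def)
    let ?e = "\<lambda>i::nat. if i = 0 then 1 else 0 :: 'a"
    have e: "?e \<in> W 0" by (simp add: W_def)
    show "W 0 \<noteq> {0}"
    proof
      assume "W 0 = {0}"
      from e[unfolded this] have "?e = 0" by (rule singletonD)
      from fun_cong[OF this, of 0] show False by simp
    qed
    have "f \<in> fun_scale.span {?e}" if "f \<in> W 0" for f
    proof -
      have "fun_scale (f 0) ?e = f" using that by (auto simp: W_def fun_scale_def fun_eq_iff)
      then show ?thesis by (metis fun_scale.span_base fun_scale.span_scale singletonI)
    qed
    then show "\<exists>B. finite B \<and> W 0 \<subseteq> fun_scale.span B" by (intro exI[of _ "{?e}"]) blast
    show "0 \<in> W i" for i by (auto simp: W_def)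
    show "0 \<in> W (Suc i)" for i by (auto simp: W_def)
  qed (simp_all add: fun_scale_def fun_eq_iff)
  then show ?thesis by blast
qed

lemma span_insert_bracket:
  assumes J: "subspace J" and "\<And>a. a \<in> J \<Longrightarrow> b y a \<in> J" "b y x \<in> J" "a \<in> span (insert x J)"
  shows "b y a \<in> J"
  using assms(4)
proof (induction rule: span_induct_alt)
  case (step c u v)
  have "b y u \<in> J" using step(1) assms by blast
  then show ?case using step(2) by (simp add: b_add_right b_scale_right subspace_add[OF J] subspace_scale[OF J])
qed (simp add: subspace_0[OF J])

text \<open>\<open>J\<close> grows inside \<open>nil\<close> through ideals of \<open>nil\<close>:
  \<open>nil_central_step\<close> supplies \<open>x\<close> with
  \<open>[nil, x] \<subseteq> J\<close>, and \<open>ad x\<close> is nilpotent, so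
  \<open>nil_extend\<close> applies.\<close>

lemma nil_rep_nil: "\<exists>\<rho> W. nil_rep scale b K fun_scale nil \<rho> W"
proof -
  define P where "P J \<longleftrightarrow> subspace J \<and> K \<subseteq> J \<and> J \<subseteq> nil \<and> (\<forall>y\<in>nil. \<forall>a\<in>J. b y a \<in> J) \<and>
    (\<exists>\<rho> W. nil_rep scale b K fun_scale J \<rho> W)" for J
  have "P K" unfolding P_def by (intro conjI K order_refl K_nil trivial_nil_rep ballI K_right)
  moreover have "subspace J \<and> K \<subseteq> J" if "P J" for J using that by (simp add: P_def)
  ultimately obtain J where PJ: "P J" and Jmax: "\<And>J'. P J' \<Longrightarrow> J \<subseteq> J' \<Longrightarrow> J' = J"
    using maximal_subspace[OF finite_K, of P] by meson
  have sJ: "subspace J" and KJ: "K \<subseteq> J" and Jn: "J \<subseteq> nil" and idl: "\<And>y a. y \<in> nil \<Longrightarrow> a \<in> J \<Longrightarrow> b y a \<in> J"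
    using PJ unfolding P_def by (elim conjE, blast)+
  obtain \<rho> W where rep: "nil_rep scale b K fun_scale J \<rho> W"
    using PJ unfolding P_def by (elim conjE exE)
  have "J = nil"
  proof (rule ccontr)
    assume "J \<noteq> nil"
    then have "J \<subset> nil" using Jn by blast
    then obtain x where x: "x \<in> nil" "x \<notin> J" "\<And>y. y \<in> nil \<Longrightarrow> b y x \<in> J"
      using nil_central_step[OF sJ KJ] by blast
    interpret rep_extension scale b K fun_scale J \<rho> W x
      using rep sJ KJ x idl Jn by (intro rep_extension.intro rep_extension_axioms.intro) auto
    obtain r where r: "\<And>y. (b x ^^ r) y \<in> K" using nil_ad_nilpotent[OF x(1)] by blast
    obtain \<rho>' V where "nil_rep scale b K ss (span (insert x J)) \<rho>' V"
      using nil_extend[OF x(1) Jn r] by (elim exE)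
    then have "\<exists>\<rho> W. nil_rep scale b K fun_scale (span (insert x J)) \<rho> W"
      by (rule nil_rep.rep_on_functions)
    moreover have "b y a \<in> span (insert x J)" if "y \<in> nil" "a \<in> span (insert x J)" for y a
      using span_insert_bracket[OF sJ idl[OF that(1)] x(3)[OF that(1)] that(2)] by (auto intro: span_base)
    moreover have "span (insert x J) \<subseteq> nil" using x(1) Jn subspace_nil by (simp add: span_minimal)
    moreover have "K \<subseteq> span (insert x J)" using KJ span_base by blast
    ultimately have "P (span (insert x J))" unfolding P_def by (intro conjI subspace_span ballI)
    moreover have "J \<subseteq> span (insert x J)" using span_base by blast
    ultimately have "span (insert x J) = J" by (rule Jmax)
    then show False using x(2) span_base by blast
  qed
  then show ?thesis using rep by (intro exI) simp
qed

text \<open>Above \<open>nil\<close> any \<open>x\<close> outside \<open>J\<close> may be adjoined,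
  since all brackets lie in \<open>nil\<close> and hence in \<open>J\<close>.\<close>

lemma nil_rep_UNIV: "\<exists>\<rho> W. nil_rep scale b K fun_scale UNIV \<rho> W"
proof -
  define P where "P J \<longleftrightarrow> subspace J \<and> nil \<subseteq> J \<and> (\<exists>\<rho> W. nil_rep scale b K fun_scale J \<rho> W)" for J
  have "P nil" unfolding P_def by (intro conjI subspace_nil order_refl nil_rep_nil)
  moreover have "subspace J \<and> K \<subseteq> J" if "P J" for J using that K_nil unfolding P_def by (elim conjE) blast
  ultimately obtain J where PJ: "P J" and Jmax: "\<And>J'. P J' \<Longrightarrow> J \<subseteq> J' \<Longrightarrow> J' = J"
    using maximal_subspace[OF finite_K, of P] by meson
  have sJ: "subspace J" and nJ: "nil \<subseteq> J" using PJ unfolding P_def by (elim conjE, blast)+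
  obtain \<rho> W where rep: "nil_rep scale b K fun_scale J \<rho> W"
    using PJ unfolding P_def by (elim conjE exE)
  have "x \<in> J" for x
  proof (rule ccontr)
    assume x: "x \<notin> J"
    interpret rep_extension scale b K fun_scale J \<rho> W x
      using rep sJ x K_nil nJ b_nil by (intro rep_extension.intro rep_extension_axioms.intro) auto
    obtain \<rho>' V where "nil_rep scale b K ss (span (insert x J)) \<rho>' V"
      using solvable_extend[OF nJ] by (elim exE)
    then have "\<exists>\<rho> W. nil_rep scale b K fun_scale (span (insert x J)) \<rho> W"
      by (rule nil_rep.rep_on_functions)
    moreover have J_sub: "J \<subseteq> span (insert x J)" using span_base by blast
    ultimately have "P (span (insert x J))" unfolding P_def using nJ by (intro conjI subspace_span) blast+
    then have "span (insert x J) = J" using J_sub by (rule Jmax)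
    then show False using x span_base by blast
  qed
  then have "J = UNIV" by blast
  then show ?thesis using rep by (intro exI) simp
qed

text \<open>Ado's theorem for the solvable Lie algebra \<open>UNIV / K\<close>.\<close>

theorem faithful_matrices:
  "\<exists>N R. matrix_rep N R"
proof -
  obtain \<rho> W where "nil_rep scale b K fun_scale UNIV \<rho> W" using nil_rep_UNIV by (elim exE)
  then show ?thesis by (rule nil_rep.matrix_rep_exists) simp
qed

end

section \<open>Local finiteness of the adjoint representation\<close>

locale poly_module = module scale
  for scale :: "'k::field_char_0 poly \<Rightarrow> 'l::ab_group_add \<Rightarrow> 'l" (infixr "*h" 75)
begin

abbreviation D :: "'l \<Rightarrow> 'l" where "D x \<equiv> [:0, 1:] *h x"

text \<open>The same group as a vector space over the constants: \<open>k.span\<close> and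
  \<open>k.subspace\<close> are over \<open>k\<close>, while \<open>span\<close> and
  \<open>subspace\<close> are over \<open>k[D]\<close>.\<close>

sublocale k: char0_space "\<lambda>c. scale [:c:]"
proof
  fix a b :: 'k and x y :: 'l
  show "[:a:] *h (x + y) = [:a:] *h x + [:a:] *h y" by (rule scale_right_distrib)
  show "[:a + b:] *h x = [:a:] *h x + [:b:] *h x" by (simp flip: scale_left_distrib)
  show "[:a:] *h [:b:] *h x = [:a * b:] *h x" by (simp add: mult.commute)
  show "[:1:] *h x = x" by (simp flip: one_pCons)
qed

lemma scale_of_nat: "of_nat n *h x = [:of_nat n:] *h x"
  by (simp add: of_nat_poly)

lemma scale_pCons: "pCons a p *h x = [:a:] *h x + D (p *h x)"
proof -
  have "pCons a p = [:a:] + [:0, 1:] * p" by simp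
  then show ?thesis by (simp only: scale_left_distrib scale_scale)
qed

lemma D_k: "D ([:c:] *h x) = [:c:] *h D x"
  by (simp add: mult.commute)

lemma subspaceI_k:
  assumes "k.subspace S" "\<And>x. x \<in> S \<Longrightarrow> D x \<in> S"
  shows "subspace S"
proof (rule subspaceI)
  show "p *h x \<in> S" if "x \<in> S" for p x
  proof (induction p)
    case (pCons a p)
    show ?case unfolding scale_pCons[of a p]
      by (intro k.subspace_add[OF assms(1)] k.subspace_scale[OF assms(1)] assms(2) that pCons)
  qed (simp add: k.subspace_0[OF assms(1)])
qed (use k.subspace_0[OF assms(1)] k.subspace_add[OF assms(1)] in auto)

lemma subspace_k: "subspace S \<Longrightarrow> k.subspace S"
  by (rule k.subspaceI) (auto simp: subspace_0 subspace_add subspace_scale)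

lemma k_span_subset: "k.span X \<subseteq> span X"
  by (rule k.span_minimal) (auto intro: span_base subspace_k)

text \<open>Induction on the generators. The coefficients of \<open>a\<close> in elements of
  \<open>S\<close> form an ideal of the principal ideal domain \<open>k[D]\<close>; a lift of its
  generator, together with generators of \<open>S \<inter> span F\<close>, generates
  \<open>S\<close>.\<close>

lemma noetherian:
  assumes "finite F" "subspace S" "S \<subseteq> span F"
  shows "\<exists>G. finite G \<and> G \<subseteq> S \<and> S \<subseteq> span G"
  using assms
proof (induction F arbitrary: S rule: finite_induct)
  case empty
  then show ?case by (intro exI[of _ "{}"]) auto
next
  case (insert a F)
  define I where "I = {r. \<exists>w\<in>span F. r *h a + w \<in> S}"
  have I_add: "r + r' \<in> I" if "r \<in> I" "r' \<in> I" for r r'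
  proof -
    obtain w w' where w: "w \<in> span F" "r *h a + w \<in> S" "w' \<in> span F" "r' *h a + w' \<in> S"
      using \<open>r \<in> I\<close> \<open>r' \<in> I\<close> unfolding I_def by blast
    have "(r + r') *h a + (w + w') = (r *h a + w) + (r' *h a + w')"
      by (simp add: scale_left_distrib)
    then have "(r + r') *h a + (w + w') \<in> S" using subspace_add[OF insert.prems(1) w(2,4)] by (simp only:)
    then show ?thesis using span_add[OF w(1,3)] unfolding I_def by blast
  qed
  have I_mult: "q * r \<in> I" if "r \<in> I" for q r
  proof -
    obtain w where w: "w \<in> span F" "r *h a + w \<in> S" using \<open>r \<in> I\<close> unfolding I_def by blast
    have "(q * r) *h a + q *h w = q *h (r *h a + w)" by (simp add: scale_right_distrib)
    then have "(q * r) *h a + q *h w \<in> S" using subspace_scale[OF insert.prems(1) w(2)] by (simp only:)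
    then show ?thesis using span_scale[OF w(1)] unfolding I_def by blast
  qed
  have "\<exists>g\<in>I. \<forall>r\<in>I. g dvd r"
  proof (cases "\<exists>r\<in>I. r \<noteq> 0")
    case True
    then obtain g where g: "g \<in> I" "g \<noteq> 0" "\<And>r. r \<in> I \<Longrightarrow> r \<noteq> 0 \<Longrightarrow> degree g \<le> degree r"
      using ex_has_least_nat[of "\<lambda>r. r \<in> I \<and> r \<noteq> 0" _ degree] by blast
    have "g dvd r" if "r \<in> I" for r
    proof -
      have "r mod g = r + (- (r div g)) * g" by (simp add: minus_div_mult_eq_mod)
      then have "r mod g \<in> I" using I_add[OF that I_mult[OF g(1)]] by metis
      then have "r mod g = 0" using g(3)[of "r mod g"] degree_mod_less'[OF g(2), of r] by linarith
      then show ?thesis by (simp add: mod_eq_0_iff_dvd)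
    qed
    then show ?thesis using g by blast
  next
    case False
    have "0 \<in> I" unfolding I_def using subspace_0[OF insert.prems(1)] span_zero by fastforce
    then show ?thesis using False by auto
  qed
  then obtain g where g: "g \<in> I" "\<And>r. r \<in> I \<Longrightarrow> g dvd r" by blast
  obtain w0 where w0: "w0 \<in> span F" "g *h a + w0 \<in> S" using g(1) unfolding I_def by blast
  obtain G where G: "finite G" "G \<subseteq> S \<inter> span F" "S \<inter> span F \<subseteq> span G"
    using insert.IH[of "S \<inter> span F"] subspace_inter[OF insert.prems(1)] by auto
  let ?G = "insert (g *h a + w0) G"
  have "s \<in> span ?G" if s: "s \<in> S" for s
  proof -
    obtain r where r: "s - r *h a \<in> span F" using s insert.prems(2) by (auto simp: span_insert)
    have "r *h a + (s - r *h a) \<in> S" using s by simp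
    then have "r \<in> I" using r unfolding I_def by blast
    then obtain q where q: "r = g * q" using g(2) by (auto elim: dvdE)
    have e: "s - q *h (g *h a + w0) = (s - r *h a) - q *h w0"
      by (simp add: q scale_right_distrib mult.commute)
    have "s - q *h (g *h a + w0) \<in> S"
      by (intro subspace_diff[OF insert.prems(1)] s subspace_scale[OF insert.prems(1)] w0)
    moreover have "s - q *h (g *h a + w0) \<in> span F"
      unfolding e by (intro span_diff span_scale r w0)
    ultimately have "s - q *h (g *h a + w0) \<in> span G" using G(3) by blast
    then show ?thesis by (auto simp: span_insert)
  qed
  then show ?case using G w0 by (intro exI[of _ ?G]) auto
qed

lemma span_finite_subset:
  assumes "v \<in> span Y"
  shows "\<exists>T. finite T \<and> T \<subseteq> Y \<and> v \<in> span T"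
  using assms
proof (induction rule: span_induct_alt)
  case base
  then show ?case by (intro exI[of _ "{}"]) auto
next
  case (step c x y)
  then obtain T where "finite T" "T \<subseteq> Y" "y \<in> span T" by blast
  then show ?case using step(1) span_mono[of T "insert x T"]
    by (intro exI[of _ "insert x T"]) (auto intro!: span_add span_scale intro: span_base)
qed

lemma finite_generating_subset:
  assumes "finite F" "span F = UNIV"
  shows "\<exists>T. finite T \<and> T \<subseteq> Y \<and> Y \<subseteq> span T"
proof -
  obtain G where G: "finite G" "G \<subseteq> span Y" "span Y \<subseteq> span G"
    using noetherian[OF assms(1), of "span Y"] assms(2) by auto
  then have "\<forall>g\<in>G. \<exists>T. finite T \<and> T \<subseteq> Y \<and> g \<in> span T" using span_finite_subset by blast
  then obtain T where T: "\<And>g. g \<in> G \<Longrightarrow> finite (T g) \<and> T g \<subseteq> Y \<and> g \<in> span (T g)" by metis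
  have "G \<subseteq> span (\<Union>(T ` G))" using T span_mono[of "T _" "\<Union>(T ` G)"] by blast
  then have "span G \<subseteq> span (\<Union>(T ` G))" by (simp add: span_minimal)
  then have "Y \<subseteq> span (\<Union>(T ` G))" using G(3) span_superset by blast
  then show ?thesis using T G(1) by (intro exI[of _ "\<Union>(T ` G)"]) auto
qed

text \<open>The sum of \<open>D^i w_i\<close> over a list \<open>w_0, w_1, ...\<close>. It separates
  the \<open>k\<close>-coefficients from the powers of \<open>D\<close> in an element of a
  \<open>k[D]\<close>-span.\<close>

definition horner :: "'l list \<Rightarrow> 'l" where "horner ws = foldr (\<lambda>w z. w + D z) ws 0"

lemma horner_simps [simp]: "horner [] = 0" "horner (w # ws) = w + D (horner ws)"
  by (simp_all add: horner_def)

lemma horner_append: "horner (ws @ [w]) = horner ws + (D ^^ length ws) w"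
  by (induction ws) (simp_all add: scale_right_distrib)

lemma span_horner:
  assumes "v \<in> span Y"
  obtains ws where "v = horner ws" "set ws \<subseteq> k.span Y"
proof -
  let ?S = "{horner ws |ws. set ws \<subseteq> k.span Y}"
  have add: "\<exists>ws''. set ws'' \<subseteq> k.span Y \<and> horner ws + horner ws' = horner ws''"
    if "set ws \<subseteq> k.span Y" "set ws' \<subseteq> k.span Y" for ws ws'
    using that
  proof (induction ws arbitrary: ws')
    case (Cons w ws)
    show ?case
    proof (cases ws')
      case Nil
      then show ?thesis using Cons by (intro exI[of _ "w # ws"]) auto
    next
      case (Cons w' vs)
      then obtain ws'' where "set ws'' \<subseteq> k.span Y" "horner ws + horner vs = horner ws''"
        using Cons.IH[of vs] Cons.prems by auto
      then show ?thesis using Cons Cons.prems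
        by (intro exI[of _ "(w + w') # ws''"]) (auto simp: k.span_add scale_right_distrib algebra_simps simp flip: \<open>horner ws + horner vs = horner ws''\<close>)
    qed
  qed auto
  have "k.subspace ?S"
  proof (rule k.subspaceI)
    show "0 \<in> ?S" by (metis (mono_tags, lifting) empty_set empty_subsetI horner_simps(1) mem_Collect_eq)
    show "x + y \<in> ?S" if xy: "x \<in> ?S" "y \<in> ?S" for x y
    proof -
      obtain ws ws' where "x = horner ws" "set ws \<subseteq> k.span Y" "y = horner ws'" "set ws' \<subseteq> k.span Y"
        using xy by blast
      then show ?thesis using add[of ws ws'] by blast
    qed
    show "[:c:] *h x \<in> ?S" if x: "x \<in> ?S" for c x
    proof -
      obtain ws where ws: "x = horner ws" "set ws \<subseteq> k.span Y" using x by blast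
      have "[:c:] *h horner ws = horner (map (scale [:c:]) ws)"
        by (induction ws) (simp_all only: horner_simps list.map scale_right_distrib scale_zero_right D_k[symmetric])
      moreover have "set (map (scale [:c:]) ws) \<subseteq> k.span Y" using ws(2) k.span_scale by auto
      ultimately show ?thesis using ws(1) by blast
    qed
  qed
  moreover have "D x \<in> ?S" if x: "x \<in> ?S" for x
  proof -
    obtain ws where ws: "x = horner ws" "set ws \<subseteq> k.span Y" using x by blast
    then have "D x = horner (0 # ws)" "set (0 # ws) \<subseteq> k.span Y" by (auto simp: k.span_zero)
    then show ?thesis by blast
  qed
  ultimately have "subspace ?S" by (rule subspaceI_k)
  moreover have "Y \<subseteq> ?S"
  proof
    fix y assume "y \<in> Y"
    then have "y = horner [y]" "set [y] \<subseteq> k.span Y" by (auto intro: k.span_base)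
    then show "y \<in> ?S" by blast
  qed
  ultimately have "span Y \<subseteq> ?S" by (rule span_minimal[rotated])
  then show thesis using assms that by blast
qed

end

sublocale conformal_algebra \<subseteq> poly_module scale ..

context conformal_algebra
begin

lemma br_0 [simp]: "br n 0 x = 0" "br n x 0 = 0"
  using br_scale_left[of n 0 0 x] br_scale_right[of n x 0 0] by simp_all
definition stable :: "'l set \<Rightarrow> bool" where "stable S \<longleftrightarrow> (\<forall>n x. \<forall>v\<in>S. br n x v \<in> S)"

lemma stableD: "stable S \<Longrightarrow> v \<in> S \<Longrightarrow> br n x v \<in> S" by (simp add: stable_def)

text \<open>On the left, \<open>D\<close> only shifts the index and leaves no \<open>D\<close>
  outside. The set is therefore a \<open>k[D]\<close>-submodule although \<open>P\<close> is merely
  a \<open>k\<close>-subspace, and left arguments may be restricted to generators.\<close>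

lemma bracket_left_subspace:
  assumes "k.subspace P"
  shows "subspace {x. \<forall>n. br n x w \<in> P}"
proof (rule subspaceI_k)
  show "k.subspace {x. \<forall>n. br n x w \<in> P}"
    by (rule k.subspaceI)
      (auto simp: br_add_left br_scale_left k.subspace_0[OF assms] k.subspace_add[OF assms] k.subspace_scale[OF assms])
  show "D x \<in> {x. \<forall>n. br n x w \<in> P}" if "x \<in> {x. \<forall>n. br n x w \<in> P}" for x
    using that by (auto simp: br_D_left scale_of_nat k.subspace_neg[OF assms] k.subspace_scale[OF assms])
qed

lemma bracket_left_span:
  assumes "k.subspace P" "\<And>g n. g \<in> G \<Longrightarrow> br n g w \<in> P" "x \<in> span G"
  shows "br n x w \<in> P"
  using span_minimal[OF _ bracket_left_subspace[OF assms(1), of w], of G] assms(2,3) by blast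

end

section \<open>The locally finite part modulo an ideal\<close>

context lie_conformal_algebra
begin

text \<open>The derived set is only a \<open>k\<close>-span. It is closed under \<open>D\<close>
  because \<open>D [u_(m) v] = [u_(m) Dv] - m [u_(m-1) v]\<close>, and stable by the Jacobi
  identity.\<close>

lemma derived_series_ideal:
  assumes "n \<ge> 1"
  shows "subspace (derived_series n) \<and> stable (derived_series n)"
  using assms
proof (induction n rule: dec_induct)
  case base
  then show ?case by (simp add: derived_series_def stable_def)
next
  case (step n)
  let ?S = "derived_series n" and ?B = "{br m x y |m x y. x \<in> derived_series n \<and> y \<in> derived_series n}"
  have S: "subspace ?S" "stable ?S" using step by auto
  have eq: "derived_series (Suc n) = k.span ?B"
    using step(1) by (simp add: derived_series_Suc derived_def)
  have B: "br m x y \<in> k.span ?B" if "x \<in> ?S" "y \<in> ?S" for m x y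
    using that by (intro k.span_base) blast
  have "D z \<in> k.span ?B" if "z \<in> k.span ?B" for z
    using that
  proof (induction rule: k.span_induct_alt)
    case (step c z y)
    then obtain m u v where z: "z = br m u v" "u \<in> ?S" "v \<in> ?S" by blast
    have "D z = br m u (D v) - scale [:of_nat m:] (br (m - 1) u v)"
      using br_D_right[of m u v] by (simp add: z scale_of_nat)
    then have "D z \<in> k.span ?B"
      using z B S by (auto intro!: k.span_diff k.span_scale subspace_scale)
    then show ?case using step(2)
      by (simp only: scale_right_distrib D_k) (intro k.span_add k.span_scale)
  qed (simp add: k.span_zero)
  then have 1: "subspace (k.span ?B)" by (intro subspaceI_k) auto
  have "br p x z \<in> k.span ?B" if "z \<in> k.span ?B" for p x z
    using that
  proof (induction rule: k.span_induct_alt)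
    case (step c z y)
    then obtain m u v where z: "z = br m u v" "u \<in> ?S" "v \<in> ?S" by blast
    have "br p x z = br m u (br p x v) + (\<Sum>s\<le>p. scale (of_nat (p choose s)) (br (m + s) (br (p - s) x u) v))"
      using br_jacobi[of p x m u v] by (simp add: z algebra_simps)
    also have "\<dots> \<in> k.span ?B"
      unfolding scale_of_nat using S(2) z
      by (intro k.span_add k.span_sum k.span_scale B) (auto simp: stable_def)
    finally show ?case using step(2)
      by (simp only: br_add_right br_scale_right) (intro k.span_add k.span_scale)
  qed (simp add: k.span_zero)
  then show ?case unfolding eq stable_def using 1 by blast
qed

lemma derived_series_bracket:
  "n \<ge> 1 \<Longrightarrow> x \<in> derived_series n \<Longrightarrow> y \<in> derived_series n \<Longrightarrow> br m x y \<in> derived_series (Suc n)"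
  by (auto simp: derived_series_Suc derived_def intro: k.span_base)

definition loc_fin :: "'l set \<Rightarrow> 'l set \<Rightarrow> bool" where
  "loc_fin U X \<longleftrightarrow> finite X \<and> (\<forall>x n. \<forall>w\<in>X. br n x w \<in> k.span (X \<union> U))"

text \<open>For an ideal \<open>U\<close>, this is the preimage of the sum of all finite-dimensional
  subspaces of \<open>L / U\<close> that are stable under every operator
  \<open>br n x\<close>.\<close>

definition loc_fin_part :: "'l set \<Rightarrow> 'l set" where
  "loc_fin_part U = {v. \<exists>X. loc_fin U X \<and> v \<in> k.span (X \<union> U)}"

lemma loc_fin_Union:
  assumes "finite I" "\<And>i. i \<in> I \<Longrightarrow> loc_fin U (X i)"
  shows "loc_fin U (\<Union>i\<in>I. X i)"
  unfolding loc_fin_def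
proof (intro conjI allI ballI)
  show "finite (\<Union>i\<in>I. X i)" using assms by (auto simp: loc_fin_def)
  fix x n w assume "w \<in> (\<Union>i\<in>I. X i)"
  then obtain i where i: "i \<in> I" "w \<in> X i" by blast
  then have "br n x w \<in> k.span (X i \<union> U)" using assms(2) by (auto simp: loc_fin_def)
  moreover have "k.span (X i \<union> U) \<subseteq> k.span ((\<Union>i\<in>I. X i) \<union> U)" using i by (intro k.span_mono) auto
  ultimately show "br n x w \<in> k.span ((\<Union>i\<in>I. X i) \<union> U)" by blast
qed

lemma loc_fin_Un: "loc_fin U X \<Longrightarrow> loc_fin U Y \<Longrightarrow> loc_fin U (X \<union> Y)"
  using loc_fin_Union[of "{True, False}" U "\<lambda>i. if i then X else Y"] by (simp add: Un_commute)

context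
  fixes U assumes U: "subspace U" and sU: "stable U"
begin

lemma loc_fin_span:
  assumes "loc_fin U X" "v \<in> k.span (X \<union> U)"
  shows "br n x v \<in> k.span (X \<union> U)"
  using assms(2)
proof (induction rule: k.span_induct_alt)
  case (step c w y)
  have "br n x w \<in> k.span (X \<union> U)"
    using step(1) assms(1) stableD[OF sU] by (auto simp: loc_fin_def intro: k.span_base)
  then show ?case using step(2) by (simp only: br_add_right br_scale_right) (intro k.span_add k.span_scale)
qed (simp add: k.span_zero)

lemma U_loc_fin_part: "U \<subseteq> loc_fin_part U"
  by (auto simp: loc_fin_part_def loc_fin_def intro!: exI[of _ "{}"] k.span_base)

lemma stable_loc_fin_part: "stable (loc_fin_part U)"
  using loc_fin_span by (auto simp: stable_def loc_fin_part_def)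

lemma subspace_loc_fin_part: "subspace (loc_fin_part U)"
proof (rule subspaceI_k)
  show "k.subspace (loc_fin_part U)"
  proof (rule k.subspaceI)
    show "0 \<in> loc_fin_part U" using U_loc_fin_part subspace_0[OF U] by blast
    show "x + y \<in> loc_fin_part U" if xy: "x \<in> loc_fin_part U" "y \<in> loc_fin_part U" for x y
    proof -
      obtain X Y where XY: "loc_fin U X" "x \<in> k.span (X \<union> U)" "loc_fin U Y" "y \<in> k.span (Y \<union> U)"
        using xy by (auto simp: loc_fin_part_def)
      have "k.span (X \<union> U) \<subseteq> k.span ((X \<union> Y) \<union> U)" "k.span (Y \<union> U) \<subseteq> k.span ((X \<union> Y) \<union> U)"
        by (auto intro!: k.span_mono)
      then have "x + y \<in> k.span ((X \<union> Y) \<union> U)" using XY by (intro k.span_add) auto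
      then show ?thesis using loc_fin_Un[OF XY(1,3)] by (auto simp: loc_fin_part_def)
    qed
    show "scale [:c:] x \<in> loc_fin_part U" if "x \<in> loc_fin_part U" for c x
      using that k.span_scale by (auto simp: loc_fin_part_def)
  qed
  show "D x \<in> loc_fin_part U" if x: "x \<in> loc_fin_part U" for x
  proof -
    obtain X where X: "loc_fin U X" "x \<in> k.span (X \<union> U)" using x by (auto simp: loc_fin_part_def)
    let ?Y = "X \<union> D ` X"
    have mono: "k.span (X \<union> U) \<subseteq> k.span (?Y \<union> U)" by (intro k.span_mono) auto
    have D_span: "D v \<in> k.span (?Y \<union> U)" if "v \<in> k.span (X \<union> U)" for v
      using that
    proof (induction rule: k.span_induct_alt)
      case (step c w y)
      have "D w \<in> k.span (?Y \<union> U)" using step(1) subspace_scale[OF U] by (auto intro: k.span_base)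
      then show ?case using step(2) by (simp only: scale_right_distrib D_k) (intro k.span_add k.span_scale)
    qed (simp add: k.span_zero)
    have "br n y w \<in> k.span (?Y \<union> U)" if "w \<in> ?Y" for n y w
      using that
    proof
      assume "w \<in> X"
      then show ?thesis using X(1) mono by (auto simp: loc_fin_def)
    next
      assume "w \<in> D ` X"
      then obtain w' where w': "w = D w'" "w' \<in> X" by blast
      have "br m y w' \<in> k.span (X \<union> U)" for m using X(1) w'(2) by (auto simp: loc_fin_def)
      then show ?thesis unfolding w'(1) br_D_right scale_of_nat
        using mono D_span by (intro k.span_add k.span_scale) auto
    qed
    then have "loc_fin U ?Y" using X(1) by (auto simp: loc_fin_def)
    then show ?thesis using D_span[OF X(2)] by (auto simp: loc_fin_part_def)
  qed
qed

text \<open>Forming the locally finite part twice gives nothing new. By locality, the products of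
  generators \<open>g\<close> of \<open>L\<close> with elements of the finite set \<open>X\<close>
  are finitely many, so only finitely many elements of the first locally finite part are needed to
  express them.\<close>

lemma loc_fin_part_trans:
  assumes G: "finite G" "span G = UNIV" and X: "loc_fin (loc_fin_part U) X"
    and v: "v \<in> k.span (X \<union> loc_fin_part U)"
  shows "v \<in> loc_fin_part U"
proof -
  let ?T = "loc_fin_part U"
  have kT: "k.span ?T = ?T" using subspace_k[OF subspace_loc_fin_part] by simp
  have dec: "\<exists>Y. loc_fin U Y \<and> z \<in> k.span ((X \<union> Y) \<union> U)" if zT: "z \<in> k.span (X \<union> ?T)" for z
  proof -
    obtain x t where z: "z = x + t" "x \<in> k.span X" "t \<in> ?T"
      using zT unfolding k.span_Un kT by blast
    then obtain Y where Y: "loc_fin U Y" "t \<in> k.span (Y \<union> U)" by (auto simp: loc_fin_part_def)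
    have "k.span X \<subseteq> k.span ((X \<union> Y) \<union> U)" "k.span (Y \<union> U) \<subseteq> k.span ((X \<union> Y) \<union> U)"
      by (auto intro!: k.span_mono)
    then have "z \<in> k.span ((X \<union> Y) \<union> U)" unfolding z(1) using z Y by (intro k.span_add) auto
    then show ?thesis using Y by blast
  qed
  define Z where "Z = insert v (insert 0 (\<Union>(g, w)\<in>G \<times> X. (\<lambda>n. br n g w) ` {n. br n g w \<noteq> 0}))"
  have finX: "finite X" using X by (simp add: loc_fin_def)
  have finZ: "finite Z" unfolding Z_def using G(1) finX br_locality by auto
  have Z_br: "br n g w \<in> Z" if "g \<in> G" "w \<in> X" for n g w using that unfolding Z_def by auto
  have "Z \<subseteq> k.span (X \<union> ?T)"
    using v X by (auto simp: Z_def loc_fin_def k.span_zero)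
  then have "\<forall>z\<in>Z. \<exists>Y. loc_fin U Y \<and> z \<in> k.span ((X \<union> Y) \<union> U)" using dec by blast
  then obtain Y where Y: "\<And>z. z \<in> Z \<Longrightarrow> loc_fin U (Y z) \<and> z \<in> k.span ((X \<union> Y z) \<union> U)" by metis
  let ?Y = "\<Union>z\<in>Z. Y z"
  have lY: "loc_fin U ?Y" using loc_fin_Union finZ Y by blast
  have Z_span: "z \<in> k.span ((X \<union> ?Y) \<union> U)" if "z \<in> Z" for z
    using Y[OF that] k.span_mono[of "(X \<union> Y z) \<union> U" "(X \<union> ?Y) \<union> U"] that by blast
  have "br n x w \<in> k.span ((X \<union> ?Y) \<union> U)" if "w \<in> X \<union> ?Y" for n x w
    using that
  proof
    assume w: "w \<in> X"
    show ?thesis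
      by (rule bracket_left_span[where G = G]) (use Z_span Z_br w G(2) in auto)
  next
    assume "w \<in> ?Y"
    then show ?thesis using lY k.span_mono[of "?Y \<union> U" "(X \<union> ?Y) \<union> U"] unfolding loc_fin_def by blast
  qed
  then have "loc_fin U (X \<union> ?Y)" using finX lY by (auto simp: loc_fin_def)
  moreover have "v \<in> Z" by (simp add: Z_def)
  ultimately show ?thesis using Z_span unfolding loc_fin_part_def by blast
qed

end

end

text \<open>
  Vectors killed modulo \<open>T\<close> by the products of index at least \<open>N\<close> with \<open>V\<close>. If index \<open>N - 1\<close> gives
  nothing new then they are linearly independent over \<open>k[D]\<close> modulo \<open>T\<close>, so there are finitely many.
\<close>

locale truncated_invariants = lie_conformal_algebra scale br
  for scale :: "'k::field_char_0 poly \<Rightarrow> 'l::ab_group_add \<Rightarrow> 'l"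
    and br :: "nat \<Rightarrow> 'l \<Rightarrow> 'l \<Rightarrow> 'l" +
  fixes V U T :: "'l set" and N :: nat
  assumes T: "subspace T" "stable T"
    and minimal: "v \<in> U \<Longrightarrow> (\<And>u m. u \<in> V \<Longrightarrow> m \<ge> N \<Longrightarrow> br m u v \<in> T) \<Longrightarrow> v \<in> T"
begin

definition M :: "'l set" where
  "M = {v \<in> U. \<forall>u\<in>V. \<forall>m\<ge>Suc N. br m u v \<in> T}"

lemma D_T: "x \<in> T \<Longrightarrow> D x \<in> T" by (rule subspace_scale[OF T(1)])

lemma br_D: "br n u (D x) = D (br n u x) + scale (of_nat n) (br (n - 1) u x)"
  by (rule br_D_right)

lemma br_pow_T: "u \<in> V \<Longrightarrow> w \<in> M \<Longrightarrow> n \<ge> Suc (N + k) \<Longrightarrow> br n u ((D ^^ k) w) \<in> T"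
proof (induction k arbitrary: n)
  case 0
  then show ?case by (simp add: M_def)
next
  case (Suc k)
  then show ?case by (auto simp: br_D intro!: subspace_add[OF T(1)] subspace_scale[OF T(1)])
qed

lemma br_horner_T: "u \<in> V \<Longrightarrow> set ws \<subseteq> M \<Longrightarrow> n \<ge> N + length ws \<Longrightarrow> br n u (horner ws) \<in> T"
proof (induction ws arbitrary: n)
  case Nil
  then show ?case by (simp add: subspace_0[OF T(1)])
next
  case (Cons w ws)
  then have "br n u w \<in> T" by (simp add: M_def)
  then show ?case using Cons
    by (auto simp: br_D br_add_right intro!: subspace_add[OF T(1)] subspace_scale[OF T(1)])
qed

text \<open>Each \<open>D\<close> on the right either comes out or lowers the index by one with the
  index as factor. At index \<open>N + k\<close>, modulo \<open>T\<close>, only the term lowered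
  \<open>k\<close> times survives, with factor \<open>(N + 1) ... (N + k)\<close>, nonzero in
  characteristic 0.\<close>

lemma br_pow_top:
  assumes "u \<in> V" "w \<in> M"
  shows "\<exists>c. c \<noteq> (0::'k) \<and> br (N + k) u ((D ^^ k) w) - scale [:c:] (br N u w) \<in> T"
proof (induction k)
  case 0
  show ?case by (rule exI[of _ 1]) (simp add: subspace_0[OF T(1)])
next
  case (Suc k)
  then obtain c where c: "c \<noteq> 0" "br (N + k) u ((D ^^ k) w) - scale [:c:] (br N u w) \<in> T" by blast
  let ?n = "of_nat (Suc (N + k)) :: 'k"
  have 1: "br (Suc (N + k)) u ((D ^^ k) w) \<in> T" using assms by (intro br_pow_T) auto
  have "br (N + Suc k) u ((D ^^ Suc k) w) - scale [:?n * c:] (br N u w) =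
      D (br (Suc (N + k)) u ((D ^^ k) w)) + scale [:?n:] (br (N + k) u ((D ^^ k) w) - scale [:c:] (br N u w))"
    by (simp add: br_D scale_of_nat k.scale_right_diff_distrib del: of_nat_Suc)
  also have "\<dots> \<in> T" by (intro subspace_add[OF T(1)] D_T 1 subspace_scale[OF T(1)] c(2))
  finally show ?case using c(1) by (intro exI[of _ "?n * c"]) (simp del: of_nat_Suc)
qed

text \<open>The product of index \<open>N + k\<close> applied to the sum of \<open>D^i w_i\<close>
  for \<open>i \<le> k\<close> sees, modulo \<open>T\<close>, only the top coefficient. So
  \<open>br N u w_k\<close> lies in \<open>T\<close>, and \<open>minimal\<close> puts
  \<open>w_k\<close> itself into \<open>T\<close>.\<close>

lemma horner_independent: "set ws \<subseteq> M \<Longrightarrow> horner ws \<in> T \<Longrightarrow> set ws \<subseteq> T"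
proof (induction ws rule: rev_induct)
  case (snoc w ws)
  let ?k = "length ws"
  have w: "w \<in> M" and ws: "set ws \<subseteq> M" using snoc.prems(1) by auto
  have h: "horner ws + (D ^^ ?k) w \<in> T" using snoc.prems(2) by (simp add: horner_append)
  have "br N u w \<in> T" if u: "u \<in> V" for u
  proof -
    obtain c where c: "c \<noteq> 0" "br (N + ?k) u ((D ^^ ?k) w) - scale [:c:] (br N u w) \<in> T"
      using br_pow_top[OF u w] by blast
    have a: "br (N + ?k) u (horner ws + (D ^^ ?k) w) \<in> T" using h stableD[OF T(2)] by blast
    have b: "br (N + ?k) u (horner ws) \<in> T" using u ws by (intro br_horner_T) auto
    have "br (N + ?k) u ((D ^^ ?k) w) \<in> T" using subspace_diff[OF T(1) a b] by (simp add: br_add_right)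
    from subspace_diff[OF T(1) this c(2)] have "scale [:c:] (br N u w) \<in> T" by simp
    then have "scale [:inverse c:] (scale [:c:] (br N u w)) \<in> T" by (rule subspace_scale[OF T(1)])
    then show ?thesis using c(1) by (simp only: k.scale_scale) simp
  qed
  moreover have "br m u w \<in> T" if "u \<in> V" "m \<ge> Suc N" for u m using w that by (simp add: M_def)
  ultimately have "br m u w \<in> T" if "u \<in> V" "m \<ge> N" for u m
    using that by (cases "m = N") auto
  moreover have "w \<in> U" using w by (simp add: M_def)
  ultimately have wT: "w \<in> T" using minimal by blast
  have "(D ^^ k) w \<in> T" for k by (induction k) (simp_all add: wT D_T)
  from subspace_diff[OF T(1) h this[of ?k]] have "horner ws \<in> T" by simp
  then show ?case using snoc.IH ws wT by auto
qed simp

text \<open>Write \<open>v\<close> as the sum of \<open>D^i w_i\<close> with all \<open>w_i\<close>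
  in the span of finitely many generators \<open>Y \<subseteq> M\<close>. Independence, applied to
  \<open>w_0 - v, w_1, w_2, ...\<close>, whose sum with powers of \<open>D\<close> is 0, gives that
  \<open>v\<close> and \<open>w_0\<close> agree modulo \<open>T\<close>.\<close>

lemma finite_modulo:
  assumes G: "finite G" "span G = UNIV" and "k.subspace U"
  obtains Y where "finite Y" "Y \<subseteq> M" "M \<subseteq> k.span (Y \<union> T)"
proof -
  have kM: "k.subspace M"
    by (rule k.subspaceI)
      (auto simp: M_def br_add_right br_scale_right k.subspace_0[OF assms(3)] k.subspace_add[OF assms(3)]
        k.subspace_scale[OF assms(3)] subspace_0[OF T(1)] subspace_add[OF T(1)] subspace_scale[OF T(1)])
  obtain Y where Y: "finite Y" "Y \<subseteq> M" "M \<subseteq> span Y"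
    using finite_generating_subset[OF G, of M] by blast
  have YM: "k.span Y \<subseteq> M" using Y(2) kM by (rule k.span_minimal)
  have "v \<in> k.span (Y \<union> T)" if v: "v \<in> M" for v
  proof -
    obtain ws where ws: "v = horner ws" "set ws \<subseteq> k.span Y"
      using span_horner[of v Y] v Y(3) by blast
    show ?thesis
    proof (cases ws)
      case Nil
      then show ?thesis using ws by (simp add: k.span_zero)
    next
      case (Cons w vs)
      have "horner ((w - v) # vs) = 0" using ws(1) Cons by simp
      moreover have "set ((w - v) # vs) \<subseteq> M"
        using ws(2) YM v k.subspace_diff[OF kM] Cons by auto
      ultimately have "w - v \<in> T" using horner_independent[of "(w - v) # vs"] subspace_0[OF T(1)] by simp
      moreover have "w \<in> k.span Y" using ws(2) Cons by simp
      ultimately have "w \<in> k.span (Y \<union> T)" "w - v \<in> k.span (Y \<union> T)"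
        using k.span_mono[of Y "Y \<union> T"] by (auto intro: k.span_base)
      then have "w - (w - v) \<in> k.span (Y \<union> T)" by (rule k.span_diff)
      then show ?thesis by simp
    qed
  qed
  then show thesis using that Y by blast
qed

end

context lie_conformal_algebra
begin

lemma loc_fin_part_mono: "U \<subseteq> U' \<Longrightarrow> loc_fin_part U \<subseteq> loc_fin_part U'"
  unfolding loc_fin_part_def loc_fin_def
  using k.span_mono[of "_ \<union> U" "_ \<union> U'"] by (smt (verit) Collect_mono Un_mono order_refl subsetD)

text \<open>Let \<open>T\<close> be the locally finite part modulo \<open>U0\<close>, and filter
  \<open>U\<close> by the vectors \<open>M N\<close> that products of index at least
  \<open>N\<close> with a finite set \<open>V\<close> send into \<open>T\<close>. If
  \<open>U\<close> is not inside \<open>T\<close>, take the least \<open>N\<close> with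
  \<open>M N\<close> outside \<open>T\<close>. For \<open>N = 0\<close> the induction hypothesis
  applies to \<open>M 0\<close>; for \<open>N > 0\<close>, \<open>M N\<close> is finite-dimensional
  modulo \<open>T\<close>. Either way \<open>M N\<close> is locally finite modulo \<open>T\<close>,
  hence inside it.\<close>

lemma derived_acts_loc_fin:
  assumes G: "finite G" "span G = UNIV" and n: "n \<ge> 1"
    and "subspace U0" "stable U0" "subspace U" "stable U" "U0 \<subseteq> U"
    and "\<And>m x u. x \<in> derived_series n \<Longrightarrow> u \<in> U \<Longrightarrow> br m x u \<in> U0"
  shows "U \<subseteq> loc_fin_part U0"
  using n assms(4-)
proof (induction n arbitrary: U0 U rule: dec_induct)
  case base
  have "v \<in> loc_fin_part U0" if "v \<in> U" for v
  proof -
    have "loc_fin U0 {v}"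
      unfolding loc_fin_def using base(6) that derived_series_1 by (auto intro!: k.span_base)
    moreover have "v \<in> k.span ({v} \<union> U0)" by (rule k.span_base) simp
    ultimately show ?thesis unfolding loc_fin_part_def by blast
  qed
  then show ?case by blast
next
  case (step n)
  note U0 = step.prems(1,2) and U = step.prems(3,4) and UU = step.prems(5) and act = step.prems(6)
  let ?L = "derived_series n" and ?L' = "derived_series (Suc n)" and ?T = "loc_fin_part U0"
  have n: "n \<ge> 1" by fact
  note L = derived_series_ideal[OF n]
  have L': "subspace ?L'" "stable ?L'" using derived_series_ideal[of "Suc n"] by auto
  have L'L: "?L' \<subseteq> ?L"
    unfolding derived_series_Suc[OF n] derived_def
    by (rule k.span_minimal) (use L in \<open>auto simp: stable_def intro: subspace_k\<close>)
  \<comment> \<open>The induction hypothesis also applies to \<open>L^(n)\<close> acting on itself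
    modulo \<open>L^(n+1)\<close>; this yields the finite set \<open>V\<close>, stable modulo
    \<open>L^(n+1)\<close>, which generates \<open>L^(n)\<close> over it.\<close>
  have lL: "?L \<subseteq> loc_fin_part ?L'"
    by (rule step.IH) (use L L' L'L derived_series_bracket[OF n] in auto)
  obtain F where F: "finite F" "F \<subseteq> ?L" "?L \<subseteq> span F"
    using noetherian[OF G(1), of ?L] L G(2) by auto
  have "\<forall>g\<in>F. \<exists>X. loc_fin ?L' X \<and> g \<in> k.span (X \<union> ?L')"
    using F(2) lL unfolding loc_fin_part_def by blast
  then obtain X where X: "\<And>g. g \<in> F \<Longrightarrow> loc_fin ?L' (X g) \<and> g \<in> k.span (X g \<union> ?L')" by metis
  define V where "V = (\<Union>g\<in>F. X g)"
  have V: "loc_fin ?L' V" unfolding V_def using F(1) X by (intro loc_fin_Union) auto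
  have finV: "finite V" using V by (simp add: loc_fin_def)
  have "F \<subseteq> span (V \<union> ?L')"
  proof
    fix g assume g: "g \<in> F"
    have "k.span (X g \<union> ?L') \<subseteq> k.span (V \<union> ?L')" using g by (intro k.span_mono) (auto simp: V_def)
    then show "g \<in> span (V \<union> ?L')" using X[OF g] k_span_subset by blast
  qed
  then have L_span: "?L \<subseteq> span (V \<union> ?L')" using F(3) span_minimal[of F] by blast
  note T = subspace_loc_fin_part[OF U0] stable_loc_fin_part[OF U0]
  have U0T: "U0 \<subseteq> ?T" by (rule U_loc_fin_part[OF U0])
  have kT: "k.subspace ?T" using T(1) by (rule subspace_k)
  have L'_T: "br m x u \<in> ?T" if "x \<in> ?L'" "u \<in> U" for m x u using act[OF that] U0T by blast
  show ?case
  proof (rule ccontr)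
    assume "\<not> U \<subseteq> ?T"
    then obtain v0 where v0: "v0 \<in> U" "v0 \<notin> ?T" by blast
    define M where "M N = {v \<in> U. \<forall>u\<in>V. \<forall>m\<ge>N. br m u v \<in> ?T}" for N
    have kM: "k.subspace (M N)" for N
      by (rule k.subspaceI)
        (use U(1) T(1) in \<open>auto simp: M_def br_add_right br_scale_right subspace_0 subspace_add subspace_scale\<close>)
    have M_br: "br p y v \<in> ?T" if "v \<in> M N" "y \<in> k.span (V \<union> ?L')" "p \<ge> N" for v y N p
      using that(2)
    proof (induction rule: k.span_induct_alt)
      case (step c z y)
      have "br p z v \<in> ?T" using step(1) that L'_T by (auto simp: M_def)
      then show ?case using step(2)
        by (simp only: br_add_left br_scale_left) (intro subspace_add[OF T(1)] subspace_scale[OF T(1)])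
    qed (simp add: subspace_0[OF T(1)])
    \<comment> \<open>Here the stability of \<open>V\<close> enters: Jacobi produces the elements
      \<open>br (m - s) x u\<close>, which stay in the span of \<open>V\<close> and
      \<open>L^(n+1)\<close>, at indices \<open>p + s\<close> that remain at least
      \<open>N\<close>.\<close>
    have stM: "stable (M N)" for N
      unfolding stable_def
    proof (intro allI ballI)
      fix m x v assume v: "v \<in> M N"
      have "br p u (br m x v) \<in> ?T" if u: "u \<in> V" "p \<ge> N" for u p
      proof -
        have "br p u (br m x v) = br m x (br p u v) - (\<Sum>s\<le>m. scale (of_nat (m choose s)) (br (p + s) (br (m - s) x u) v))"
          using br_jacobi[of m x p u v] by (simp add: algebra_simps)
        moreover have "br (m - s) x u \<in> k.span (V \<union> ?L')" for s using V u(1) by (simp add: loc_fin_def)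
        then have "br (p + s) (br (m - s) x u) v \<in> ?T" for s using M_br[OF v] u(2) by simp
        then have "(\<Sum>s\<le>m. scale (of_nat (m choose s)) (br (p + s) (br (m - s) x u) v)) \<in> ?T"
          by (intro subspace_sum[OF T(1)] subspace_scale[OF T(1)])
        moreover have "br m x (br p u v) \<in> ?T" by (rule stableD[OF T(2)]) (use v u in \<open>auto simp: M_def\<close>)
        ultimately show ?thesis using subspace_diff[OF T(1)] by simp
      qed
      then show "br m x v \<in> M N" using v stableD[OF U(2)] by (simp add: M_def)
    qed
    have "\<exists>N. v0 \<in> M N"
    proof -
      have "finite (\<Union>u\<in>V. {m. br m u v0 \<noteq> 0})" using finV br_locality by auto
      then obtain N where N: "\<forall>m\<in>(\<Union>u\<in>V. {m. br m u v0 \<noteq> 0}). m < N"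
        using finite_nat_set_iff_bounded by blast
      have "br m u v0 = 0" if "u \<in> V" "m \<ge> N" for u m using N that by fastforce
      then have "v0 \<in> M N" using v0(1) subspace_0[OF T(1)] by (simp add: M_def)
      then show ?thesis ..
    qed
    then have ex: "\<exists>N. \<not> M N \<subseteq> ?T" using v0(2) by blast
    define N where "N = (LEAST N. \<not> M N \<subseteq> ?T)"
    have N: "\<not> M N \<subseteq> ?T" using LeastI_ex[OF ex] by (simp add: N_def)
    show False
    proof (cases N)
      case 0
      \<comment> \<open>Multiplication by \<open>D\<close> can lower the index, so
        \<open>M N\<close> need not be closed under it in general; for \<open>N = 0\<close> no index
        bound can be violated.\<close>
      have "subspace (M 0)"
      proof (rule subspaceI_k[OF kM])
        fix v assume v: "v \<in> M 0"
        then have "br m u (D v) \<in> ?T" if "u \<in> V" for m u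
          using that unfolding br_D_right
          by (intro subspace_add[OF T(1)] subspace_scale[OF T(1)]) (auto simp: M_def)
        then show "D v \<in> M 0" using v subspace_scale[OF U(1)] by (simp add: M_def)
      qed
      moreover have "br m x u \<in> ?T \<inter> U" if x: "x \<in> ?L" and u: "u \<in> M 0" for m x u
      proof -
        have "br m x u \<in> ?T"
          by (rule bracket_left_span[OF kT, of "V \<union> ?L'"]) (use x u L_span L'_T in \<open>auto simp: M_def\<close>)
        then show ?thesis using u stableD[OF U(2)] by (simp add: M_def)
      qed
      moreover have "?T \<inter> U \<subseteq> M 0" using stableD[OF T(2)] by (auto simp: M_def)
      moreover have "subspace (?T \<inter> U)" "stable (?T \<inter> U)"
        using T U by (auto simp: stable_def intro: subspace_inter)
      ultimately have "M 0 \<subseteq> loc_fin_part (?T \<inter> U)" using stM by (intro step.IH) auto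
      then have "M 0 \<subseteq> loc_fin_part ?T" using loc_fin_part_mono[of "?T \<inter> U" ?T] by blast
      then have "M 0 \<subseteq> ?T" unfolding loc_fin_part_def[of ?T] using loc_fin_part_trans[OF U0 G] by blast
      then show False using N 0 by simp
    next
      case (Suc N')
      have "M N' \<subseteq> ?T" using not_less_Least[of N' "\<lambda>N. \<not> M N \<subseteq> ?T"] Suc by (simp add: N_def)
      then interpret ti: truncated_invariants scale br V U ?T N'
        using T by unfold_locales (auto simp: M_def)
      have M_eq: "ti.M = M N" by (simp add: ti.M_def M_def Suc)
      obtain Y where Y: "finite Y" "Y \<subseteq> M N" "M N \<subseteq> k.span (Y \<union> ?T)"
        using ti.finite_modulo[OF G subspace_k[OF U(1)]] unfolding M_eq by blast
      have "loc_fin ?T Y"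
        unfolding loc_fin_def using Y stableD[OF stM] by blast
      then have "M N \<subseteq> ?T" using loc_fin_part_trans[OF U0 G] Y(3) by blast
      then show False using N by simp
    qed
  qed
qed

theorem solvable_invariant_generators:
  assumes "finitely_generated UNIV" "solvable"
  shows "\<exists>X. finite X \<and> span X = UNIV \<and> (\<forall>n x. \<forall>v\<in>k.span X. br n x v \<in> k.span X)"
proof -
  obtain G where G: "finite G" "span G = UNIV" using assms(1) by (auto simp: finitely_generated_def)
  obtain n where n: "n > 1" "derived_series n = {0}" using assms(2) by (auto simp: solvable_def)
  have "UNIV \<subseteq> loc_fin_part {0}"
    by (rule derived_acts_loc_fin[OF G, of n]) (use n in \<open>auto simp: stable_def\<close>)
  then have "\<forall>g\<in>G. \<exists>X. loc_fin {0} X \<and> g \<in> k.span (X \<union> {0})" unfolding loc_fin_part_def by blast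
  then obtain X where X: "\<And>g. g \<in> G \<Longrightarrow> loc_fin {0} (X g) \<and> g \<in> k.span (X g \<union> {0})" by metis
  define Y where "Y = (\<Union>g\<in>G. X g)"
  have Y: "loc_fin {0} Y" unfolding Y_def using G(1) X by (intro loc_fin_Union) auto
  have Y0: "k.span (Y \<union> {0}) = k.span Y" by simp
  have "G \<subseteq> span Y"
  proof
    fix g assume g: "g \<in> G"
    have "k.span (X g \<union> {0}) \<subseteq> k.span (Y \<union> {0})" using g by (intro k.span_mono) (auto simp: Y_def)
    then show "g \<in> span Y" using X[OF g] k_span_subset[of Y] Y0 by blast
  qed
  then have "span Y = UNIV" using G(2) span_minimal[of G "span Y"] by auto
  moreover have "br n x v \<in> k.span Y" if "v \<in> k.span Y" for n x v
    using loc_fin_span[OF _ _ Y, of v] that by (simp add: stable_def)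
  moreover have "finite Y" using Y by (simp add: loc_fin_def)
  ultimately show ?thesis by blast
qed

end

section \<open>The annihilation algebra\<close>

context char0_space
begin

text \<open>With the shift operator \<open>E\<close>, this is \<open>(1 + E)^n F\<close> at 0. Thus
  \<open>binsum_Suc\<close> is Pascal's rule and \<open>binsum_binsum\<close> is Vandermonde's
  identity.\<close>

definition binsum :: "nat \<Rightarrow> (nat \<Rightarrow> 'b) \<Rightarrow> 'b" where
  "binsum n F = (\<Sum>j\<le>n. of_nat (n choose j) *s F j)"

lemma binsum_0 [simp]: "binsum 0 F = F 0" by (simp add: binsum_def)

lemma binsum_cong: "(\<And>j. j \<le> n \<Longrightarrow> F j = G j) \<Longrightarrow> binsum n F = binsum n G"
  by (simp add: binsum_def)

lemma binsum_add: "binsum n (\<lambda>j. F j + G j) = binsum n F + binsum n G"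
  by (simp add: binsum_def scale_right_distrib sum.distrib)

lemma binsum_diff: "binsum n (\<lambda>j. F j - G j) = binsum n F - binsum n G"
  by (simp add: binsum_def scale_right_diff_distrib sum_subtractf)

lemma binsum_minus: "binsum n (\<lambda>j. - F j) = - binsum n F"
  by (simp add: binsum_def sum_negf)

lemma binsum_scale: "binsum n (\<lambda>j. c *s F j) = c *s binsum n F"
  by (simp add: binsum_def scale_sum_right mult.commute)

lemma binsum_in: "subspace S \<Longrightarrow> (\<And>j. j \<le> n \<Longrightarrow> F j \<in> S) \<Longrightarrow> binsum n F \<in> S"
  unfolding binsum_def by (intro subspace_sum subspace_scale) auto

lemma binsum_swap: "binsum m (\<lambda>i. binsum n (\<lambda>j. F i j)) = binsum n (\<lambda>j. binsum m (\<lambda>i. F i j))"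
  unfolding binsum_def scale_sum_right by (subst sum.swap) (simp add: mult.commute)

lemma binsum_Suc: "binsum (Suc n) F = binsum n F + binsum n (\<lambda>j. F (Suc j))"
proof -
  have "binsum (Suc n) F = F 0 + (\<Sum>j\<le>n. of_nat (Suc n choose Suc j) *s F (Suc j))"
    unfolding binsum_def by (subst sum.atMost_Suc_shift) simp
  also have "\<dots> = (F 0 + (\<Sum>j\<le>n. of_nat (n choose Suc j) *s F (Suc j))) + binsum n (\<lambda>j. F (Suc j))"
    by (simp add: binsum_def scale_left_distrib sum.distrib algebra_simps)
  also have "F 0 + (\<Sum>j\<le>n. of_nat (n choose Suc j) *s F (Suc j)) = (\<Sum>j\<le>Suc n. of_nat (n choose j) *s F j)"
    by (subst sum.atMost_Suc_shift) simp
  also have "\<dots> = binsum n F" by (simp add: binsum_def)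
  finally show ?thesis .
qed

lemma binsum_binsum: "binsum m (\<lambda>i. binsum n (\<lambda>j. F (i + j))) = binsum (m + n) F"
proof (induction m arbitrary: F)
  case (Suc m)
  show ?case using Suc[of F] Suc[of "\<lambda>j. F (Suc j)"] by (simp add: binsum_Suc)
qed simp

text \<open>Both sides weight \<open>F i j\<close> by the trinomial coefficient
  \<open>n! / (i! j! (n - i - j)!)\<close>.\<close>

lemma binsum_triangle:
  "binsum n (\<lambda>s. binsum s (\<lambda>j. F (s - j) j)) = binsum n (\<lambda>i. binsum (n - i) (\<lambda>j. F i j))"
proof -
  have "binsum n (\<lambda>i. binsum (n - i) (\<lambda>j. F i j)) =
      (\<Sum>i\<le>n. \<Sum>j\<le>n - i. of_nat ((n choose i) * ((n - i) choose j)) *s F i j)"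
    by (simp add: binsum_def scale_sum_right)
  also have "\<dots> = (\<Sum>s\<le>n. \<Sum>i\<le>s. of_nat ((n choose i) * ((n - i) choose (s - i))) *s F i (s - i))"
    by (rule sum_triangle)
  also have "\<dots> = (\<Sum>s\<le>n. \<Sum>i\<le>s. of_nat ((n choose s) * (s choose i)) *s F i (s - i))"
    by (intro sum.cong refl) (simp add: choose_mult)
  also have "\<dots> = (\<Sum>s\<le>n. \<Sum>j\<le>s. of_nat ((n choose s) * (s choose j)) *s F (s - j) j)"
  proof (rule sum.cong[OF refl])
    fix s
    show "(\<Sum>i\<le>s. of_nat ((n choose s) * (s choose i)) *s F i (s - i)) =
        (\<Sum>j\<le>s. of_nat ((n choose s) * (s choose j)) *s F (s - j) j)"
      by (rule sum.reindex_bij_witness[of _ "\<lambda>i. s - i" "\<lambda>i. s - i"]) (auto simp flip: binomial_symmetric)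
  qed
  also have "\<dots> = binsum n (\<lambda>s. binsum s (\<lambda>j. F (s - j) j))"
    by (simp add: binsum_def scale_sum_right)
  finally show ?thesis ..
qed

text \<open>In terms of the shift \<open>E\<close>, this is
  \<open>((1 + E) - E)^m (1 + E)^n = (1 + E)^n\<close>, with the first power expanded.\<close>

lemma binsum_alternating:
  "binsum m (\<lambda>s. (- 1) ^ s *s binsum (m + n - s) (\<lambda>j. F (s + j))) = binsum n F"
proof (induction m arbitrary: F)
  case (Suc m)
  have "binsum (Suc m) (\<lambda>s. (- 1) ^ s *s binsum (Suc m + n - s) (\<lambda>j. F (s + j))) =
      binsum m (\<lambda>s. (- 1) ^ s *s binsum (Suc m + n - s) (\<lambda>j. F (s + j))) +
      binsum m (\<lambda>s. (- 1) ^ Suc s *s binsum (m + n - s) (\<lambda>j. F (Suc s + j)))"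
    by (simp add: binsum_Suc)
  also have "\<dots> = binsum m (\<lambda>s. (- 1) ^ s *s binsum (m + n - s) (\<lambda>j. F (s + j)))"
    unfolding binsum_add[symmetric]
    by (rule binsum_cong) (simp add: Suc_diff_le binsum_Suc scale_right_distrib)
  finally show ?case using Suc by simp
qed simp

end

context poly_module
begin

definition lsc :: "'k \<Rightarrow> 'l poly \<Rightarrow> 'l poly" where "lsc c p = map_poly (scale [:c:]) p"

lemma coeff_lsc [simp]: "coeff (lsc c p) n = scale [:c:] (coeff p n)"
  by (simp add: lsc_def coeff_map_poly)

sublocale lam: char0_space lsc
  by unfold_locales (auto simp: poly_eq_iff k.scale_right_distrib k.scale_left_distrib simp del: k.scale_scale
    intro: k.scale_scale)

lemma lsc_monom: "lsc c (monom a n) = monom (scale [:c:] a) n"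
  by (auto simp: poly_eq_iff)

lemma poly_monom_induct [case_names 0 add monom]:
  assumes "P 0" "\<And>p q. P p \<Longrightarrow> P q \<Longrightarrow> P (p + q)" "\<And>a n. P (monom (a::'l) n)"
  shows "P p"
proof -
  have "P (\<Sum>i\<in>A. monom (coeff p i) i)" if "finite A" for A
    using that by (induction A rule: finite_induct) (auto simp: assms)
  from this[of "{..degree p}"] show ?thesis by (simp add: poly_as_sum_of_monoms)
qed

definition ext :: "(nat \<Rightarrow> 'l \<Rightarrow> 'x::ab_group_add) \<Rightarrow> 'l poly \<Rightarrow> 'x" where
  "ext f p = (\<Sum>m\<le>degree p. f m (coeff p m))"

context
  fixes f :: "nat \<Rightarrow> 'l \<Rightarrow> 'x::ab_group_add"
  assumes f_add: "\<And>m x y. f m (x + y) = f m x + f m y"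
begin

lemma f_0: "f m 0 = 0" using f_add[of m 0 0] by simp

lemma ext_upto: "degree p \<le> n \<Longrightarrow> ext f p = (\<Sum>m\<le>n. f m (coeff p m))"
  unfolding ext_def by (rule sum.mono_neutral_left) (auto simp: coeff_eq_0 f_0)

lemma ext_add: "ext f (p + q) = ext f p + ext f q"
proof -
  define n where "n = max (degree p) (degree q)"
  have "degree p \<le> n" "degree q \<le> n" "degree (p + q) \<le> n" by (auto simp: n_def degree_add_le)
  then show ?thesis by (simp add: ext_upto f_add sum.distrib)
qed

lemma ext_monom: "ext f (monom a n) = f n a"
proof -
  have "ext f (monom a n) = (\<Sum>m\<le>n. f m (if n = m then a else 0))"
    by (subst ext_upto[OF degree_monom_le]) simp
  also have "\<dots> = (\<Sum>m\<in>{n}. f m (if n = m then a else 0))"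
    by (rule sum.mono_neutral_right) (auto simp: f_0)
  finally show ?thesis by simp
qed

lemma ext_0: "ext f 0 = 0" using ext_add[of 0 0] by simp

end

lemma monom_add: "monom (a + b) n = monom a n + monom (b::'l) n" by (auto simp: poly_eq_iff)
lemma monom_neg: "monom (- a) n = - monom (a::'l) n" by (auto simp: poly_eq_iff)
lemma monom_diff: "monom (a - b) n = monom a n - monom (b::'l) n" by (auto simp: poly_eq_iff)
lemma monom_sum: "monom (sum f A) n = (\<Sum>a\<in>A. monom (f a :: 'l) n)"
  by (induction A rule: infinite_finite_induct) (auto simp: monom_add)

lemma subspace_monom:
  assumes "lam.subspace S"
  shows "k.subspace {a. \<forall>n. monom a n \<in> S}"
  by (rule k.subspaceI)
    (auto simp: monom_add lam.subspace_0[OF assms] lam.subspace_add[OF assms] lam.subspace_scale[OF assms]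
      simp flip: lsc_monom)

end

context conformal_algebra
begin

text \<open>The bracket of the annihilation algebra on \<open>L[t]\<close>; \<open>monom a n\<close> stands for \<open>a t\<^sup>n\<close>.\<close>

definition lbr0 :: "nat \<Rightarrow> 'l \<Rightarrow> nat \<Rightarrow> 'l \<Rightarrow> 'l poly" where
  "lbr0 m a n c = lam.binsum m (\<lambda>s. monom (br s a c) (m + n - s))"

definition lbr :: "'l poly \<Rightarrow> 'l poly \<Rightarrow> 'l poly" where
  "lbr p q = ext (\<lambda>m a. ext (lbr0 m a) q) p"

lemma lbr0_add: "lbr0 m (a + b) n c = lbr0 m a n c + lbr0 m b n c" "lbr0 m a n (c + d) = lbr0 m a n c + lbr0 m a n d"
  by (simp_all add: lbr0_def br_add_left br_add_right monom_add lam.binsum_add)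

lemma lbr0_scale: "lbr0 m (scale [:r:] a) n c = lsc r (lbr0 m a n c)" "lbr0 m a n (scale [:r:] c) = lsc r (lbr0 m a n c)"
  by (simp_all add: lbr0_def br_scale_left br_scale_right lam.binsum_scale flip: lsc_monom)

lemma ext_lbr0_add: "ext (lbr0 m (a + b)) q = ext (lbr0 m a) q + ext (lbr0 m b) q"
  by (simp add: ext_def lbr0_add sum.distrib)

lemma lbr_add_left: "lbr (p + p') q = lbr p q + lbr p' q"
  unfolding lbr_def by (rule ext_add) (rule ext_lbr0_add)

lemma lbr_add_right: "lbr p (q + q') = lbr p q + lbr p q'"
  unfolding lbr_def by (simp add: ext_def[of _ p] ext_add lbr0_add sum.distrib)

lemma lbr_monom: "lbr (monom a m) (monom c n) = lam.binsum m (\<lambda>s. monom (br s a c) (m + n - s))"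
proof -
  have "lbr (monom a m) (monom c n) = ext (lbr0 m a) (monom c n)"
    unfolding lbr_def by (rule ext_monom) (rule ext_lbr0_add)
  also have "\<dots> = lbr0 m a n c" by (rule ext_monom) (rule lbr0_add)
  finally show ?thesis by (simp add: lbr0_def)
qed

lemma lbr_0 [simp]: "lbr 0 q = 0" "lbr p 0 = 0"
  using lbr_add_left[of 0 0 q] lbr_add_right[of p 0 0] by simp_all

lemma lbr_scale: "lbr (lsc c p) q = lsc c (lbr p q) \<and> lbr p (lsc c q) = lsc c (lbr p q)"
proof (induction p rule: poly_monom_induct)
  case (monom a m)
  show ?case
  proof (induction q rule: poly_monom_induct)
    case (monom d n)
    show ?case
      unfolding lsc_monom lbr_monom
      using lbr0_scale(1)[of m c a n d] lbr0_scale(2)[of m a n c d] by (simp add: lbr0_def)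
  qed (simp_all add: lbr_add_right lam.scale_right_distrib)
qed (simp_all add: lbr_add_left lam.scale_right_distrib)

lemma lbr_sum_right: "lbr p (sum f A) = (\<Sum>a\<in>A. lbr p (f a))"
  by (induction A rule: infinite_finite_induct) (auto simp: lbr_add_right)
lemma lbr_sum_left: "lbr (sum f A) p = (\<Sum>a\<in>A. lbr (f a) p)"
  by (induction A rule: infinite_finite_induct) (auto simp: lbr_add_left)
lemma lbr_binsum_right: "lbr p (lam.binsum n F) = lam.binsum n (\<lambda>j. lbr p (F j))"
  by (simp add: lam.binsum_def lbr_sum_right lbr_scale)
lemma lbr_binsum_left: "lbr (lam.binsum n F) p = lam.binsum n (\<lambda>j. lbr (F j) p)"
  by (simp add: lam.binsum_def lbr_sum_left lbr_scale)

end

context lie_conformal_algebra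
begin

text \<open>The conformal Jacobi identity turns the commutator into a triple sum over
  \<open>s\<close>, \<open>r\<close> and \<open>j\<close>. Regrouping by \<open>i = s - j\<close>
  and merging the sums over \<open>j\<close> and \<open>r\<close> by Vandermonde gives the brackets
  with \<open>br i x y\<close>.\<close>

lemma lbr_leibniz_monom:
  "lbr (monom x a) (lbr (monom y b) (monom z c)) =
    lbr (lbr (monom x a) (monom y b)) (monom z c) + lbr (monom y b) (lbr (monom x a) (monom z c))"
proof -
  define G where "G i p = monom (br p (br i x y) z) (a + b + c - i - p)" for i p
  have 1: "lbr (monom x a) (lbr (monom y b) (monom z c)) =
      lam.binsum a (\<lambda>s. lam.binsum b (\<lambda>r. monom (br s x (br r y z)) (a + b + c - s - r)))"
    unfolding lbr_monom[of y] lbr_binsum_right lbr_monom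
    by (subst lam.binsum_swap) (intro lam.binsum_cong arg_cong[of _ _ "monom _"], simp)
  have 2: "lbr (monom y b) (lbr (monom x a) (monom z c)) =
      lam.binsum a (\<lambda>s. lam.binsum b (\<lambda>r. monom (br r y (br s x z)) (a + b + c - s - r)))"
    unfolding lbr_monom[of x] lbr_binsum_right lbr_monom
    by (intro lam.binsum_cong arg_cong[of _ _ "monom _"]) simp
  have "monom (br s x (br r y z)) (a + b + c - s - r) - monom (br r y (br s x z)) (a + b + c - s - r) =
      lam.binsum s (\<lambda>j. G (s - j) (r + j))" for s r
    unfolding monom_diff[symmetric] br_jacobi monom_sum lam.binsum_def scale_of_nat G_def lsc_monom
    by (intro sum.cong refl arg_cong[of _ _ "monom _"]) auto
  then have "lbr (monom x a) (lbr (monom y b) (monom z c)) - lbr (monom y b) (lbr (monom x a) (monom z c)) =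
      lam.binsum a (\<lambda>s. lam.binsum b (\<lambda>r. lam.binsum s (\<lambda>j. G (s - j) (r + j))))"
    unfolding 1 2 lam.binsum_diff[symmetric] by simp
  also have "\<dots> = lam.binsum a (\<lambda>s. lam.binsum s (\<lambda>j. lam.binsum b (\<lambda>r. G (s - j) (r + j))))"
    by (intro lam.binsum_cong lam.binsum_swap)
  also have "\<dots> = lam.binsum a (\<lambda>i. lam.binsum (a - i) (\<lambda>j. lam.binsum b (\<lambda>r. G i (r + j))))"
    by (rule lam.binsum_triangle)
  also have "\<dots> = lam.binsum a (\<lambda>i. lam.binsum (a - i + b) (G i))"
    by (subst add.commute[of "_ :: nat"]) (simp only: lam.binsum_binsum)
  also have "\<dots> = lam.binsum a (\<lambda>i. lbr (monom (br i x y) (a + b - i)) (monom z c))"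
  proof (rule lam.binsum_cong)
    fix i assume i: "i \<le> a"
    then have e: "a + b - i = a - i + b" by simp
    show "lam.binsum (a - i + b) (G i) = lbr (monom (br i x y) (a + b - i)) (monom z c)"
      unfolding lbr_monom e G_def using i by (intro lam.binsum_cong arg_cong[of _ _ "monom _"]) simp
  qed
  also have "\<dots> = lbr (lbr (monom x a) (monom y b)) (monom z c)"
    by (simp only: lbr_monom[of x] lbr_binsum_left)
  finally show ?thesis by (simp add: algebra_simps)
qed

lemma lbr_leibniz: "lbr p (lbr q r) = lbr (lbr p q) r + lbr q (lbr p r)"
proof (induction p rule: poly_monom_induct)
  case (monom x a)
  show ?case
  proof (induction q rule: poly_monom_induct)
    case (monom y b)
    show ?case
    proof (induction r rule: poly_monom_induct)
      case (monom z c)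
      show ?case by (rule lbr_leibniz_monom)
    qed (simp_all add: lbr_add_right)
  qed (simp_all add: lbr_add_left lbr_add_right)
qed (simp_all add: lbr_add_left lbr_add_right)

end

section \<open>A finite-dimensional quotient of the annihilation algebra\<close>

locale truncated_annihilation = lie_conformal_algebra scale br
  for scale :: "'k::field_char_0 poly \<Rightarrow> 'l::ab_group_add \<Rightarrow> 'l"
    and br :: "nat \<Rightarrow> 'l \<Rightarrow> 'l \<Rightarrow> 'l" +
  fixes X :: "'l set" and N :: nat
  assumes finX: "finite X" and span_X: "span X = UNIV"
    and inv_X: "v \<in> k.span X \<Longrightarrow> br n x v \<in> k.span X"
begin

text \<open>\<open>dgen y n\<close> is \<open>(D + d/dt) y t\<^sup>n\<close>, and \<open>K\<close> is \<open>t\<^sup>N X[t] + (D + d/dt) L[t]\<close>.\<close>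

definition dgen :: "'l \<Rightarrow> nat \<Rightarrow> 'l poly" where
  "dgen y n = monom (D y) n + lsc (of_nat n) (monom y (n - 1))"

definition Kgen :: "'l poly set" where
  "Kgen = {monom v n |v n. v \<in> k.span X \<and> n \<ge> N} \<union> {dgen y n |y n. True}"

definition K :: "'l poly set" where "K = lam.span Kgen"

lemma K: "lam.subspace K" by (simp add: K_def)

lemma K_high: "v \<in> k.span X \<Longrightarrow> n \<ge> N \<Longrightarrow> monom v n \<in> K"
  unfolding K_def Kgen_def by (rule lam.span_base) blast

lemma K_dgen: "dgen y n \<in> K"
  unfolding K_def Kgen_def by (rule lam.span_base) blast

definition cong (infix "\<approx>" 50) where "p \<approx> q \<longleftrightarrow> p - q \<in> K"

lemma cong_refl [simp]: "p \<approx> p" by (simp add: cong_def lam.subspace_0[OF K])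
lemma cong_trans [trans]: "p \<approx> q \<Longrightarrow> q \<approx> r \<Longrightarrow> p \<approx> r"
  unfolding cong_def using lam.subspace_add[OF K, of "p - q" "q - r"] by simp
lemma cong_eq_trans [trans]: "p \<approx> q \<Longrightarrow> q = r \<Longrightarrow> p \<approx> r" by simp
lemma eq_cong_trans [trans]: "p = q \<Longrightarrow> q \<approx> r \<Longrightarrow> p \<approx> r" by simp
lemma cong_lsc: "p \<approx> q \<Longrightarrow> lsc c p \<approx> lsc c q"
  unfolding cong_def using lam.subspace_scale[OF K, of "p - q" c] by (simp add: lam.scale_right_diff_distrib)
lemma cong_add: "p \<approx> q \<Longrightarrow> p' \<approx> q' \<Longrightarrow> p + p' \<approx> q + q'"
  unfolding cong_def using lam.subspace_add[OF K, of "p - q" "p' - q'"] by (simp add: algebra_simps)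
lemma cong_minus: "p \<approx> q \<Longrightarrow> - p \<approx> - q"
  unfolding cong_def using lam.subspace_neg[OF K, of "p - q"] by (simp add: algebra_simps)
lemma cong_sum: "(\<And>a. a \<in> A \<Longrightarrow> f a \<approx> g a) \<Longrightarrow> sum f A \<approx> sum g A"
  by (induction A rule: infinite_finite_induct) (auto intro: cong_add)
lemma cong_binsum: "(\<And>j. j \<le> n \<Longrightarrow> F j \<approx> G j) \<Longrightarrow> lam.binsum n F \<approx> lam.binsum n G"
  unfolding lam.binsum_def by (intro cong_sum cong_lsc) auto

lemma D_cong: "monom (D y) n \<approx> - lsc (of_nat n) (monom y (n - 1))"
  using K_dgen[of y n] by (simp add: cong_def dgen_def)

text \<open>Modulo \<open>K\<close>, \<open>D\<close> acts as \<open>- d/dt\<close>, so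
  \<open>D^j / j!\<close> becomes the signed divided derivative of \<open>t^n\<close>. The divided
  powers are those of the skew-symmetry axiom.\<close>

lemma divided_D_cong:
  "monom (scale (monom (c / fact j) j) z) n \<approx> lsc ((- 1) ^ j * c * of_nat (n choose j)) (monom z (n - j))"
proof (induction j arbitrary: c n)
  case 0
  show ?case by (simp add: lsc_monom monom_0)
next
  case (Suc j)
  let ?d = "c / of_nat (Suc j)"
  have nz: "(of_nat (Suc j) :: 'k) \<noteq> 0" by (simp del: of_nat_Suc)
  have "scale (monom (c / fact (Suc j)) (Suc j)) z = D (scale (monom (?d / fact j) j) z)"
    by (simp add: monom_Suc)
  then have "monom (scale (monom (c / fact (Suc j)) (Suc j)) z) n \<approx>
      - lsc (of_nat n) (monom (scale (monom (?d / fact j) j) z) (n - 1))"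
    using D_cong by metis
  also have "\<dots> \<approx> - lsc (of_nat n) (lsc ((- 1) ^ j * ?d * of_nat ((n - 1) choose j)) (monom z (n - 1 - j)))"
    by (intro cong_minus cong_lsc Suc)
  also have "\<dots> = lsc (- (of_nat n * ((- 1) ^ j * ?d * of_nat ((n - 1) choose j)))) (monom z (n - Suc j))"
    by (simp add: lam.scale_minus_left)
  also have "- (of_nat n * ((- 1) ^ j * ?d * of_nat ((n - 1) choose j))) = (- 1) ^ Suc j * c * of_nat (n choose Suc j)"
  proof (cases n)
    case (Suc n')
    have "of_nat (Suc j) * of_nat (n choose Suc j) = (of_nat n * of_nat (n' choose j) :: 'k)"
      unfolding Suc of_nat_mult[symmetric] Suc_times_binomial ..
    have "of_nat n * ((- 1) ^ j * ?d * of_nat ((n - 1) choose j)) =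
        (- 1) ^ j * ?d * (of_nat n * of_nat (n' choose j))"
      by (simp add: Suc mult_ac del: of_nat_Suc)
    also have "\<dots> = (- 1) ^ j * c * of_nat (n choose Suc j)"
      unfolding \<open>of_nat (Suc j) * of_nat (n choose Suc j) = (of_nat n * of_nat (n' choose j) :: 'k)\<close>[symmetric]
      using nz by (simp del: of_nat_Suc binomial_Suc_Suc)
    finally show ?thesis by simp
  qed simp
  finally show ?case .
qed

text \<open>Once divided powers of \<open>D\<close> are replaced by binomials, the signs combine to
  \<open>(-1)^s\<close>, and \<open>binsum_alternating\<close> collapses the double sum.\<close>

lemma lbr_skew_monom: "lbr (monom x m) (monom y n) \<approx> - lbr (monom y n) (monom x m)"
proof -
  define F where "F r = monom (br r y x) (m + n - r)" for r
  have step: "monom (br s x y) q \<approx> - lsc ((- 1) ^ s) (lam.binsum q (\<lambda>j. monom (br (s + j) y x) (q - j)))" for s q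
  proof -
    let ?A = "{j. br (s + j) y x \<noteq> 0}"
    let ?f = "\<lambda>j. lsc (of_nat (q choose j)) (monom (br (s + j) y x) (q - j))"
    have finA: "finite ?A"
      using finite_vimageI[OF br_locality[of y x], of "\<lambda>j. s + j"] by (simp add: vimage_def)
    have "monom (br s x y) q = - (\<Sum>j\<in>?A. monom (scale (monom ((- 1) ^ (s + j) / fact j) j) (br (s + j) y x)) q)"
      by (subst br_skew) (simp add: monom_neg monom_sum)
    also have "\<dots> \<approx> - (\<Sum>j\<in>?A. lsc ((- 1) ^ j * (- 1) ^ (s + j) * of_nat (q choose j)) (monom (br (s + j) y x) (q - j)))"
      by (intro cong_minus cong_sum divided_D_cong)
    also have "\<dots> = - (\<Sum>j\<in>?A. lsc ((- 1) ^ s) (?f j))"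
    proof -
      have "(- 1) ^ j * (- 1) ^ (s + j) = ((- 1) ^ s :: 'k)" for j
        by (simp add: power_add flip: power_mult_distrib)
      then show ?thesis by simp
    qed
    also have "(\<Sum>j\<in>?A. lsc ((- 1) ^ s) (?f j)) = lsc ((- 1) ^ s) (\<Sum>j\<in>?A. ?f j)"
      by (simp only: lam.scale_sum_right)
    also have "(\<Sum>j\<in>?A. ?f j) = (\<Sum>j\<in>?A \<union> {..q}. ?f j)"
      by (rule sum.mono_neutral_left) (use finA in auto)
    also have "\<dots> = (\<Sum>j\<le>q. ?f j)"
      by (rule sum.mono_neutral_right) (use finA in \<open>auto simp: not_le\<close>)
    finally show ?thesis by (simp add: lam.binsum_def)
  qed
  have "lbr (monom x m) (monom y n) \<approx>
      lam.binsum m (\<lambda>s. - lsc ((- 1) ^ s) (lam.binsum (m + n - s) (\<lambda>j. monom (br (s + j) y x) (m + n - s - j))))"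
    unfolding lbr_monom by (intro cong_binsum step)
  also have "\<dots> = - lam.binsum m (\<lambda>s. lsc ((- 1) ^ s) (lam.binsum (m + n - s) (\<lambda>j. F (s + j))))"
    unfolding lam.binsum_minus F_def by simp
  also have "\<dots> = - lam.binsum n F" by (simp only: lam.binsum_alternating)
  also have "\<dots> = - lbr (monom y n) (monom x m)" by (simp add: lbr_monom F_def[abs_def] add.commute)
  finally show ?thesis .
qed

lemma lbr_skew: "lbr p q + lbr q p \<in> K"
proof (induction p rule: poly_monom_induct)
  case (monom x m)
  show ?case
  proof (induction q rule: poly_monom_induct)
    case (monom y n)
    show ?case using lbr_skew_monom[of x m y n] by (simp add: cong_def)
  next
    case (add q q')
    then show ?case using lam.subspace_add[OF K add] by (simp add: lbr_add_left lbr_add_right algebra_simps)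
  qed (simp add: lam.subspace_0[OF K])
next
  case (add p p')
  then show ?case using lam.subspace_add[OF K add] by (simp add: lbr_add_left lbr_add_right algebra_simps)
qed (simp add: lam.subspace_0[OF K])

text \<open>Exact, not merely modulo \<open>K\<close>: \<open>D\<close> on the left gives the factor
  \<open>- s\<close>, which \<open>s * (n choose s) = n * (n - 1 choose s - 1)\<close> turns into
  the opposite of the \<open>d/dt\<close> term. With \<open>dgen\<close> on the right the bracket
  vanishes only modulo \<open>K\<close>.\<close>

lemma lbr_dgen_left: "lbr (dgen y n) q = 0"
proof (induction q rule: poly_monom_induct)
  case (monom a m)
  show ?case
  proof (cases n)
    case 0
    then show ?thesis by (simp add: dgen_def lbr_monom br_D_left)
  next
    case (Suc n')
    define G where "G s = monom (br s y a) (n' + m - s)" for s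
    have "lbr (monom (D y) n) (monom a m) =
        - (\<Sum>s\<le>Suc n'. lsc (of_nat (Suc n' choose s) * of_nat s) (monom (br (s - 1) y a) (Suc n' + m - s)))"
      unfolding lbr_monom Suc lam.binsum_def sum_negf[symmetric]
      by (intro sum.cong refl) (simp add: br_D_left scale_of_nat monom_neg flip: lsc_monom)
    also have "\<dots> = - (\<Sum>s\<le>n'. lsc (of_nat (Suc n' choose Suc s) * of_nat (Suc s)) (G s))"
      by (subst sum.atMost_Suc_shift) (simp add: G_def del: of_nat_Suc binomial_Suc_Suc)
    also have "\<dots> = - lsc (of_nat (Suc n')) (lam.binsum n' G)"
    proof -
      have "of_nat (Suc n' choose Suc s) * of_nat (Suc s) = (of_nat (Suc n') * of_nat (n' choose s) :: 'k)" for s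
        unfolding of_nat_mult[symmetric] by (simp only: Suc_times_binomial_eq)
      then show ?thesis by (simp add: lam.binsum_def lam.scale_sum_right del: of_nat_Suc binomial_Suc_Suc)
    qed
    also have "lam.binsum n' G = lbr (monom y n') (monom a m)" by (simp add: lbr_monom G_def[abs_def])
    finally show ?thesis by (simp add: dgen_def lbr_add_left lbr_scale Suc del: of_nat_Suc)
  qed
qed (simp_all add: lbr_add_right)

lemma lbr_K_right:
  assumes "p \<in> K"
  shows "lbr q p \<in> K"
  using assms unfolding K_def
proof (induction rule: lam.span_induct_alt)
  case base
  then show ?case by (simp add: lam.span_zero)
next
  case (step c g p)
  have "lbr q g \<in> K"
  proof -
    consider v n where "g = monom v n" "v \<in> k.span X" "n \<ge> N" | y n where "g = dgen y n"
      using step(1) unfolding Kgen_def by blast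
    then show ?thesis
    proof cases
      case 1
      show ?thesis
      proof (induction q rule: poly_monom_induct)
        case (monom a m)
        show ?case unfolding 1(1) lbr_monom
          by (intro lam.binsum_in[OF K] K_high inv_X 1) (use 1(3) in auto)
      qed (auto simp: lbr_add_left lam.subspace_0[OF K] lam.subspace_add[OF K])
    next
      case 2
      then show ?thesis using lbr_skew[of q g] lbr_dgen_left by simp
    qed
  qed
  then show ?case using step(2) unfolding K_def
    by (simp add: lbr_add_right lbr_scale lam.span_add lam.span_scale)
qed

lemma monom_subspace:
  assumes "lam.subspace S" "\<And>y n. dgen y n \<in> S"
  shows "subspace {a. \<forall>n. monom a n \<in> S}"
proof (rule subspaceI_k[OF subspace_monom[OF assms(1)]])
  fix a assume a: "a \<in> {a. \<forall>n. monom a n \<in> S}"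
  have "monom (D a) n \<in> S" for n
  proof -
    have "dgen a n - lsc (of_nat n) (monom a (n - 1)) \<in> S"
      using a by (intro lam.subspace_diff[OF assms(1)] lam.subspace_scale[OF assms(1)] assms(2)) auto
    then show ?thesis by (simp add: dgen_def)
  qed
  then show "D a \<in> {a. \<forall>n. monom a n \<in> S}" by simp
qed

text \<open>Modulo \<open>K\<close>, a \<open>D\<close> in the coefficient is traded for a lower
  power of \<open>t\<close>, so the \<open>v t^n\<close> with \<open>v\<close> in \<open>X\<close>
  suffice; those with \<open>n \<ge> N\<close> lie in \<open>K\<close>.\<close>

lemma finite_over_K: "lam.finite_over K UNIV"
proof -
  let ?B = "{monom v n |v n. v \<in> X \<and> n < N}"
  let ?S = "lam.span (K \<union> ?B)"
  have fin: "finite ?B"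
    using finite_image_set2[of "\<lambda>v. v \<in> X" "\<lambda>n. n < N" monom] finX by simp
  have "monom v n \<in> ?S" if v: "v \<in> X" for v n
  proof (cases "n < N")
    case True
    then show ?thesis using v by (intro lam.span_base) blast
  next
    case False
    then have "monom v n \<in> K" using v by (intro K_high k.span_base) auto
    then show ?thesis by (intro lam.span_base) blast
  qed
  then have "X \<subseteq> {a. \<forall>n. monom a n \<in> ?S}" by blast
  then have "span X \<subseteq> {a. \<forall>n. monom a n \<in> ?S}"
    by (rule span_minimal) (intro monom_subspace, simp, intro lam.span_base, simp add: K_dgen)
  then have "monom a n \<in> ?S" for a n using span_X by blast
  then have "p \<in> ?S" for p
    by (induction p rule: poly_monom_induct) (auto simp: lam.span_zero lam.span_add)
  then show ?thesis using fin unfolding lam.finite_over_def by blast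
qed

sublocale leib: leibniz_mod lsc lbr K
  by unfold_locales
    (auto simp: lbr_add_left lbr_add_right lbr_scale lbr_skew K finite_over_K lbr_K_right intro: lbr_leibniz)

lemma dser_coeff: "p \<in> leib.dser n \<Longrightarrow> coeff p i \<in> derived_series (Suc n)"
proof (induction n arbitrary: p i)
  case 0
  then show ?case by (simp add: derived_series_def)
next
  case (Suc n)
  let ?S = "derived_series (Suc (Suc n))"
  have kS: "k.subspace ?S" using derived_series_ideal[of "Suc (Suc n)"] subspace_k by simp
  have "coeff (lbr p q) i \<in> ?S" if pq: "p \<in> leib.dser n" "q \<in> leib.dser n" for p q i
  proof -
    have "lbr p q = (\<Sum>m\<le>degree p. \<Sum>l\<le>degree q. lbr0 m (coeff p m) l (coeff q l))"
      by (simp add: lbr_def ext_def)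
    then show ?thesis
      unfolding lbr0_def lam.binsum_def coeff_sum coeff_lsc coeff_monom using pq Suc.IH
      by (auto simp: coeff_sum intro!: k.subspace_sum[OF kS] k.subspace_scale[OF kS]
          derived_series_bracket k.subspace_0[OF kS])
  qed
  then have *: "coeff g i \<in> ?S" if "g \<in> {lbr x y |x y. x \<in> leib.dser n \<and> y \<in> leib.dser n}" for g i
    using that by blast
  from Suc.prems show ?case unfolding leib.dser_Suc
  proof (induction rule: lam.span_induct_alt)
    case (step c g q)
    then show ?case using * by (simp add: k.subspace_add[OF kS] k.subspace_scale[OF kS])
  qed (simp add: k.subspace_0[OF kS])
qed

lemma solvable_leib:
  assumes solvable
  shows "solvable_leibniz_mod lsc lbr K"
proof unfold_locales
  obtain n where n: "n > 1" "derived_series n = {0}" using assms by (auto simp: solvable_def)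
  then obtain n' where n': "n = Suc n'" by (cases n) auto
  have "leib.dser n' \<subseteq> {0}" using dser_coeff[of _ n'] n n' by (auto simp: poly_eq_iff)
  then show "\<exists>n. leib.dser n \<subseteq> K" using lam.subspace_0[OF K] by blast
qed

lemma eventually_K: "\<exists>n0. \<forall>n\<ge>n0. monom a n \<in> K"
proof -
  let ?S = "{a. \<exists>n0. \<forall>n\<ge>n0. monom a n \<in> K}"
  have "k.subspace ?S"
  proof (rule k.subspaceI)
    show "0 \<in> ?S" by (simp add: lam.subspace_0[OF K])
    show "a + b \<in> ?S" if ab: "a \<in> ?S" "b \<in> ?S" for a b
    proof -
      obtain n0 n1 where "\<forall>n\<ge>n0. monom a n \<in> K" "\<forall>n\<ge>n1. monom b n \<in> K" using ab by blast
      then have "\<forall>n\<ge>max n0 n1. monom (a + b) n \<in> K"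
        by (auto simp: monom_add intro!: lam.subspace_add[OF K])
      then show ?thesis by blast
    qed
    show "scale [:c:] a \<in> ?S" if "a \<in> ?S" for c a
      using that by (auto simp flip: lsc_monom intro: lam.subspace_scale[OF K])
  qed
  moreover have "D a \<in> ?S" if "a \<in> ?S" for a
  proof -
    obtain n0 where n0: "\<forall>n\<ge>n0. monom a n \<in> K" using \<open>a \<in> ?S\<close> by blast
    have "monom (D a) n \<in> K" if "n \<ge> Suc n0" for n
    proof -
      have "dgen a n - lsc (of_nat n) (monom a (n - 1)) \<in> K"
        using n0 that by (intro lam.subspace_diff[OF K] lam.subspace_scale[OF K] K_dgen) auto
      then show ?thesis by (simp add: dgen_def)
    qed
    then show ?thesis by blast
  qed
  ultimately have "subspace ?S" by (rule subspaceI_k)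
  moreover have "X \<subseteq> ?S" using K_high k.span_base by blast
  ultimately have "span X \<subseteq> ?S" by (rule span_minimal[rotated])
  then show ?thesis using span_X by blast
qed

text \<open>An \<open>H\<close>-linear functional on \<open>L\<close> pairs with \<open>L[t]\<close> by letting \<open>D\<close> act as \<open>- d/dt\<close> and setting \<open>t = 0\<close>.\<close>

lemma functional_separates:
  assumes xi_add: "\<And>x y. \<xi> (x + y) = \<xi> x + (\<xi> y :: 'k poly)" and xi_scale: "\<And>h x. \<xi> (scale h x) = h * \<xi> x"
    and deg: "\<And>v n. v \<in> X \<Longrightarrow> n \<ge> N \<Longrightarrow> coeff (\<xi> v) n = 0"
    and a: "\<And>n. monom a n \<in> K"
  shows "\<xi> a = 0"
proof -
  \<comment> \<open>This is \<open>\<xi> x\<close>, evaluated at \<open>- d/dt\<close>, applied to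
    \<open>t^m\<close> and taken at \<open>t = 0\<close>: only the coefficient of \<open>D^m\<close>
    survives.\<close>
  define f where "f m x = (- 1) ^ m * fact m * coeff (\<xi> x) m" for m x
  have f_add: "f m (x + y) = f m x + f m y" for m x y by (simp add: f_def xi_add algebra_simps)
  have f_scale: "f m (scale [:c:] x) = c * f m x" for m c x by (simp add: f_def xi_scale)
  let ?\<Phi> = "ext f"
  have Phi_lsc: "?\<Phi> (lsc c p) = c * ?\<Phi> p" for c p
  proof (induction p rule: poly_monom_induct)
    case (monom a n)
    show ?case by (simp add: lsc_monom ext_monom[of f, OF f_add] f_scale)
  qed (simp_all add: ext_0[of f, OF f_add] ext_add[of f, OF f_add] lam.scale_right_distrib algebra_simps)
  have xi_0: "\<xi> 0 = 0" using xi_scale[of 0 0] by simp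
  have high: "coeff (\<xi> v) n = 0" if "v \<in> k.span X" "n \<ge> N" for v n
    using that(1) by (induction rule: k.span_induct_alt) (auto simp: xi_0 xi_add xi_scale deg that(2))
  have dg: "?\<Phi> (dgen y n) = 0" for y n
  proof (cases n)
    case 0
    then show ?thesis
      by (simp add: dgen_def ext_add[of f, OF f_add] ext_monom[of f, OF f_add] Phi_lsc f_def xi_scale)
  next
    case (Suc n')
    then show ?thesis
      by (simp add: dgen_def ext_add[of f, OF f_add] ext_monom[of f, OF f_add] Phi_lsc f_def xi_scale algebra_simps)
  qed
  have "?\<Phi> p = 0" if "p \<in> K" for p
    using that unfolding K_def
  proof (induction rule: lam.span_induct_alt)
    case (step c g p)
    have "?\<Phi> g = 0"
      using step(1) dg high unfolding Kgen_def by (auto simp: ext_monom[of f, OF f_add] f_def)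
    then show ?case using step(2) by (simp add: ext_add[of f, OF f_add] Phi_lsc)
  qed (simp add: ext_0[of f, OF f_add])
  then have "f n a = 0" for n using a[of n] by (metis ext_monom[of f, OF f_add])
  then show ?thesis by (simp add: f_def poly_eq_iff)
qed

end

context poly_module
begin

text \<open>For a maximal independent subset \<open>B\<close> of the generators, each generator has
  a nonzero multiple in \<open>span B\<close>, so one nonzero \<open>H\<close> carries the whole
  module there. Multiplication by \<open>H\<close> is injective by torsion-freeness, and
  \<open>\<xi> b x\<close> is the coordinate of \<open>H x\<close> at \<open>b\<close>.\<close>

lemma torsion_free_coordinates:
  assumes "finite F" "span F = UNIV" "torsion_free"
  shows "\<exists>(B :: 'l set) \<xi>. finite B \<and> (\<forall>b x y. \<xi> b (x + y) = \<xi> b x + (\<xi> b y :: 'k poly)) \<and>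
    (\<forall>b h x. \<xi> b (h *h x) = h * \<xi> b x) \<and> (\<forall>x. (\<forall>b\<in>B. \<xi> b x = 0) \<longrightarrow> x = 0)"
proof -
  have "\<exists>B. B \<subseteq> F \<and> independent B \<and> (\<forall>B'. B' \<subseteq> F \<longrightarrow> independent B' \<longrightarrow> card B' \<le> card B)"
  proof -
    have "{} \<subseteq> F \<and> independent {}" by (simp add: independent_empty)
    moreover have "\<forall>B. B \<subseteq> F \<and> independent B \<longrightarrow> card B < Suc (card F)"
      using assms(1) by (simp add: card_mono less_Suc_eq_le)
    ultimately obtain B where "B \<subseteq> F \<and> independent B" "\<forall>B'. B' \<subseteq> F \<and> independent B' \<longrightarrow> card B' \<le> card B"
      using ex_has_greatest_nat[of "\<lambda>B. B \<subseteq> F \<and> independent B" "{}" card "Suc (card F)"] by blast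
    then show ?thesis by blast
  qed
  then obtain B where B: "B \<subseteq> F" "independent B" "\<And>B'. B' \<subseteq> F \<Longrightarrow> independent B' \<Longrightarrow> card B' \<le> card B"
    by blast
  have finB: "finite B" using B(1) assms(1) finite_subset by blast
  have "\<exists>h. h \<noteq> 0 \<and> h *h f \<in> span B" if f: "f \<in> F" for f
  proof (cases "f \<in> B")
    case True
    then show ?thesis by (intro exI[of _ 1]) (simp add: span_base)
  next
    case False
    then have "dependent (insert f B)" using B(1) B(3)[of "insert f B"] f finB by auto
    then obtain u where u: "\<exists>v\<in>insert f B. u v \<noteq> 0" "(\<Sum>v\<in>insert f B. u v *h v) = 0"
      using dependent_finite[of "insert f B"] finB by auto
    have sum: "u f *h f + (\<Sum>v\<in>B. u v *h v) = 0" using u(2) False finB by simp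
    have "u f \<noteq> 0"
    proof
      assume "u f = 0"
      then have "(\<Sum>v\<in>B. u v *h v) = 0" "\<exists>v\<in>B. u v \<noteq> 0" using sum u(1) by auto
      then show False using B(2) dependent_finite[OF finB] by blast
    qed
    moreover have "u f *h f = - (\<Sum>v\<in>B. u v *h v)" using sum by (simp add: eq_neg_iff_add_eq_0)
    then have "u f *h f \<in> span B" by (simp only:) (intro span_neg span_sum span_scale span_base)
    ultimately show ?thesis by blast
  qed
  then obtain h where h: "\<And>f. f \<in> F \<Longrightarrow> h f \<noteq> 0 \<and> h f *h f \<in> span B" by metis
  define H where "H = (\<Prod>f\<in>F. h f)"
  have H0: "H \<noteq> 0" using h assms(1) by (simp add: H_def)
  have "F \<subseteq> {x. H *h x \<in> span B}"
  proof safe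
    fix f assume f: "f \<in> F"
    have "H = (\<Prod>f\<in>F - {f}. h f) * h f" using f assms(1) by (simp add: H_def prod.remove mult.commute)
    then have "H *h f = (\<Prod>f\<in>F - {f}. h f) *h (h f *h f)" by simp
    then show "H *h f \<in> span B" using h[OF f] span_scale by metis
  qed
  moreover have "subspace {x. H *h x \<in> span B}"
  proof (rule subspaceI)
    show "c *h x \<in> {x. H *h x \<in> span B}" if "x \<in> {x. H *h x \<in> span B}" for c x
      using span_scale[of "H *h x" B c] that by (simp add: mult.commute)
  qed (auto simp: span_zero span_add scale_right_distrib)
  ultimately have "span F \<subseteq> {x. H *h x \<in> span B}" by (rule span_minimal)
  then have HB: "H *h x \<in> span B" for x using assms(2) by blast
  define \<xi> where "\<xi> b x = representation B (H *h x) b" for b x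
  show ?thesis
  proof (rule exI[of _ B], rule exI[of _ \<xi>], intro conjI allI impI)
    show "\<xi> b (x + y) = \<xi> b x + \<xi> b y" for b x y
      unfolding \<xi>_def scale_right_distrib by (simp add: representation_add[OF B(2) HB HB])
    show "\<xi> b (c *h x) = c * \<xi> b x" for b c x
      unfolding \<xi>_def scale_left_commute[of H] representation_scale[OF B(2) HB] ..
    show "x = 0" if "\<forall>b\<in>B. \<xi> b x = 0" for x
    proof -
      have "H *h x = (\<Sum>b\<in>B. \<xi> b x *h b)"
        unfolding \<xi>_def by (rule sum_representation_eq[symmetric, OF B(2) HB finB order_refl])
      then have "H *h x = 0" using that by simp
      then show ?thesis using assms(3) H0 by (auto simp: torsion_free_def)
    qed
  qed (rule finB)
qed

end

context lie_conformal_algebra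
begin

text \<open>\<open>\<rho> n a\<close> is the matrix by which \<open>a t\<^sup>n\<close> acts on \<open>k\<^sup>d\<close>.\<close>

definition coefficient_rep :: "nat \<Rightarrow> (nat \<Rightarrow> 'l \<Rightarrow> nat \<Rightarrow> nat \<Rightarrow> 'k) \<Rightarrow> bool" where
  "coefficient_rep d \<rho> \<longleftrightarrow>
    (\<forall>n a b i j. \<rho> n (a + b) i j = \<rho> n a i j + \<rho> n b i j) \<and>
    (\<forall>n c a i j. \<rho> n (scale [:c:] a) i j = c * \<rho> n a i j) \<and>
    (\<forall>n a i j. i < d \<longrightarrow> j < d \<longrightarrow> \<rho> n (D a) i j = - of_nat n * \<rho> (n - 1) a i j) \<and>
    (\<forall>m n a b i j. j < d \<longrightarrow>
      (\<Sum>l<d. \<rho> m a i l * \<rho> n b l j - \<rho> n b i l * \<rho> m a l j) =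
      (\<Sum>s\<le>m. of_nat (m choose s) * \<rho> (m + n - s) (br s a b) i j)) \<and>
    (\<forall>a. \<exists>n0. \<forall>n\<ge>n0. \<forall>i<d. \<forall>j<d. \<rho> n a i j = 0) \<and>
    (\<forall>a. (\<forall>n. \<forall>i<d. \<forall>j<d. \<rho> n a i j = 0) \<longrightarrow> a = 0)"

theorem coefficient_rep_exists:
  assumes "finitely_generated UNIV" "torsion_free" "solvable"
  shows "\<exists>d \<rho>. coefficient_rep d \<rho>"
proof -
  obtain X where X: "finite X" "span X = UNIV" "\<And>n x v. v \<in> k.span X \<Longrightarrow> br n x v \<in> k.span X"
    using solvable_invariant_generators[OF assms(1,3)] by blast
  obtain B :: "'l set" and \<xi> :: "'l \<Rightarrow> 'l \<Rightarrow> 'k poly" where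
    coord: "finite B \<and> (\<forall>b x y. \<xi> b (x + y) = \<xi> b x + \<xi> b y) \<and>
      (\<forall>b h x. \<xi> b (scale h x) = h * \<xi> b x) \<and> (\<forall>x. (\<forall>b\<in>B. \<xi> b x = 0) \<longrightarrow> x = 0)"
    using torsion_free_coordinates[OF X(1,2) assms(2)] by (elim exE)
  note B = coord[THEN conjunct1] coord[THEN conjunct2, THEN conjunct1, rule_format]
    coord[THEN conjunct2, THEN conjunct2, THEN conjunct1, rule_format]
    coord[THEN conjunct2, THEN conjunct2, THEN conjunct2, rule_format]
  \<comment> \<open>\<open>N\<close> has to exceed all degrees of coordinates of generators; then
    \<open>functional_separates\<close> shows that no nonzero \<open>a\<close> has every
    \<open>a t^n\<close> in \<open>K\<close>.\<close>
  have "finite ((\<lambda>(b, v). degree (\<xi> b v)) ` (B \<times> X))" using B(1) X(1) by simp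
  then obtain N where N: "\<forall>n\<in>(\<lambda>(b, v). degree (\<xi> b v)) ` (B \<times> X). n < N"
    using finite_nat_set_iff_bounded by blast
  interpret truncated_annihilation scale br X N using X by unfold_locales
  obtain d and R :: "'l poly \<Rightarrow> nat \<Rightarrow> nat \<Rightarrow> 'k" where
    mat: "leib.matrix_rep d R"
    using solvable_leibniz_mod.faithful_matrices[OF solvable_leib[OF assms(3)]] by (elim exE)
  note mat' = mat[unfolded leib.matrix_rep_def]
  note R = mat'[THEN conjunct1, rule_format] mat'[THEN conjunct2, THEN conjunct1, rule_format]
    mat'[THEN conjunct2, THEN conjunct2, THEN conjunct1, rule_format]
    mat'[THEN conjunct2, THEN conjunct2, THEN conjunct2, THEN spec]
  have R_0: "R 0 i j = 0" for i j using R(2)[of 0 0] by simp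
  have R_sum: "R (sum f A) i j = (\<Sum>a\<in>A. R (f a) i j)" for f A i j
    by (induction A rule: infinite_finite_induct) (auto simp: R(1) R_0)
  define \<rho> where "\<rho> n a = R (monom a n)" for n a
  have "coefficient_rep d \<rho>" unfolding coefficient_rep_def
  proof (intro conjI allI impI)
    show "\<rho> n (a + b) i j = \<rho> n a i j + \<rho> n b i j" for n a b i j by (simp add: \<rho>_def monom_add R)
    show "\<rho> n (scale [:c:] a) i j = c * \<rho> n a i j" for n c a i j by (simp add: \<rho>_def R flip: lsc_monom)
    show "\<rho> n (D a) i j = - of_nat n * \<rho> (n - 1) a i j" if "i < d" "j < d" for n a i j
    proof -
      have "R (dgen a n) i j = 0" using K_dgen R(4) that by blast
      then show ?thesis by (simp add: dgen_def R \<rho>_def eq_neg_iff_add_eq_0)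
    qed
    show "(\<Sum>l<d. \<rho> m a i l * \<rho> n b l j - \<rho> n b i l * \<rho> m a l j) =
      (\<Sum>s\<le>m. of_nat (m choose s) * \<rho> (m + n - s) (br s a b) i j)" if "j < d" for m n a b i j
      unfolding \<rho>_def R(3)[OF that, symmetric] lbr_monom lam.binsum_def R_sum R(2) ..
    show "\<exists>n0. \<forall>n\<ge>n0. \<forall>i<d. \<forall>j<d. \<rho> n a i j = 0" for a
      using eventually_K[of a] R(4) unfolding \<rho>_def by blast
    show "a = 0" if "\<forall>n. \<forall>i<d. \<forall>j<d. \<rho> n a i j = 0" for a
    proof (rule B(4))
      fix \<beta> assume \<beta>: "\<beta> \<in> B"
      show "\<xi> \<beta> a = 0"
      proof (rule functional_separates)
        show "coeff (\<xi> \<beta> v) n = 0" if "v \<in> X" "n \<ge> N" for v n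
          using N \<beta> that by (intro coeff_eq_0) fastforce
        show "monom a n \<in> K" for n using that R(4) unfolding \<rho>_def by blast
      qed (rule B)+
    qed
  qed
  then show ?thesis by blast
qed

end

section \<open>The induced module\<close>

context char0_space
begin

lemma binsum_reflect: "binsum n (\<lambda>j. F (n - j)) = binsum n F"
  unfolding binsum_def
  by (rule sum.reindex_bij_witness[of _ "\<lambda>i. n - i" "\<lambda>i. n - i"]) (auto simp flip: binomial_symmetric)

lemma binsum_triangle_swap:
  "binsum n (\<lambda>j. binsum (n - j) (\<lambda>i. F i j)) = binsum n (\<lambda>i. binsum (n - i) (\<lambda>j. F i j))"
proof -
  have "binsum n (\<lambda>j. binsum (n - j) (\<lambda>i. F i j)) = binsum n (\<lambda>s. binsum s (\<lambda>j. F j (s - j)))"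
    by (rule binsum_triangle[symmetric])
  also have "\<dots> = binsum n (\<lambda>s. binsum s (\<lambda>j. F (s - j) j))"
  proof (rule binsum_cong)
    fix s
    show "binsum s (\<lambda>j. F j (s - j)) = binsum s (\<lambda>j. F (s - j) j)"
      by (subst binsum_reflect[symmetric]) (intro binsum_cong, simp)
  qed
  finally show ?thesis by (simp add: binsum_triangle)
qed

lemma binsum_index: "binsum n (\<lambda>j. of_nat j *s F (j - 1)) = of_nat n *s binsum (n - 1) F"
proof (cases n)
  case (Suc n')
  have "binsum n (\<lambda>j. of_nat j *s F (j - 1)) = (\<Sum>j\<le>n'. of_nat (Suc j * (Suc n' choose Suc j)) *s F j)"
    unfolding binsum_def Suc
    by (subst sum.atMost_Suc_shift) (simp add: mult.commute del: of_nat_Suc binomial_Suc_Suc mult_Suc mult_Suc_right)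
  also have "\<dots> = of_nat n *s binsum (n - 1) F"
    unfolding Suc_times_binomial by (simp add: Suc binsum_def scale_sum_right del: of_nat_Suc mult_Suc mult_Suc_right)
  finally show ?thesis .
qed simp

lemma binsum_coindex: "binsum n (\<lambda>j. of_nat (n - j) *s F j) = of_nat n *s binsum (n - 1) F"
proof (cases n)
  case (Suc n')
  have "binsum n (\<lambda>j. of_nat (n - j) *s F j) = (\<Sum>j\<le>n'. of_nat ((n - j) * (n choose j)) *s F j)"
    unfolding binsum_def Suc by (simp add: mult.commute del: binomial_Suc_Suc of_nat_diff)
  also have "\<dots> = of_nat n *s binsum (n - 1) F"
    unfolding binomial_absorb_comp by (simp add: Suc binsum_def scale_sum_right del: of_nat_Suc mult_Suc mult_Suc_right)
  finally show ?thesis .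
qed simp

end

interpretation pp: poly_module "smult :: 'k::field_char_0 poly \<Rightarrow> 'k poly poly \<Rightarrow> 'k poly poly"
  using module_smult by (rule poly_module.intro)

text \<open>The type \<open>'k poly poly\<close> is read as \<open>k[D] \<otimes> W\<close>: the
  inner variable is \<open>D\<close>, and the powers of the outer one form the basis of
  \<open>W\<close>. This map is \<open>d/dD\<close>.\<close>

definition dcoeff :: "'k::field_char_0 poly poly \<Rightarrow> 'k poly poly" where
  "dcoeff P = map_poly pderiv P"

lemma coeff_dcoeff: "coeff ((dcoeff ^^ j) P) i = (pderiv ^^ j) (coeff P i)"
  by (induction j) (simp_all add: dcoeff_def coeff_map_poly)

lemma higher_pderiv_add: "(pderiv ^^ j) (p + q) = (pderiv ^^ j) p + (pderiv ^^ j) (q :: 'k::field_char_0 poly)"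
  by (induction j) (simp_all add: pderiv_add)

lemma higher_pderiv_smult: "(pderiv ^^ j) (smult c p) = smult c ((pderiv ^^ j) (p :: 'k::field_char_0 poly))"
  by (induction j) (simp_all add: pderiv_smult)

lemma higher_pderiv_pCons_0:
  "(pderiv ^^ j) (pCons 0 p) = pCons 0 ((pderiv ^^ j) p) + smult (of_nat j) ((pderiv ^^ (j - 1)) (p :: 'k::field_char_0 poly))"
proof (induction j)
  case (Suc j)
  have "smult (of_nat j) (pderiv ((pderiv ^^ (j - 1)) p)) = smult (of_nat j) ((pderiv ^^ j) p)"
    by (cases j) simp_all
  then show ?case
    by (simp only: funpow.simps comp_def Suc pderiv_add pderiv_smult pderiv_pCons diff_Suc_1 of_nat_Suc
        smult_add_left smult_1_left add_ac)
qed simp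

lemma higher_pderiv_degree: "degree p < j \<Longrightarrow> (pderiv ^^ j) (p :: 'k::field_char_0 poly) = 0"
proof (induction j arbitrary: p)
  case (Suc j)
  show ?case
  proof (cases "degree p = 0")
    case True
    then have "pderiv p = 0" by (simp add: pderiv_eq_0_iff)
    moreover have "(pderiv ^^ j) 0 = (0 :: 'k poly)" by (induction j) simp_all
    ultimately show ?thesis by (simp add: funpow_swap1)
  next
    case False
    then show ?thesis using Suc by (simp add: funpow_swap1 degree_pderiv)
  qed
qed simp

definition matp :: "nat \<Rightarrow> (nat \<Rightarrow> nat \<Rightarrow> 'k::field_char_0) \<Rightarrow> 'k poly poly \<Rightarrow> 'k poly poly" where
  "matp d R P = (\<Sum>i<d. monom (\<Sum>j<d. smult (R i j) (coeff P j)) i)"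

lemma coeff_matp: "coeff (matp d R P) i = (if i < d then \<Sum>j<d. smult (R i j) (coeff P j) else 0)"
  by (simp add: matp_def coeff_sum)

text \<open>
  The module induced from the action of \<open>\<rho>\<close> on \<open>W = k\<^sup>d\<close>: on \<open>k[D] \<otimes> W\<close> one has
  \<open>a\<^sub>\<lambda> (f(D) w) = f(D + \<lambda>) a\<^sub>\<lambda> w\<close>, and \<open>matact\<close> is the coefficient of \<open>\<lambda>\<^sup>n / n!\<close>.
\<close>

definition matact :: "nat \<Rightarrow> (nat \<Rightarrow> 'l \<Rightarrow> nat \<Rightarrow> nat \<Rightarrow> 'k::field_char_0) \<Rightarrow> nat \<Rightarrow> 'l \<Rightarrow> 'k poly poly \<Rightarrow> 'k poly poly" where
  "matact d \<rho> n a P = pp.k.binsum n (\<lambda>j. matp d (\<rho> (n - j) a) ((dcoeff ^^ j) P))"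

lemma matp_add: "matp d R (P + Q) = matp d R P + matp d R Q"
  by (auto simp: poly_eq_iff[of "matp d R (P + Q)"] coeff_matp smult_add_right sum.distrib)
lemma matp_0: "matp d R 0 = 0"
  by (auto simp: poly_eq_iff[of "matp d R 0"] coeff_matp)
lemma smult_sum_poly: "smult c (sum f A) = (\<Sum>a\<in>A. smult c (f a))"
  by (induction A rule: infinite_finite_induct) (auto simp: smult_add_right)
lemma matp_smult: "matp d R (smult f P) = smult f (matp d R P)"
  by (rule poly_eqI) (simp add: coeff_matp sum_distrib_left)
lemma matp_sum: "matp d R (sum f A) = (\<Sum>a\<in>A. matp d R (f a))"
  by (induction A rule: infinite_finite_induct) (auto simp: matp_add matp_0)
lemma matp_cong: "(\<And>i j. i < d \<Longrightarrow> j < d \<Longrightarrow> R i j = S i j) \<Longrightarrow> matp d R P = matp d S P"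
  by (rule poly_eqI) (auto simp: coeff_matp)
lemma matp_add_left: "matp d (\<lambda>i j. R i j + S i j) P = matp d R P + matp d S P"
  by (rule poly_eqI) (simp add: coeff_matp smult_add_left sum.distrib)
lemma matp_diff_left: "matp d (\<lambda>i j. R i j - S i j) P = matp d R P - matp d S P"
  by (rule poly_eqI) (simp add: coeff_matp smult_diff_left sum_subtractf)
lemma matp_scale_left: "matp d (\<lambda>i j. c * R i j) P = smult [:c:] (matp d R P)"
  by (rule poly_eqI) (simp add: coeff_matp smult_sum_poly)
lemma matp_sum_left: "matp d (\<lambda>i j. \<Sum>a\<in>A. R a i j) P = (\<Sum>a\<in>A. matp d (R a) P)"
proof (induction A rule: infinite_finite_induct)
  case (insert x F)
  then show ?case by (simp add: matp_add_left)
qed (auto intro!: poly_eqI simp: coeff_matp)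
lemma matp_matp: "matp d R (matp d S P) = matp d (\<lambda>i j. \<Sum>l<d. R i l * S l j) P"
proof (rule poly_eqI)
  fix i
  have "(\<Sum>l<d. smult (R i l) (\<Sum>j<d. smult (S l j) (coeff P j))) =
      (\<Sum>j<d. smult (\<Sum>l<d. R i l * S l j) (coeff P j))"
    by (simp add: smult_sum_poly smult_sum) (rule sum.swap)
  then show "coeff (matp d R (matp d S P)) i = coeff (matp d (\<lambda>i j. \<Sum>l<d. R i l * S l j) P) i"
    by (simp add: coeff_matp)
qed
lemma higher_pderiv_sum: "(pderiv ^^ j) (sum f A) = (\<Sum>a\<in>A. (pderiv ^^ j) (f a :: 'k::field_char_0 poly))"
proof (induction A rule: infinite_finite_induct)
  case (infinite A) then show ?case by (induction j) simp_all
next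
  case empty then show ?case by (induction j) simp_all
next
  case (insert x F) then show ?case by (simp add: higher_pderiv_add)
qed
lemma dcoeff_matp: "(dcoeff ^^ k) (matp d R P) = matp d R ((dcoeff ^^ k) P)"
proof (rule poly_eqI)
  fix i
  have "(pderiv ^^ k) 0 = (0 :: 'a poly)" by (induction k) simp_all
  then show "coeff ((dcoeff ^^ k) (matp d R P)) i = coeff (matp d R ((dcoeff ^^ k) P)) i"
    by (simp add: coeff_dcoeff coeff_matp higher_pderiv_sum higher_pderiv_smult)
qed
lemma dcoeff_add: "(dcoeff ^^ k) (P + Q) = (dcoeff ^^ k) P + (dcoeff ^^ k) Q"
  by (rule poly_eqI) (simp add: coeff_dcoeff higher_pderiv_add)
lemma dcoeff_smult: "(dcoeff ^^ k) (smult [:c:] P) = smult [:c:] ((dcoeff ^^ k) P)"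
  by (rule poly_eqI) (simp add: coeff_dcoeff higher_pderiv_smult)
lemma dcoeff_sum: "(dcoeff ^^ k) (sum f A) = (\<Sum>a\<in>A. (dcoeff ^^ k) (f a))"
  by (rule poly_eqI) (simp add: coeff_dcoeff coeff_sum higher_pderiv_sum)
lemma dcoeff_D: "(dcoeff ^^ k) (smult [:0, 1:] P) =
    smult [:0, 1:] ((dcoeff ^^ k) P) + smult [:of_nat k:] ((dcoeff ^^ (k - 1)) P)"
  by (rule poly_eqI) (simp add: coeff_dcoeff higher_pderiv_pCons_0)
lemma dcoeff_binsum: "(dcoeff ^^ k) (pp.k.binsum n F) = pp.k.binsum n (\<lambda>j. (dcoeff ^^ k) (F j))"
  by (simp add: pp.k.binsum_def dcoeff_sum dcoeff_smult)
lemma matp_binsum: "matp d R (pp.k.binsum n F) = pp.k.binsum n (\<lambda>j. matp d R (F j))"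
  by (simp add: pp.k.binsum_def matp_sum matp_smult)

definition bounded_polys :: "nat \<Rightarrow> 'k::field_char_0 poly poly set" where
  "bounded_polys d = {P. \<forall>i\<ge>d. coeff P i = 0}"

lemma bounded_polys_basis:
  fixes B :: "'a::field_char_0 poly poly set" and d :: nat
  defines "B \<equiv> (\<lambda>i. monom 1 i) ` {..<d}"
  shows "pp.independent B \<and> pp.span B = bounded_polys d"
  unfolding B_def
proof
  let ?B = "(\<lambda>i. monom 1 i) ` {..<d} :: 'a poly poly set"
  have inj: "inj_on (\<lambda>i. monom (1 :: 'a poly) i) {..<d}" by (auto intro!: inj_onI simp: monom_eq_iff')
  show "pp.independent ?B"
  proof
    assume "pp.dependent ?B"
    then obtain u where u: "\<exists>v\<in>?B. u v \<noteq> 0" "(\<Sum>v\<in>?B. smult (u v) v) = 0"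
      using pp.dependent_finite[of ?B] by auto
    have "(\<Sum>i<d. smult (u (monom 1 i)) (monom 1 i)) = 0"
      using u(2) by (simp add: sum.reindex[OF inj])
    then have "coeff (\<Sum>i<d. smult (u (monom 1 i)) (monom 1 i)) i = 0" for i by simp
    then have "(if i < d then u (monom 1 i) else 0) = 0" for i
      by (simp add: coeff_sum if_distrib[of "(*) _"] cong: if_cong)
    then have "u (monom 1 i) = 0" if "i < d" for i using that by metis
    then show False using u(1) by auto
  qed
  show "pp.span ?B = bounded_polys d"
  proof
    have "pp.subspace (bounded_polys d :: 'a poly poly set)"
      by (rule pp.subspaceI) (auto simp: bounded_polys_def)
    then show "pp.span ?B \<subseteq> bounded_polys d"
      by (intro pp.span_minimal) (auto simp: bounded_polys_def)
    show "bounded_polys d \<subseteq> pp.span ?B"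
    proof
      fix P :: "'a poly poly" assume "P \<in> bounded_polys d"
      then have "P = (\<Sum>i<d. smult (coeff P i) (monom 1 i))"
        by (intro poly_eqI) (auto simp: bounded_polys_def coeff_sum if_distrib[of "(*) _"] cong: if_cong)
      also have "\<dots> \<in> pp.span ?B" by (intro pp.span_sum pp.span_scale pp.span_base) auto
      finally show "P \<in> pp.span ?B" .
    qed
  qed
qed

text \<open>Since \<open>d/dD\<close> commutes with constant matrices, a composition of two actions
  is a double binomial sum of matrix products; the bracket rule for \<open>\<rho>\<close> and a
  regrouping as for \<open>lbr_leibniz_monom\<close> give Jacobi.\<close>

lemma (in lie_conformal_algebra) matact_representation:
  assumes rep: "coefficient_rep d \<rho>"
  shows "conformal_representation scale br smult (bounded_polys d) (matact d \<rho>) \<and> faithful (bounded_polys d) (matact d \<rho>)"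
proof
  note * = rep[unfolded coefficient_rep_def]
  note add = *[THEN conjunct1, rule_format]
    and scale = *[THEN conjunct2, THEN conjunct1, rule_format]
    and D = *[THEN conjunct2, THEN conjunct2, THEN conjunct1, rule_format]
    and bracket = *[THEN conjunct2, THEN conjunct2, THEN conjunct2, THEN conjunct1, rule_format]
    and local = *[THEN conjunct2, THEN conjunct2, THEN conjunct2, THEN conjunct2, THEN conjunct1, rule_format]
    and faith = *[THEN conjunct2, THEN conjunct2, THEN conjunct2, THEN conjunct2, THEN conjunct2, rule_format]
  let ?M = "bounded_polys d :: 'k poly poly set" and ?act = "matact d \<rho>"
  have matp_rho_add: "matp d (\<rho> n (a + b)) P = matp d (\<rho> n a) P + matp d (\<rho> n b) P" for n a b P
    unfolding matp_add_left[symmetric] by (rule matp_cong) (rule add)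
  have matp_rho_scale: "matp d (\<rho> n (scale [:c:] a)) P = smult [:c:] (matp d (\<rho> n a) P)" for n c a P
    unfolding matp_scale_left[symmetric] by (rule matp_cong) (rule scale)
  have matp_rho_D: "matp d (\<rho> n (D a)) P = smult [:- of_nat n:] (matp d (\<rho> (n - 1) a) P)" for n a P
    unfolding matp_scale_left[symmetric] by (rule matp_cong) (rule D)
  have matp_rho_bracket: "matp d (\<rho> m a) (matp d (\<rho> n b) P) - matp d (\<rho> n b) (matp d (\<rho> m a) P) =
      pp.k.binsum m (\<lambda>s. matp d (\<rho> (m + n - s) (br s a b)) P)" for m n a b P
    unfolding matp_matp matp_diff_left[symmetric] pp.k.binsum_def matp_scale_left[symmetric] matp_sum_left[symmetric]
    by (rule matp_cong) (simp only: bracket sum_subtractf[symmetric])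
  have k: "smult (of_nat n) P = smult [:of_nat n:] P" for n and P :: "'k poly poly" by (rule pp.scale_of_nat)
  show "conformal_representation scale br smult ?M ?act"
  proof (intro conformal_representation.intro conformal_representation_axioms.intro)
    show "lie_conformal_algebra scale br" by (rule lie_conformal_algebra_axioms)
    show "module (smult :: 'k poly \<Rightarrow> _)" by (rule module_smult)
    show "pp.subspace ?M" by (rule pp.subspaceI) (auto simp: bounded_polys_def)
    show "?act n a v \<in> ?M" for n a v
      by (auto simp: bounded_polys_def matact_def pp.k.binsum_def coeff_sum coeff_matp)
    show "?act n (a + b) v = ?act n a v + ?act n b v" for n a b v
      by (simp add: matact_def matp_rho_add pp.k.binsum_add)
    show "?act n a (v + w) = ?act n a v + ?act n a w" for n a v w
      by (simp add: matact_def dcoeff_add matp_add pp.k.binsum_add)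
    show "?act n (scale [:r:] a) v = smult [:r:] (?act n a v)" for n r a v
      by (simp only: matact_def matp_rho_scale pp.k.binsum_scale)
    show "?act n a (smult [:r:] v) = smult [:r:] (?act n a v)" for n r a v
      by (simp only: matact_def dcoeff_smult matp_smult pp.k.binsum_scale)
    show "finite {n. ?act n a v \<noteq> 0}" for a v
    proof -
      obtain n0 where n0: "\<And>n i j. n \<ge> n0 \<Longrightarrow> i < d \<Longrightarrow> j < d \<Longrightarrow> \<rho> n a i j = 0" using local by metis
      define D where "D = (\<Sum>i\<le>degree v. Suc (degree (coeff v i)))"
      have deg: "(dcoeff ^^ j) v = 0" if "j \<ge> D" for j
      proof (rule poly_eqI)
        fix i
        show "coeff ((dcoeff ^^ j) v) i = coeff 0 i"
        proof (cases "i \<le> degree v")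
          case True
          then have "Suc (degree (coeff v i)) \<le> D" unfolding D_def by (intro member_le_sum) auto
          then show ?thesis using that by (simp add: coeff_dcoeff higher_pderiv_degree)
        next
          case False
          have "(pderiv ^^ j) 0 = (0 :: 'k poly)" by (induction j) simp_all
          then show ?thesis using False by (simp add: coeff_dcoeff coeff_eq_0)
        qed
      qed
      have "?act n a v = 0" if "n \<ge> n0 + D" for n
      proof -
        \<comment> \<open>Either \<open>j \<ge> D\<close>, and the derivative vanishes, or
          \<open>n - j \<ge> n0\<close>, and the matrix does.\<close>
        have "matp d (\<rho> (n - j) a) ((dcoeff ^^ j) v) = 0" for j
        proof (cases "j \<ge> D")
          case False
          then have "matp d (\<rho> (n - j) a) ((dcoeff ^^ j) v) = matp d (\<lambda>i j. 0) ((dcoeff ^^ j) v)"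
            by (intro matp_cong n0) (use that in auto)
          then show ?thesis by (simp add: matp_def)
        qed (simp add: deg matp_0)
        then show ?thesis by (simp add: matact_def pp.k.binsum_def)
      qed
      then have "{n. ?act n a v \<noteq> 0} \<subseteq> {..<n0 + D}" by (auto simp: not_le[symmetric])
      then show ?thesis by (rule finite_subset) simp
    qed
    show "?act n (D a) v = - smult (of_nat n) (?act (n - 1) a v)" for n a v
    proof -
      have "?act n (D a) v = pp.k.binsum n (\<lambda>j. - smult [:of_nat (n - j):] (matp d (\<rho> (n - 1 - j) a) ((dcoeff ^^ j) v)))"
        by (simp add: matact_def matp_rho_D del: of_nat_diff)
      also have "\<dots> = - smult [:of_nat n:] (?act (n - 1) a v)"
        unfolding pp.k.binsum_minus pp.k.binsum_coindex matact_def ..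
      finally show ?thesis by (simp only: k)
    qed
    show "?act n a (smult [:0, 1:] v) = smult [:0, 1:] (?act n a v) + smult (of_nat n) (?act (n - 1) a v)" for n a v
    proof -
      have "?act n a (smult [:0, 1:] v) =
          pp.k.binsum n (\<lambda>j. smult [:0, 1:] (matp d (\<rho> (n - j) a) ((dcoeff ^^ j) v))) +
          pp.k.binsum n (\<lambda>j. smult [:of_nat j:] (matp d (\<rho> (n - j) a) ((dcoeff ^^ (j - 1)) v)))"
        by (simp only: matact_def dcoeff_D matp_add matp_smult pp.k.binsum_add)
      also have "pp.k.binsum n (\<lambda>j. smult [:0, 1:] (matp d (\<rho> (n - j) a) ((dcoeff ^^ j) v))) = smult [:0, 1:] (?act n a v)"
        by (simp only: matact_def pp.k.binsum_def pp.scale_sum_right pp.D_k)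
      also have "pp.k.binsum n (\<lambda>j. smult [:of_nat j:] (matp d (\<rho> (n - j) a) ((dcoeff ^^ (j - 1)) v))) =
          pp.k.binsum n (\<lambda>j. smult [:of_nat j:] (matp d (\<rho> (n - 1 - (j - 1)) a) ((dcoeff ^^ (j - 1)) v)))"
      proof (rule pp.k.binsum_cong)
        fix j
        show "smult [:of_nat j:] (matp d (\<rho> (n - j) a) ((dcoeff ^^ (j - 1)) v)) =
            smult [:of_nat j:] (matp d (\<rho> (n - 1 - (j - 1)) a) ((dcoeff ^^ (j - 1)) v))"
          by (cases j) simp_all
      qed
      also have "\<dots> = smult [:of_nat n:] (?act (n - 1) a v)"
        unfolding matact_def by (rule pp.k.binsum_index)
      finally show ?thesis by (simp only: k)
    qed
    show "?act n a (?act m b v) - ?act m b (?act n a v) =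
        (\<Sum>s\<le>n. smult (of_nat (n choose s)) (?act (m + s) (br (n - s) a b) v))" for n a m b v
    proof -
      let ?w = "\<lambda>j. (dcoeff ^^ j) v"
      define G where "G s l = matp d (\<rho> (m + n - s - l) (br s a b)) (?w l)" for s l
      have comp: "?act n a (?act m b v) = pp.k.binsum n (\<lambda>j. pp.k.binsum m (\<lambda>l.
          matp d (\<rho> (n - j) a) (matp d (\<rho> (m - l) b) (?w (j + l)))))" for n a m b
        by (simp add: matact_def dcoeff_binsum matp_binsum dcoeff_matp funpow_add)
      have "?act n a (?act m b v) - ?act m b (?act n a v) =
          pp.k.binsum n (\<lambda>j. pp.k.binsum m (\<lambda>l.
            matp d (\<rho> (n - j) a) (matp d (\<rho> (m - l) b) (?w (j + l))) -
            matp d (\<rho> (m - l) b) (matp d (\<rho> (n - j) a) (?w (j + l)))))"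
        unfolding comp pp.k.binsum_diff
        by (subst (2) pp.k.binsum_swap) (simp only: add.commute)
      also have "\<dots> = pp.k.binsum n (\<lambda>j. pp.k.binsum m (\<lambda>l. pp.k.binsum (n - j) (\<lambda>s. G s (j + l))))"
        unfolding matp_rho_bracket G_def
      proof (intro pp.k.binsum_cong)
        fix j l s assume "j \<le> n" "l \<le> m" "s \<le> n - j"
        then have "n - j + (m - l) - s = m + n - s - (j + l)" by linarith
        then show "matp d (\<rho> (n - j + (m - l) - s) (br s a b)) (?w (j + l)) =
            matp d (\<rho> (m + n - s - (j + l)) (br s a b)) (?w (j + l))" by (rule arg_cong)
      qed
      also have "\<dots> = pp.k.binsum n (\<lambda>j. pp.k.binsum (n - j) (\<lambda>s. pp.k.binsum m (\<lambda>l. G s (j + l))))"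
        by (intro pp.k.binsum_cong pp.k.binsum_swap)
      also have "\<dots> = pp.k.binsum n (\<lambda>s. pp.k.binsum (n - s) (\<lambda>j. pp.k.binsum m (\<lambda>l. G s (j + l))))"
        by (rule pp.k.binsum_triangle_swap)
      also have "\<dots> = pp.k.binsum n (\<lambda>s. pp.k.binsum (n - s + m) (G s))"
        by (simp only: pp.k.binsum_binsum)
      also have "\<dots> = pp.k.binsum n (\<lambda>s. ?act (m + n - s) (br s a b) v)"
      proof (rule pp.k.binsum_cong)
        fix s assume "s \<le> n"
        then have "n - s + m = m + n - s" by simp
        then show "pp.k.binsum (n - s + m) (G s) = ?act (m + n - s) (br s a b) v"
          by (simp only: matact_def G_def[abs_def])
      qed
      also have "\<dots> = pp.k.binsum n (\<lambda>s. ?act (m + n - (n - s)) (br (n - s) a b) v)"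
        by (rule pp.k.binsum_reflect[symmetric])
      also have "\<dots> = pp.k.binsum n (\<lambda>s. ?act (m + s) (br (n - s) a b) v)"
        by (rule pp.k.binsum_cong) simp
      finally show ?thesis by (simp only: pp.k.binsum_def k)
    qed
  qed
  show "faithful ?M ?act"
    unfolding faithful_def
  proof (intro allI impI, rule faith)
    fix a n i j assume 0: "\<forall>n. \<forall>v\<in>?M. ?act n a v = 0" and ij: "i < d" "j < d"
    let ?v = "monom 1 j :: 'k poly poly"
    have "?v \<in> ?M" using ij by (auto simp: bounded_polys_def)
    then have z: "?act n a ?v = 0" using 0 by blast
    \<comment> \<open>On a basis vector of \<open>W\<close> all derivatives vanish, so the action
      reduces to the matrix of \<open>a t^n\<close>, and faithfulness is that of
      \<open>\<rho>\<close>.\<close>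
    have "(dcoeff ^^ l) ?v = 0" if "l > 0" for l
      using that by (intro poly_eqI) (simp add: coeff_dcoeff higher_pderiv_degree)
    then have "?act n a ?v = (\<Sum>l\<in>{0}. smult [:of_nat (n choose l):] (matp d (\<rho> (n - l) a) ((dcoeff ^^ l) ?v)))"
      unfolding matact_def pp.k.binsum_def
      by (intro sum.mono_neutral_right) (auto simp: matp_0)
    then have "coeff (matp d (\<rho> n a) ?v) i = 0" using z by simp
    then have "(\<Sum>l<d. smult (\<rho> n a i l) (if j = l then 1 else 0)) = 0" using ij by (simp add: coeff_matp)
    then have "smult (\<rho> n a i j) (1 :: 'k poly) = 0" using ij by (simp add: if_distrib cong: if_cong)
    then show "\<rho> n a i j = 0" by simp
  qed
qed

theorem theorem7:
  fixes scale :: "'k::field_char_0 poly \<Rightarrow> 'l::ab_group_add \<Rightarrow> 'l"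
    and br :: "nat \<Rightarrow> 'l \<Rightarrow> 'l \<Rightarrow> 'l"
  assumes "lie_conformal_algebra scale br"
    and "module.finitely_generated scale UNIV"
    and "module.torsion_free scale"
    and "conformal_algebra.solvable scale br"
  shows "\<exists>(M :: 'k poly poly set) act.
    conformal_representation scale br smult M act \<and>
    module.finitely_generated smult M \<and>
    module.free smult M \<and>
    faithful M act"
proof -
  interpret lie_conformal_algebra scale br by fact
  obtain d \<rho> where rep: "coefficient_rep d \<rho>"
    using coefficient_rep_exists[OF assms(2-4)] by (elim exE)
  let ?B = "(\<lambda>i. monom 1 i) ` {..<d} :: 'k poly poly set"
  have basis: "pp.independent ?B \<and> pp.span ?B = bounded_polys d" by (rule bounded_polys_basis)
  have "pp.finitely_generated (bounded_polys d :: 'k poly poly set)"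
    unfolding pp.finitely_generated_def using basis by (intro exI[of _ ?B]) simp
  moreover have "pp.free (bounded_polys d :: 'k poly poly set)"
    unfolding pp.free_def using basis by (intro exI[of _ ?B]) simp
  ultimately show ?thesis using matact_representation[OF rep] by blast
qed

end
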